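(* Let $1\le r\le n$. The $r\times r$ minors of an $n\times n$ symmetric matrix of indeterminates form a tropical basis when $r=2$, $r=3$, or $r=n$. They do not form a tropical basis when $4<r<n$, nor when $r=4$ and $n>12$.
   Context: Let $\tilde K$ be the field of Hahn series $\sum_{\alpha\in A}c_\alpha t^\alpha$ ($A\subset\mathbb R$ well-ordered, $c_\alpha\in\mathbb C$); for nonzero $a\in\tilde K$, $\deg(a)$ is the smallest exponent with nonzero coefficient. A symmetric lift of a real symmetric $n\times n$ matrix $A=(A_{i,j})$ is a symmetric matrix $\tilde A$ over $\tilde K$ with all entries nonzero and $\deg(\tilde a_{i,j})=A_{i,j}$. For an $r\times r$ submatrix of $A$ with row index set $I$ and column index set $J$, each bijection $\rho:I\to J$ gives a monomial $\prod_{i\in I}X_{i,\rho(i)}$ in commuting variables subject to the identification $X_{i,j}=X_{j,i}$, with value $\sum_{i\in I}A_{i,\rho(i)}$; the submatrix is symmetrically tropically singular if the minimum value is attained by at least two distinct monomials (distinct after the identification $X_{i,j}=X_{j,i}$). The symmetric tropical rank of $A$ is the largest $r$ such that $A$ has an $r\times r$ submatrix (arbitrary row and column sets) that is not symmetrically tropically singular; the symmetric Kapranov rank of $A$ is the minimum rank over $\tilde K$ of a symmetric lift of $A$. The $r\times r$ minors of an $n\times n$ symmetric matrix of indeterminates (the matrix $(x_{i,j})$ with $x_{i,j}=x_{j,i}$) form a tropical basis if the tropical prevariety cut out by the tropicalizations of these minors equals the tropicalization (image under coordinatewise $\deg$) of the variety they define in nonzero coordinates; equivalently, for every real symmetric $n\times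 n$ matrix $A$: every $r\times r$ submatrix of $A$ is symmetrically tropically singular if and only if $A$ has a symmetric lift of rank at most $r-1$ (i.e. symmetric tropical rank $\le r-1$ iff symmetric Kapranov rank $\le r-1$). *)

theory Defs
  imports Complex_Main "HOL-Library.Multiset" "HOL-Combinatorics.Permutations"
begin

text \<open>A Hahn series is represented by its coefficient function c :: real => complex,
  c alpha being the coefficient of t^alpha; its support must be well-ordered.\<close>

type_synonym hahn = "real \<Rightarrow> complex"

definition hsupp :: "hahn \<Rightarrow> real set" where
  "hsupp c = {\<alpha>. c \<alpha> \<noteq> 0}"

definition is_hahn :: "hahn \<Rightarrow> bool" where
  "is_hahn c \<longleftrightarrow> (\<forall>S. S \<subseteq> hsupp c \<and> S \<noteq> {} \<longrightarrow> (\<exists>m\<in>S. \<forall>x\<in>S. m \<le> x))"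

definition hdeg :: "hahn \<Rightarrow> real" where
  "hdeg c = (LEAST \<alpha>. c \<alpha> \<noteq> 0)"

text \<open>field operations (the sum in the product is finite for well-ordered supports)\<close>
definition hmul :: "hahn \<Rightarrow> hahn \<Rightarrow> hahn" where
  "hmul f g = (\<lambda>\<gamma>. \<Sum>\<alpha>\<in>{\<alpha>. f \<alpha> \<noteq> 0 \<and> g (\<gamma> - \<alpha>) \<noteq> 0}. f \<alpha> * g (\<gamma> - \<alpha>))"

definition hone :: hahn where
  "hone = (\<lambda>\<gamma>. if \<gamma> = 0 then 1 else 0)"

fun hprod_list :: "hahn list \<Rightarrow> hahn" where
  "hprod_list [] = hone"
| "hprod_list (x # xs) = hmul x (hprod_list xs)"

definition symmetric_mat :: "nat \<Rightarrow> (nat \<Rightarrow> nat \<Rightarrow> 'a) \<Rightarrow> bool" where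
  "symmetric_mat n A \<longleftrightarrow> (\<forall>i<n. \<forall>j<n. A i j = A j i)"

definition hminor :: "(nat \<Rightarrow> nat \<Rightarrow> hahn) \<Rightarrow> nat set \<Rightarrow> nat set \<Rightarrow> hahn" where
  "hminor L I J = (\<lambda>\<gamma>. \<Sum>p\<in>{p. p permutes {..<card I}}.
      of_int (sign p) * hprod_list
        (map (\<lambda>k. L (sorted_list_of_set I ! k) (sorted_list_of_set J ! p k)) [0..<card I]) \<gamma>)"

definition sym_lift :: "nat \<Rightarrow> (nat \<Rightarrow> nat \<Rightarrow> real) \<Rightarrow> (nat \<Rightarrow> nat \<Rightarrow> hahn) \<Rightarrow> bool" where
  "sym_lift n A L \<longleftrightarrow> symmetric_mat n L \<and>
     (\<forall>i<n. \<forall>j<n. is_hahn (L i j) \<and> L i j \<noteq> (\<lambda>_. 0) \<and> hdeg (L i j) = A i j)"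

definition hrank_le :: "nat \<Rightarrow> (nat \<Rightarrow> nat \<Rightarrow> hahn) \<Rightarrow> nat \<Rightarrow> bool" where
  "hrank_le n L k \<longleftrightarrow> (\<forall>I J. I \<subseteq> {..<n} \<and> J \<subseteq> {..<n} \<and> card I = Suc k \<and> card J = Suc k
       \<longrightarrow> hminor L I J = (\<lambda>_. 0))"

text \<open>monomial of a bijection rho: I -> J, as a multiset of unordered index pairs
  (implementing the identification X_ij = X_ji)\<close>
definition sym_monomial :: "nat set \<Rightarrow> (nat \<Rightarrow> nat) \<Rightarrow> nat set multiset" where
  "sym_monomial I \<rho> = image_mset (\<lambda>i. {i, \<rho> i}) (mset_set I)"

definition trop_value :: "(nat \<Rightarrow> nat \<Rightarrow> real) \<Rightarrow> nat set \<Rightarrow> (nat \<Rightarrow> nat) \<Rightarrow> real" where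
  "trop_value A I \<rho> = (\<Sum>i\<in>I. A i (\<rho> i))"

definition sym_trop_singular :: "(nat \<Rightarrow> nat \<Rightarrow> real) \<Rightarrow> nat set \<Rightarrow> nat set \<Rightarrow> bool" where
  "sym_trop_singular A I J \<longleftrightarrow>
     (\<exists>\<rho>1 \<rho>2. bij_betw \<rho>1 I J \<and> bij_betw \<rho>2 I J \<and>
        (\<forall>\<rho>. bij_betw \<rho> I J \<longrightarrow> trop_value A I \<rho>1 \<le> trop_value A I \<rho>) \<and>
        trop_value A I \<rho>2 = trop_value A I \<rho>1 \<and>
        sym_monomial I \<rho>1 \<noteq> sym_monomial I \<rho>2)"

definition sym_minors_tropical_basis :: "nat \<Rightarrow> nat \<Rightarrow> bool" where
  "sym_minors_tropical_basis n r \<longleftrightarrow>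
     (\<forall>A. symmetric_mat n A \<longrightarrow>
        ((\<forall>I J. I \<subseteq> {..<n} \<and> J \<subseteq> {..<n} \<and> card I = r \<and> card J = r \<longrightarrow> sym_trop_singular A I J)
         \<longleftrightarrow> (\<exists>L. sym_lift n A L \<and> hrank_le n L (r - 1))))"

end

(*
  Terms of a minor of a symmetric matrix that share a symmetric monomial differ by reversing cycles,
  hence have equal sign and cannot cancel; so a lift of rank < r forces every r x r submatrix to be
  symmetrically singular, and only the converse is at stake.

  r = 2: the matrix has entries a_i + a_j. r = 3: after scaling the diagonal to 0, the numbers
  max(0, -2 A_ij) form a pseudometric that embeds in the real line as points p_i, and
  A_ij + (p_i + p_j)/2 is the degree of z_i + z_j for suitable series z_i; the matrix (z_i + z_j) has
  rank 2. r = n: take generic coefficients, except at one position whose exponent differs in two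
  optimal monomials; the determinant is then a quadratic polynomial in that entry and has a root of
  the right degree, because Hahn series have square roots.

  The counterexamples come from a 6 x 6 matrix (r = 5) and a 13 x 13 matrix (r = 4) by two
  constructions: repeating the last row and column, and bordering by a large value with corner 0.
  For the 6 x 6 matrix, eliminating three pivots from a lift of rank 4 leaves a rank one matrix whose
  degrees contradict each other. The 13 x 13 matrix consists of the 3-adic valuations of a Gram matrix
  of integer vectors of rank 3, which makes it singular; the constant coefficients of a lift of rank 3
  would realize the projective plane of order 3 over the complex numbers.
*)
theory Submission
  imports Defs "Jordan_Normal_Form.Determinant" "HOL-Computational_Algebra.Formal_Power_Series"
    "HOL-Library.Nat_Bijection"
begin

section \<open>The field of Hahn series\<close>

text \<open>Symmetry makes 2 a natural multiplicity: reversing a long cycle of a bijection keeps its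
  monomial, and an off-diagonal variable can occur squared. The square is why r = n leads to a
  quadratic equation. The multiplicity is why the plane has order 3. A vanishing minor of the
  integer Gram matrix certifies singularity provided that the equal terms of one optimal monomial do
  not cancel modulo the prime; in a 4 x 4 minor there are one or two such terms. For the prime 2,
  where the plane has only 7 points, a term and its reversal would cancel. The plane of order 3 has
  coordinates in characteristic 3 but not over the complex numbers, and this gap separates the two
  ranks. For r = 3 the principal submatrices only say that in each triple one distance is the sum of
  the other two. Such a metric can fail to lie on a line only through four points that form a
  four-cycle with equal opposite sides (Menger); a submatrix that is not principal excludes
  these.\<close>

definition well_ordered :: "real set \<Rightarrow> bool" where
  "well_ordered A \<longleftrightarrow> (\<forall>S. S \<subseteq> A \<and> S \<noteq> {} \<longrightarrow> (\<exists>m\<in>S. \<forall>x\<in>S. m \<le> x))"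

lemma is_hahn_iff: "is_hahn c \<longleftrightarrow> well_ordered {a. c a \<noteq> 0}"
  by (simp add: is_hahn_def well_ordered_def hsupp_def)

lemma well_ordered_min:
  assumes "well_ordered A" "S \<subseteq> A" "S \<noteq> {}"
  obtains m where "m \<in> S" "\<And>x. x \<in> S \<Longrightarrow> m \<le> x"
proof -
  have "\<exists>m\<in>S. \<forall>x\<in>S. m \<le> x"
    using assms(1)[unfolded well_ordered_def, rule_format, of S] assms(2,3) by simp
  then show ?thesis using that by metis
qed

lemma well_ordered_subset:
  assumes "well_ordered B" "A \<subseteq> B" shows "well_ordered A"
  unfolding well_ordered_def
proof (intro allI impI, elim conjE)
  fix S assume "S \<subseteq> A" "S \<noteq> {}"
  then have "S \<subseteq> B" using assms(2) by simp
  from well_ordered_min[OF assms(1) this \<open>S \<noteq> {}\<close>] show "\<exists>m\<in>S. \<forall>x\<in>S. m \<le> x" by metis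
qed

lemma well_ordered_empty: "well_ordered {}"
  by (simp add: well_ordered_def)

lemma well_ordered_singleton: "well_ordered {a}"
  unfolding well_ordered_def by (auto simp: subset_singleton_iff)

lemma well_ordered_Un:
  assumes "well_ordered A" "well_ordered B" shows "well_ordered (A \<union> B)"
  unfolding well_ordered_def
proof (intro allI impI, elim conjE)
  fix S assume S: "S \<subseteq> A \<union> B" "S \<noteq> {}"
  show "\<exists>m\<in>S. \<forall>x\<in>S. m \<le> x"
  proof (cases "S \<inter> A = {} \<or> S \<inter> B = {}")
    case True
    then have "S \<subseteq> B \<or> S \<subseteq> A" using S by blast
    then show ?thesis using assms S unfolding well_ordered_def by blast
  next
    case False
    obtain a where a: "a \<in> S \<inter> A" "\<And>x. x \<in> S \<inter> A \<Longrightarrow> a \<le> x"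
      using well_ordered_min[OF assms(1), of "S \<inter> A"] False by blast
    obtain b where b: "b \<in> S \<inter> B" "\<And>x. x \<in> S \<inter> B \<Longrightarrow> b \<le> x"
      using well_ordered_min[OF assms(2), of "S \<inter> B"] False by blast
    have "min a b \<in> S" using a b by (simp add: min_def)
    moreover have "min a b \<le> x" if "x \<in> S" for x
      using a(2)[of x] b(2)[of x] S that by (auto simp: min_le_iff_disj)
    ultimately show ?thesis by blast
  qed
qed

lemma well_ordered_UN:
  "finite I \<Longrightarrow> (\<And>i. i \<in> I \<Longrightarrow> well_ordered (A i)) \<Longrightarrow> well_ordered (\<Union>i\<in>I. A i)"
  by (induction I rule: finite_induct) (auto simp: well_ordered_empty intro: well_ordered_Un)

lemma well_ordered_no_descent:
  assumes "well_ordered A" "\<And>n. f n \<in> A" "\<And>n. f (Suc n) < f n"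
  shows False
proof -
  have "range f \<subseteq> A" "range f \<noteq> {}" using assms(2) by auto
  then obtain m where m: "m \<in> range f" "\<And>x. x \<in> range f \<Longrightarrow> m \<le> x"
    using well_ordered_min[OF assms(1)] by blast
  from m(1) obtain k where k: "m = f k" by auto
  have "m \<le> f (Suc k)" by (rule m(2)) simp
  then show False using k assms(3)[of k] by simp
qed

text \<open>A set of sums without least element yields a strictly descending sequence
  \<open>a n + b n\<close>, with \<open>a\<close> monotone on a subsequence. If \<open>a\<close>
  increases there, \<open>b\<close> descends strictly. If \<open>a\<close> decreases, it becomes
  constant because \<open>A\<close> is well ordered, and again \<open>b\<close> descends
  strictly.\<close>

lemma well_ordered_plus:
  assumes A: "well_ordered A" and B: "well_ordered B"
  shows "well_ordered {a + b | a b. a \<in> A \<and> b \<in> B}"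
  unfolding well_ordered_def
proof (intro allI impI, elim conjE, rule ccontr)
  fix S assume S: "S \<subseteq> {a + b | a b. a \<in> A \<and> b \<in> B}" "S \<noteq> {}" and no: "\<not> (\<exists>m\<in>S. \<forall>x\<in>S. m \<le> x)"
  have step: "\<forall>x\<in>S. \<exists>y\<in>S. y < x" using no by (meson not_le)
  obtain g where g: "\<And>x. x \<in> S \<Longrightarrow> g x \<in> S \<and> g x < x" using step by metis
  obtain s0 where s0: "s0 \<in> S" using S by blast
  define s where "s n = (g ^^ n) s0" for n
  have sS: "s n \<in> S" for n by (induction n) (auto simp: s_def s0 g)
  have sd: "s (Suc n) < s n" for n using g[OF sS[of n]] by (simp add: s_def)
  have "\<forall>n. \<exists>a b. s n = a + b \<and> a \<in> A \<and> b \<in> B" using sS S by blast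
  then obtain a b where ab: "\<And>n. s n = a n + b n" "\<And>n. a n \<in> A" "\<And>n. b n \<in> B" by metis
  obtain r :: "nat \<Rightarrow> nat" where r: "strict_mono r" "monoseq (\<lambda>n. a (r n))"
    using seq_monosub[of a] by (auto simp: o_def)
  have sr: "s (r (Suc n)) < s (r n)" for n
  proof -
    have "r n < r (Suc n)" using r(1) by (simp add: strict_mono_def)
    moreover have "s y < s x" if "x < y" for x y
      using that by (induction rule: less_Suc_induct) (auto intro: sd less_trans)
    ultimately show ?thesis by blast
  qed
  show False
  proof (cases "\<forall>m n. m \<le> n \<longrightarrow> a (r m) \<le> a (r n)")
    case True
    then have "b (r (Suc n)) < b (r n)" for n using sr[of n] ab(1) True by (smt (verit) le_SucI order_refl)
    then show False using well_ordered_no_descent[OF B, of "\<lambda>n. b (r n)"] ab(3) by blast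
  next
    case False
    then have dec: "\<And>m n. m \<le> n \<Longrightarrow> a (r n) \<le> a (r m)" using r(2) unfolding monoseq_def by blast
    have "range (\<lambda>n. a (r n)) \<subseteq> A" "range (\<lambda>n. a (r n)) \<noteq> {}" using ab(2) by auto
    then obtain m where m: "m \<in> range (\<lambda>n. a (r n))" "\<And>x. x \<in> range (\<lambda>n. a (r n)) \<Longrightarrow> m \<le> x"
      using well_ordered_min[OF A] by blast
    from m(1) obtain N where N: "m = a (r N)" by auto
    have const: "a (r n) = m" if "n \<ge> N" for n
    proof -
      have "m \<le> a (r n)" by (rule m(2)) simp
      then show ?thesis using dec[OF that] N by simp
    qed
    have "b (r (Suc n + N)) < b (r (n + N))" for n
      using sr[of "n + N"] ab(1) const[of "n + N"] const[of "Suc n + N"] by auto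
    then show False using well_ordered_no_descent[OF B, of "\<lambda>n. b (r (n + N))"] ab(3) by auto
  qed
qed

text \<open>The set is well ordered, and reflection in \<open>g\<close> embeds it in
  \<open>B\<close>, so its nonempty subsets have greatest elements too. The least element with
  infinitely many predecessors would have a greatest predecessor, which has only finitely many. This
  makes convolution sums finite.\<close>

lemma finite_well_ordered_reverse:
  assumes A: "well_ordered A" and B: "well_ordered B"
  shows "finite {a \<in> A. g - a \<in> B}"
proof (rule ccontr)
  define T where "T = {a \<in> A. g - a \<in> B}"
  assume "infinite {a \<in> A. g - a \<in> B}"
  then have inf: "infinite T" by (simp add: T_def)
  have mx: "\<exists>m\<in>S. \<forall>x\<in>S. x \<le> m" if "S \<subseteq> T" "S \<noteq> {}" for S
  proof -
    have "(\<lambda>a. g - a) ` S \<subseteq> B" using that by (auto simp: T_def)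
    moreover have "(\<lambda>a. g - a) ` S \<noteq> {}" using that by blast
    ultimately obtain m where "m \<in> (\<lambda>a. g - a) ` S" "\<And>x. x \<in> (\<lambda>a. g - a) ` S \<Longrightarrow> m \<le> x"
      using well_ordered_min[OF B] by blast
    then show ?thesis by force
  qed
  define D where "D = {x \<in> T. finite {y \<in> T. y \<le> x}}"
  show False
  proof (cases "D = T")
    case True
    obtain m where m: "m \<in> T" "\<forall>x\<in>T. x \<le> m" using mx[of T] inf by (metis finite.emptyI order_refl)
    then have "{y \<in> T. y \<le> m} = T" by blast
    moreover have "m \<in> D" using True m(1) by simp
    ultimately show ?thesis using inf by (simp add: D_def)
  next
    case False
    have "T - D \<noteq> {}" "T - D \<subseteq> A" using False by (auto simp: D_def T_def)
    then obtain x where x: "x \<in> T - D" "\<And>y. y \<in> T - D \<Longrightarrow> x \<le> y"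
      using well_ordered_min[OF A] by blast
    have sub: "{y \<in> T. y < x} \<subseteq> D" using x by force
    have "finite {y \<in> T. y \<le> x}"
    proof (cases "{y \<in> T. y < x} = {}")
      case True
      then have "{y \<in> T. y \<le> x} \<subseteq> {x}" by auto
      then show ?thesis by (meson finite.simps finite_subset)
    next
      case False
      then obtain z where z: "z \<in> {y \<in> T. y < x}" "\<forall>y\<in>{y \<in> T. y < x}. y \<le> z" using mx by (metis (mono_tags, lifting) mem_Collect_eq subsetI)
      then have "{y \<in> T. y \<le> x} \<subseteq> insert x {y \<in> T. y \<le> z}" by force
      moreover have "finite {y \<in> T. y \<le> z}" using sub z by (auto simp: D_def)
      ultimately show ?thesis by (meson finite.insertI finite_subset)
    qed
    then show False using x by (auto simp: D_def)
  qed
qed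

section \<open>The commutative ring of Hahn series\<close>

typedef hahn_series = "{c. is_hahn c}"
  morphisms coef Abs_hs
proof
  show "(\<lambda>_. 0) \<in> {c. is_hahn c}" by (simp add: is_hahn_iff well_ordered_empty)
qed

lemma well_ordered_coef: "well_ordered {a. coef x a \<noteq> 0}"
  using coef[of x] by (simp add: is_hahn_iff)

lemma coef_Abs: "well_ordered {a. c a \<noteq> 0} \<Longrightarrow> coef (Abs_hs c) = c"
  by (simp add: Abs_hs_inverse is_hahn_iff)

lemma hs_eqI: "(\<And>a. coef x a = coef y a) \<Longrightarrow> x = y"
  by (simp add: coef_inject[symmetric] fun_eq_iff)

lemma finite_conv_support: "finite {a. coef x a \<noteq> 0 \<and> coef y (g - a) \<noteq> 0}"
  using finite_well_ordered_reverse[OF well_ordered_coef[of x] well_ordered_coef[of y]] by simp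

lemma hmul_superset:
  assumes "finite T" "{a. coef x a \<noteq> 0 \<and> coef y (g - a) \<noteq> 0} \<subseteq> T"
  shows "hmul (coef x) (coef y) g = (\<Sum>a\<in>T. coef x a * coef y (g - a))"
  unfolding hmul_def by (rule sum.mono_neutral_left) (use assms in auto)

lemma hmul_support:
  "{c. hmul f g c \<noteq> 0} \<subseteq> {a + b | a b. a \<in> {a. f a \<noteq> 0} \<and> b \<in> {b. g b \<noteq> 0}}"
proof
  fix c assume "c \<in> {c. hmul f g c \<noteq> 0}"
  then have "{a. f a \<noteq> 0 \<and> g (c - a) \<noteq> 0} \<noteq> {}" unfolding hmul_def by (metis (mono_tags) mem_Collect_eq sum.empty)
  then obtain a where "f a \<noteq> 0" "g (c - a) \<noteq> 0" by blast
  moreover have "c = a + (c - a)" by simp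
  ultimately show "c \<in> {a + b | a b. a \<in> {a. f a \<noteq> 0} \<and> b \<in> {b. g b \<noteq> 0}}" by blast
qed

definition monom_hs :: "real \<Rightarrow> complex \<Rightarrow> hahn_series" where
  "monom_hs d c = Abs_hs (\<lambda>a. if a = d then c else 0)"

lemma coef_monom: "coef (monom_hs d c) a = (if a = d then c else 0)"
proof -
  have "well_ordered {a. (if a = d then c else 0) \<noteq> 0}"
    by (rule well_ordered_subset[OF well_ordered_singleton[of d]]) auto
  then show ?thesis unfolding monom_hs_def by (simp add: coef_Abs)
qed

instantiation hahn_series :: comm_ring_1
begin
definition "0 = Abs_hs (\<lambda>_. 0)"
definition "1 = Abs_hs hone"
definition "x + y = Abs_hs (\<lambda>a. coef x a + coef y a)"
definition "- x = Abs_hs (\<lambda>a. - coef x a)"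
definition "(x :: hahn_series) - y = x + - y"
definition "x * y = Abs_hs (hmul (coef x) (coef y))"

lemma coef_0 [simp]: "coef 0 a = 0"
  by (simp add: zero_hahn_series_def coef_Abs well_ordered_empty)
lemma coef_add [simp]: "coef (x + y) a = coef x a + coef y a"
proof -
  have "well_ordered {a. coef x a + coef y a \<noteq> 0}"
    by (rule well_ordered_subset[OF well_ordered_Un[OF well_ordered_coef[of x] well_ordered_coef[of y]]]) auto
  then show ?thesis by (simp add: plus_hahn_series_def coef_Abs)
qed
lemma coef_uminus [simp]: "coef (- x) a = - coef x a"
  by (simp add: uminus_hahn_series_def coef_Abs well_ordered_coef)
lemma coef_minus [simp]: "coef (x - y) a = coef x a - coef y a"
  by (simp add: minus_hahn_series_def)
lemma coef_1: "coef 1 = hone"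
proof -
  have "well_ordered {a. hone a \<noteq> 0}"
    by (rule well_ordered_subset[OF well_ordered_singleton[of 0]]) (auto simp: hone_def)
  then show ?thesis by (simp add: one_hahn_series_def coef_Abs)
qed
lemma coef_mult: "coef (x * y) = hmul (coef x) (coef y)"
proof -
  have "well_ordered {c. hmul (coef x) (coef y) c \<noteq> 0}"
    by (rule well_ordered_subset[OF well_ordered_plus[OF well_ordered_coef[of x] well_ordered_coef[of y]] hmul_support])
  then show ?thesis by (simp add: times_hahn_series_def coef_Abs)
qed

lemma hs_mult_commute: "x * y = (y :: hahn_series) * x"
proof (rule hs_eqI)
  fix g
  show "coef (x * y) g = coef (y * x) g"
    unfolding coef_mult hmul_def
    by (rule sum.reindex_bij_witness[of _ "\<lambda>a. g - a" "\<lambda>a. g - a"]) auto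
qed

text \<open>Both sides sum over the finitely many ways to write \<open>g\<close> as a sum of three
  exponents from the supports of \<open>x\<close>, \<open>y\<close>, \<open>z\<close>.
  \<open>B\<close> holds the possible sums of the first two exponents, \<open>A\<close> the possible
  first exponents.\<close>

lemma hs_mult_assoc: "(x * y) * z = x * (y * (z :: hahn_series))"
proof (rule hs_eqI)
  fix g
  let ?X = "{a. coef x a \<noteq> 0}" let ?Y = "{a. coef y a \<noteq> 0}" let ?Z = "{a. coef z a \<noteq> 0}"
  let ?XY = "{a + b | a b. a \<in> ?X \<and> b \<in> ?Y}"
  let ?YZ = "{a + b | a b. a \<in> ?Y \<and> b \<in> ?Z}"
  define B where "B = {b \<in> ?XY. g - b \<in> ?Z}"
  have finB: "finite B" unfolding B_def
    by (rule finite_well_ordered_reverse[OF well_ordered_plus[OF well_ordered_coef well_ordered_coef] well_ordered_coef])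
  define A where "A = {a \<in> ?X. g - a \<in> ?YZ}"
  have finA: "finite A" unfolding A_def
    by (rule finite_well_ordered_reverse[OF well_ordered_coef well_ordered_plus[OF well_ordered_coef well_ordered_coef]])
  have "coef (x * y * z) g = (\<Sum>b\<in>B. coef (x * y) b * coef z (g - b))"
    unfolding coef_mult[of "x * y"]
  proof (rule hmul_superset[OF finB])
    show "{a. coef (x * y) a \<noteq> 0 \<and> coef z (g - a) \<noteq> 0} \<subseteq> B"
      using hmul_support[of "coef x" "coef y"] unfolding B_def coef_mult by blast
  qed
  also have "\<dots> = (\<Sum>b\<in>B. \<Sum>a\<in>{a. coef x a \<noteq> 0 \<and> coef y (b - a) \<noteq> 0}. coef x a * coef y (b - a) * coef z (g - b))"
    unfolding coef_mult hmul_def sum_distrib_right ..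
  also have "\<dots> = (\<Sum>(b,a)\<in>Sigma B (\<lambda>b. {a. coef x a \<noteq> 0 \<and> coef y (b - a) \<noteq> 0}). coef x a * coef y (b - a) * coef z (g - b))"
    by (rule sum.Sigma) (use finB finite_conv_support in auto)
  also have "\<dots> = (\<Sum>(a,d)\<in>Sigma A (\<lambda>a. {d. coef y d \<noteq> 0 \<and> coef z (g - a - d) \<noteq> 0}). coef x a * (coef y d * coef z (g - a - d)))"
  proof (rule sum.reindex_bij_witness[of _ "\<lambda>(a,d). (a + d, a)" "\<lambda>(b,a). (a, b - a)"], goal_cases)
    case (2 p)
    obtain b a where p: "p = (b, a)" by fastforce
    have g: "g - a = (b - a) + (g - b)" "g - a - (b - a) = g - b" by simp_all
    have "coef z (g - b) \<noteq> 0" "coef y (b - a) \<noteq> 0" "coef x a \<noteq> 0" using 2 by (auto simp: p B_def)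
    then have "a \<in> A" unfolding A_def using g(1) by blast
    then show ?case using \<open>coef z (g - b) \<noteq> 0\<close> \<open>coef y (b - a) \<noteq> 0\<close> unfolding p by (simp add: g(2))
  next
    case (4 p)
    obtain a d where p: "p = (a, d)" by fastforce
    show ?case using 4 unfolding p A_def B_def by (auto simp: algebra_simps)
  qed (auto simp: algebra_simps)
  also have "\<dots> = (\<Sum>a\<in>A. \<Sum>d\<in>{d. coef y d \<noteq> 0 \<and> coef z (g - a - d) \<noteq> 0}. coef x a * (coef y d * coef z (g - a - d)))"
    by (rule sum.Sigma[symmetric]) (use finA finite_conv_support in auto)
  also have "\<dots> = (\<Sum>a\<in>A. coef x a * coef (y * z) (g - a))"
    unfolding coef_mult hmul_def sum_distrib_left ..
  also have "\<dots> = coef (x * (y * z)) g"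
    unfolding coef_mult[of x "y * z"]
  proof (rule hmul_superset[OF finA, symmetric])
    show "{a. coef x a \<noteq> 0 \<and> coef (y * z) (g - a) \<noteq> 0} \<subseteq> A"
      using hmul_support[of "coef y" "coef z"] unfolding A_def coef_mult by blast
  qed
  finally show "coef (x * y * z) g = coef (x * (y * z)) g" .
qed

lemma hs_distrib: "(x + y) * z = x * z + y * (z :: hahn_series)"
proof (rule hs_eqI)
  fix g
  let ?T = "{a. coef x a \<noteq> 0 \<and> coef z (g - a) \<noteq> 0} \<union> {a. coef y a \<noteq> 0 \<and> coef z (g - a) \<noteq> 0}"
  have fin: "finite ?T" using finite_conv_support by simp
  have "hmul (coef (x + y)) (coef z) g = (\<Sum>a\<in>?T. coef (x + y) a * coef z (g - a))"
    by (rule hmul_superset[OF fin]) auto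
  moreover have "hmul (coef x) (coef z) g = (\<Sum>a\<in>?T. coef x a * coef z (g - a))"
    by (rule hmul_superset[OF fin]) auto
  moreover have "hmul (coef y) (coef z) g = (\<Sum>a\<in>?T. coef y a * coef z (g - a))"
    by (rule hmul_superset[OF fin]) auto
  ultimately show "coef ((x + y) * z) g = coef (x * z + y * z) g"
    by (simp add: coef_mult sum.distrib distrib_right)
qed

lemma hs_mult_1: "1 * x = (x :: hahn_series)"
proof (rule hs_eqI)
  fix g
  have "coef (1 * x) g = (\<Sum>a\<in>{0}. coef 1 a * coef x (g - a))"
    unfolding coef_mult by (rule hmul_superset) (auto simp: coef_1 hone_def split: if_splits)
  then show "coef (1 * x) g = coef x g" by (simp add: coef_1 hone_def)
qed

instance
proof
  fix a b c :: hahn_series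
  show "a + b + c = a + (b + c)" "a + b = b + a" "0 + a = a" "- a + a = 0" by (auto intro!: hs_eqI)
  show "a - b = a + - b" by (rule minus_hahn_series_def)
  show "a * b * c = a * (b * c)" by (rule hs_mult_assoc)
  show "a * b = b * a" by (rule hs_mult_commute)
  show "1 * a = a" by (rule hs_mult_1)
  show "(a + b) * c = a * c + b * c" by (rule hs_distrib)
  show "(0::hahn_series) \<noteq> 1"
  proof
    assume "(0::hahn_series) = 1"
    then have "coef 0 0 = coef 1 0" by simp
    then show False by (simp add: coef_1 hone_def)
  qed
qed
end

lemma coef_sum [simp]: "coef (\<Sum>i\<in>I. f i) a = (\<Sum>i\<in>I. coef (f i) a)"
  by (induction I rule: infinite_finite_induct) auto

section \<open>Leading terms\<close>

definition lead :: "real \<Rightarrow> complex \<Rightarrow> hahn_series \<Rightarrow> bool" where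
  "lead d c x \<longleftrightarrow> (\<forall>a<d. coef x a = 0) \<and> coef x d = c"

text \<open>\<open>lead d c x\<close> says \<open>x = c t\<^sup>d + higher terms\<close>; \<open>c\<close> may vanish, so that \<open>lead d 0 x\<close> only bounds
  the degree of \<open>x\<close> from below.\<close>

lemma lead_monom: "lead d c (monom_hs d c)"
  by (simp add: lead_def coef_monom)

lemma lead_0: "lead d 0 0"
  by (simp add: lead_def)

lemma lead_1: "lead 0 1 1"
  by (simp add: lead_def coef_1 hone_def)

lemma lead_add: "lead d c x \<Longrightarrow> lead d c' y \<Longrightarrow> lead d (c + c') (x + y)"
  by (simp add: lead_def)

lemma lead_uminus: "lead d c x \<Longrightarrow> lead d (- c) (- x)"
  by (simp add: lead_def)

lemma lead_diff: "lead d c x \<Longrightarrow> lead d c' y \<Longrightarrow> lead d (c - c') (x - y)"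
  by (simp add: lead_def)

lemma lead_sum: "(\<And>i. i \<in> I \<Longrightarrow> lead d (c i) (x i)) \<Longrightarrow> lead d (\<Sum>i\<in>I. c i) (\<Sum>i\<in>I. x i)"
  by (auto simp: lead_def)

lemma lead_less: "lead d c x \<Longrightarrow> e < d \<Longrightarrow> lead e 0 x"
  by (auto simp: lead_def)

lemma lead_mult:
  assumes "lead d c x" "lead e c' y" shows "lead (d + e) (c * c') (x * y)"
proof -
  have "coef (x * y) a = 0" if "a < d + e" for a
  proof -
    have "{b. coef x b \<noteq> 0 \<and> coef y (a - b) \<noteq> 0} = {}"
      using assms that unfolding lead_def by (smt (verit) empty_Collect_eq)
    then show ?thesis unfolding coef_mult hmul_def by (metis (no_types) sum.empty)
  qed
  moreover have "coef (x * y) (d + e) = (\<Sum>b\<in>{d}. coef x b * coef y (d + e - b))"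
    unfolding coef_mult
  proof (rule hmul_superset)
    show "{b. coef x b \<noteq> 0 \<and> coef y (d + e - b) \<noteq> 0} \<subseteq> {d}"
    proof
      fix b assume b: "b \<in> {b. coef x b \<noteq> 0 \<and> coef y (d + e - b) \<noteq> 0}"
      have "\<not> b < d" "\<not> d + e - b < e" using b assms unfolding lead_def by blast+
      then show "b \<in> {d}" by simp
    qed
  qed simp
  ultimately show ?thesis using assms by (simp add: lead_def)
qed

lemma lead_prod:
  "finite I \<Longrightarrow> (\<And>i. i \<in> I \<Longrightarrow> lead (d i) (c i) (x i)) \<Longrightarrow> lead (\<Sum>i\<in>I. d i) (\<Prod>i\<in>I. c i) (\<Prod>i\<in>I. x i)"
  by (induction I rule: finite_induct) (auto intro: lead_1 lead_mult)

lemma lead_nonzero: "lead d c x \<Longrightarrow> c \<noteq> 0 \<Longrightarrow> x \<noteq> 0"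
  by (auto simp: lead_def)

lemma lead_unique: "lead d c x \<Longrightarrow> lead e c' x \<Longrightarrow> c \<noteq> 0 \<Longrightarrow> c' \<noteq> 0 \<Longrightarrow> d = e"
  by (metis lead_def linorder_neqE)

lemma lead_exists:
  assumes "x \<noteq> 0" obtains d c where "c \<noteq> 0" "lead d c x"
proof -
  have "{a. coef x a \<noteq> 0} \<noteq> {}" using assms by (auto intro: hs_eqI)
  then obtain m where "m \<in> {a. coef x a \<noteq> 0}" "\<And>a. a \<in> {a. coef x a \<noteq> 0} \<Longrightarrow> m \<le> a"
    using well_ordered_min[OF well_ordered_coef] by blast
  then have "lead m (coef x m) x" "coef x m \<noteq> 0" unfolding lead_def by fastforce+
  then show ?thesis using that by blast
qed

lemma lead_iff_hdeg:
  assumes "x \<noteq> 0" shows "hdeg (coef x) = d \<longleftrightarrow> (\<exists>c. c \<noteq> 0 \<and> lead d c x)"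
proof -
  have *: "hdeg (coef x) = d" if "c \<noteq> 0" "lead d c x" for c d
    unfolding hdeg_def using that by (intro Least_equality) (auto simp: lead_def, meson not_le)
  then show ?thesis using lead_exists[OF assms] by metis
qed

lemma monom_mult: "monom_hs a c * monom_hs b d = monom_hs (a + b) (c * d)"
proof (rule hs_eqI)
  fix g
  have "coef (monom_hs a c * monom_hs b d) g = (\<Sum>x\<in>{a}. coef (monom_hs a c) x * coef (monom_hs b d) (g - x))"
    unfolding coef_mult by (rule hmul_superset) (auto simp: coef_monom split: if_splits)
  then show "coef (monom_hs a c * monom_hs b d) g = coef (monom_hs (a + b) (c * d)) g" by (auto simp: coef_monom)
qed

lemma monom_1: "monom_hs 0 1 = 1"
  by (rule hs_eqI) (simp add: coef_monom coef_1 hone_def)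

lemma monom_sum: "monom_hs a (\<Sum>i\<in>I. f i) = (\<Sum>i\<in>I. monom_hs a (f i))"
  by (rule hs_eqI) (auto simp: coef_monom)

section \<open>Substitution of a series of positive order into a formal power series\<close>

definition order_ge :: "real \<Rightarrow> hahn_series \<Rightarrow> bool" where
  "order_ge d x \<longleftrightarrow> (\<forall>a<d. coef x a = 0)"

lemma order_ge_mono: "order_ge d x \<Longrightarrow> e \<le> d \<Longrightarrow> order_ge e x"
  by (auto simp: order_ge_def)

lemma order_ge_mult:
  assumes "order_ge d x" "order_ge e y" shows "order_ge (d + e) (x * y)"
proof -
  have "lead d (coef x d) x" "lead e (coef y e) y" using assms by (auto simp: lead_def order_ge_def)
  from lead_mult[OF this] show ?thesis by (simp add: lead_def order_ge_def)
qed

lemma order_ge_add: "order_ge d x \<Longrightarrow> order_ge d y \<Longrightarrow> order_ge d (x + y)"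
  by (simp add: order_ge_def)

lemma order_ge_diff: "order_ge d x \<Longrightarrow> order_ge d y \<Longrightarrow> order_ge d (x - y)"
  by (simp add: order_ge_def)

lemma order_ge_sum: "(\<And>i. i \<in> I \<Longrightarrow> order_ge d (x i)) \<Longrightarrow> order_ge d (\<Sum>i\<in>I. x i)"
  by (auto simp: order_ge_def)

lemma order_ge_monom: "order_ge d (monom_hs d c)"
  by (simp add: order_ge_def coef_monom)

lemma order_ge_power: "order_ge m x \<Longrightarrow> order_ge (real n * m) (x ^ n)"
proof (induction n)
  case 0
  then show ?case by (simp add: order_ge_def coef_1 hone_def)
next
  case (Suc n)
  then show ?case using order_ge_mult[of m x "real n * m" "x ^ n"] by (simp add: algebra_simps)
qed

text \<open>Equality of series can thus be tested modulo higher and higher order; this takes the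
  place of convergence below.\<close>

lemma order_ge_all_zero:
  assumes "0 < m" "\<And>N :: nat. order_ge (real N * m) x" shows "x = 0"
proof (rule hs_eqI)
  fix a
  obtain N :: nat where "a < real N * m" using ex_less_of_nat_mult[OF assms(1)] by blast
  then show "coef x a = coef 0 a" using assms(2) by (auto simp: order_ge_def)
qed

text \<open>Partial sums of \<open>f\<close> at \<open>x\<close>. For \<open>x\<close> of order at
  least \<open>m > 0\<close> the value of \<open>f\<close> at \<open>x\<close> is characterized as
  the series that differs from the \<open>N\<close>-th partial sum only at order
  \<open>N * m\<close> or more, for every \<open>N\<close>.\<close>

definition fps_trunc_eval :: "complex fps \<Rightarrow> hahn_series \<Rightarrow> nat \<Rightarrow> hahn_series" where
  "fps_trunc_eval f x N = (\<Sum>n<N. monom_hs 0 (fps_nth f n) * x ^ n)"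

text \<open>At exponent \<open>a\<close> only the powers with \<open>real n * m \<le> a\<close>
  contribute, so each coefficient is a finite sum. Up to any bound the support lies in a finite
  union of well-ordered supports, which suffices for least elements.\<close>

lemma fps_eval_exists:
  assumes m: "0 < m" and x: "order_ge m x"
  obtains y where "\<And>N. order_ge (real N * m) (y - fps_trunc_eval f x N)"
proof -
  define c where "c a = (\<Sum>n\<in>{n. real n * m \<le> a}. coef (monom_hs 0 (fps_nth f n) * x ^ n) a)" for a
  have fin: "finite {n. real n * m \<le> a}" for a
  proof -
    have "{n. real n * m \<le> a} \<subseteq> {..nat \<lceil>a / m\<rceil>}"
    proof
      fix n assume "n \<in> {n. real n * m \<le> a}"
      then have "real n \<le> a / m" using m by (simp add: field_simps)
      then show "n \<in> {..nat \<lceil>a / m\<rceil>}" by (simp add: nat_le_iff) linarith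
    qed
    then show ?thesis using finite_subset by blast
  qed
  have van: "coef (monom_hs 0 (fps_nth f n) * x ^ n) a = 0" if "a < real n * m" for n a
    using order_ge_mult[OF order_ge_monom order_ge_power[OF x, of n], of 0] that by (simp add: order_ge_def)
  have "well_ordered {a. c a \<noteq> 0}"
    unfolding well_ordered_def
  proof (intro allI impI, elim conjE)
    fix S assume S: "S \<subseteq> {a. c a \<noteq> 0}" "S \<noteq> {}"
    then obtain s where s: "s \<in> S" by blast
    let ?U = "\<Union>n\<in>{n. real n * m \<le> s}. {a. coef (monom_hs 0 (fps_nth f n) * x ^ n) a \<noteq> 0}"
    have wo: "well_ordered ?U" by (rule well_ordered_UN[OF fin well_ordered_coef])
    have sub: "S \<inter> {..s} \<subseteq> ?U"
    proof
      fix a assume a: "a \<in> S \<inter> {..s}"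
      then have "c a \<noteq> 0" using S by blast
      then obtain n where n: "real n * m \<le> a" "coef (monom_hs 0 (fps_nth f n) * x ^ n) a \<noteq> 0"
        unfolding c_def by (metis (mono_tags, lifting) mem_Collect_eq sum.not_neutral_contains_not_neutral)
      then have "n \<in> {n. real n * m \<le> s}" using a by auto
      then show "a \<in> ?U" using n(2) by blast
    qed
    have ne: "S \<inter> {..s} \<noteq> {}" using s by auto
    obtain k where k: "k \<in> S \<inter> {..s}" "\<And>y. y \<in> S \<inter> {..s} \<Longrightarrow> k \<le> y"
      by (rule well_ordered_min[OF wo sub ne]) blast
    have "k \<le> y" if "y \<in> S" for y
      using k(1) k(2)[of y] that by (cases "y \<le> s") auto
    then show "\<exists>k\<in>S. \<forall>y\<in>S. k \<le> y" using k(1) by blast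
  qed
  then have c: "coef (Abs_hs c) = c" by (rule coef_Abs)
  have "order_ge (real N * m) (Abs_hs c - fps_trunc_eval f x N)" for N
    unfolding order_ge_def
  proof (intro allI impI)
    fix a assume a: "a < real N * m"
    have "c a = (\<Sum>n<N. coef (monom_hs 0 (fps_nth f n) * x ^ n) a)"
      unfolding c_def
    proof (rule sum.mono_neutral_left)
      show "{n. real n * m \<le> a} \<subseteq> {..<N}"
      proof
        fix n assume "n \<in> {n. real n * m \<le> a}"
        then have "real n * m < real N * m" using a by simp
        then show "n \<in> {..<N}" using m by simp
      qed
      show "\<forall>i\<in>{..<N} - {n. real n * m \<le> a}. coef (monom_hs 0 (fps_nth f i) * x ^ i) a = 0"
        using van by auto
    qed simp
    then show "coef (Abs_hs c - fps_trunc_eval f x N) a = 0"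
      by (simp add: c fps_trunc_eval_def)
  qed
  then show ?thesis using that by blast
qed

lemma fps_trunc_eval_mult:
  assumes x: "order_ge m x" and m: "0 < m"
  shows "order_ge (real N * m) (fps_trunc_eval f x N * fps_trunc_eval g x N - fps_trunc_eval (f * g) x N)"
proof -
  define t where "t i j = monom_hs 0 (fps_nth f i * fps_nth g j) * x ^ (i + j)" for i j
  have "fps_trunc_eval f x N * fps_trunc_eval g x N = (\<Sum>(i,j)\<in>{..<N} \<times> {..<N}. t i j)"
    unfolding fps_trunc_eval_def sum_product t_def sum.cartesian_product
    by (rule sum.cong) (auto simp: power_add monom_mult[of 0 _ 0, simplified, symmetric] mult_ac)
  also have "\<dots> = (\<Sum>(i,j)\<in>{(i,j). i + j < N}. t i j) + (\<Sum>(i,j)\<in>{..<N} \<times> {..<N} - {(i,j). i + j < N}. t i j)"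
    by (subst add.commute, rule sum.subset_diff) auto
  also have "(\<Sum>(i,j)\<in>{(i,j). i + j < N}. t i j) = (\<Sum>k<N. \<Sum>i\<le>k. t i (k - i))"
    by (rule sum.triangle_reindex)
  also have "\<dots> = fps_trunc_eval (f * g) x N"
    unfolding fps_trunc_eval_def t_def
    by (rule sum.cong) (auto simp: fps_mult_nth monom_sum sum_distrib_right atLeast0AtMost intro!: sum.cong)
  finally have "fps_trunc_eval f x N * fps_trunc_eval g x N - fps_trunc_eval (f * g) x N
      = (\<Sum>(i,j)\<in>{..<N} \<times> {..<N} - {(i,j). i + j < N}. t i j)" by simp
  also have "order_ge (real N * m) \<dots>"
  proof (rule order_ge_sum)
    fix p assume p: "p \<in> {..<N} \<times> {..<N} - {(i,j). i + j < N}"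
    obtain i j where ij: "p = (i,j)" by fastforce
    have "order_ge (real (i + j) * m) (t i j)" unfolding t_def
      using order_ge_mult[OF order_ge_monom order_ge_power[OF x]] by (metis add_0)
    moreover have "real N * m \<le> real (i + j) * m" using p ij m by (simp add: mult_right_mono)
    ultimately show "order_ge (real N * m) (case p of (i,j) \<Rightarrow> t i j)" using ij order_ge_mono by auto
  qed
  finally show ?thesis .
qed

text \<open>Modulo order \<open>N * m\<close> both sides are products of partial sums, for every
  \<open>N\<close>, so they coincide. Multiplicative identities between formal power series thereby
  become identities between Hahn series.\<close>

lemma fps_eval_mult:
  assumes m: "0 < m" and x: "order_ge m x"
    and y: "\<And>N. order_ge (real N * m) (y - fps_trunc_eval f x N)"
    and z: "\<And>N. order_ge (real N * m) (z - fps_trunc_eval g x N)"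
    and w: "\<And>N. order_ge (real N * m) (w - fps_trunc_eval (f * g) x N)"
  shows "y * z = w"
proof -
  have "order_ge (real N * m) (y * z - w)" for N
  proof -
    have tr: "order_ge 0 (fps_trunc_eval h x N)" for h N
      unfolding fps_trunc_eval_def
    proof (rule order_ge_sum)
      fix n
      show "order_ge 0 (monom_hs 0 (fps_nth h n) * x ^ n)"
        using order_ge_mult[OF order_ge_monom order_ge_power[OF x]]
        by (rule order_ge_mono) (use m in simp)
    qed
    let ?y = "fps_trunc_eval f x N" let ?z = "fps_trunc_eval g x N" let ?w = "fps_trunc_eval (f * g) x N"
    have z0: "order_ge 0 z" using z[of 0] by (simp add: fps_trunc_eval_def)
    have "y * z - w = (y - ?y) * z + ?y * (z - ?z) + (?y * ?z - ?w) - (w - ?w)" by (simp add: algebra_simps)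
    moreover have "order_ge (real N * m) ((y - ?y) * z)" using order_ge_mult[OF y z0] by simp
    moreover have "order_ge (real N * m) (?y * (z - ?z))" using order_ge_mult[OF tr z] by simp
    moreover have "order_ge (real N * m) (?y * ?z - ?w)" by (rule fps_trunc_eval_mult[OF x m])
    ultimately show ?thesis using w[of N] by (metis order_ge_add order_ge_diff)
  qed
  then show ?thesis using order_ge_all_zero[OF m, of "y * z - w"] by simp
qed

lemma fps_eval_finite:
  assumes m: "0 < m" and x: "order_ge m x" and f: "\<And>n. n \<ge> K \<Longrightarrow> fps_nth f n = 0"
  shows "order_ge (real N * m) (fps_trunc_eval f x K - fps_trunc_eval f x N)"
proof -
  have zero: "monom_hs 0 0 = 0" by (rule hs_eqI) (simp add: coef_monom)
  show ?thesis
  proof (cases "K \<le> N")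
    case True
    have "fps_trunc_eval f x K = fps_trunc_eval f x N" unfolding fps_trunc_eval_def
      by (rule sum.mono_neutral_left) (use True f zero in auto)
    then show ?thesis by (simp add: order_ge_def)
  next
    case False
    have "{..<K} = {..<N} \<union> {N..<K}" using False by auto
    then have "fps_trunc_eval f x K - fps_trunc_eval f x N = (\<Sum>n\<in>{N..<K}. monom_hs 0 (fps_nth f n) * x ^ n)"
      unfolding fps_trunc_eval_def by (simp add: sum.union_disjoint ivl_disj_int)
    also have "order_ge (real N * m) \<dots>"
    proof (rule order_ge_sum)
      fix n assume "n \<in> {N..<K}"
      then have "real N * m \<le> 0 + real n * m" using m by (simp add: mult_right_mono)
      then show "order_ge (real N * m) (monom_hs 0 (fps_nth f n) * x ^ n)"
        using order_ge_mult[OF order_ge_monom order_ge_power[OF x]] order_ge_mono by blast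
    qed
    finally show ?thesis .
  qed
qed

section \<open>Inverses and square roots\<close>

lemma normalize_hs:
  assumes "c \<noteq> 0" "lead d c x"
  obtains m e where "0 < m" "order_ge m e" "x = monom_hs d c * (1 + e)"
proof -
  define e where "e = monom_hs (- d) (1 / c) * x - 1"
  have inv: "monom_hs d c * monom_hs (- d) (1 / c) = 1" using assms by (simp add: monom_mult monom_1)
  have x: "x = monom_hs d c * (1 + e)"
    unfolding e_def using inv by (simp add: mult.assoc[symmetric])
  have "lead 0 0 e"
    using lead_diff[OF _ lead_1] lead_mult[OF lead_monom assms(2), of "- d" "1 / c"] assms(1)
    unfolding e_def by fastforce
  show ?thesis
  proof (cases "e = 0")
    case True
    \<comment> \<open>The zero series has no degree, so any positive bound serves.\<close>
    then show ?thesis using that[of 1 e] x by (simp add: order_ge_def)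
  next
    case False
    then obtain m b where mb: "b \<noteq> 0" "lead m b e" using lead_exists by blast
    then have "0 < m" using \<open>lead 0 0 e\<close> by (metis lead_def linorder_neqE_linordered_idom)
    moreover have "order_ge m e" using mb by (simp add: lead_def order_ge_def)
    ultimately show ?thesis using that x by blast
  qed
qed

lemma fps_trunc_eval_2: "fps_trunc_eval f x 2 = monom_hs 0 (fps_nth f 0) + monom_hs 0 (fps_nth f 1) * x"
  by (simp add: fps_trunc_eval_def numeral_2_eq_2)

text \<open>After the leading term is split off, \<open>e\<close> is substituted into the formal
  inverse of \<open>1 + fps_X\<close>.\<close>

lemma hs_inverse_exists:
  assumes "(x :: hahn_series) \<noteq> 0" obtains y where "x * y = 1"
proof -
  obtain d c where c: "c \<noteq> 0" "lead d c x" using lead_exists assms by blast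
  from normalize_hs[OF this] obtain m e where e: "0 < m" "order_ge m e" "x = monom_hs d c * (1 + e)" .
  define f :: "complex fps" where "f = 1 + fps_X"
  define g where "g = inverse f"
  obtain z where z: "\<And>N. order_ge (real N * m) (z - fps_trunc_eval g e N)" using fps_eval_exists[OF e(1,2)] by blast
  have fg: "f * g = 1" unfolding g_def by (rule inverse_mult_eq_1') (simp add: f_def)
  have "(1 + e) * z = 1"
  proof (rule fps_eval_mult[OF e(1,2) _ z, of _ f])
    have "fps_trunc_eval f e 2 = 1 + e" by (simp add: fps_trunc_eval_2 f_def monom_1)
    then show "order_ge (real N * m) (1 + e - fps_trunc_eval f e N)" for N
      using fps_eval_finite[OF e(1,2), of 2 f N] by (simp add: f_def)
    have "monom_hs 0 0 = 0" by (rule hs_eqI) (simp add: coef_monom)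
    then have "fps_trunc_eval 1 e 2 = 1" by (simp add: fps_trunc_eval_2 monom_1)
    then show "order_ge (real N * m) (1 - fps_trunc_eval (f * g) e N)" for N
      using fps_eval_finite[OF e(1,2), of 2 1 N] by (simp add: fg)
  qed
  moreover have "monom_hs d c * monom_hs (- d) (1 / c) = 1" using c by (simp add: monom_mult monom_1)
  ultimately have "x * (monom_hs (- d) (1 / c) * z) = 1" unfolding e(3)
    by (metis (no_types, lifting) mult.assoc mult.left_commute mult.right_neutral)
  then show ?thesis using that by blast
qed

text \<open>The remaining factor \<open>1 + e\<close> has as root the value at \<open>e\<close> of
  the binomial series with exponent 1/2; the leading coefficient has a complex root, and its
  exponent is halved.\<close>

lemma hs_sqrt_exists: obtains y where "y * y = (x :: hahn_series)"
proof (cases "x = 0")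
  case True
  then show ?thesis using that[of 0] by simp
next
  case False
  obtain d c where c: "c \<noteq> 0" "lead d c x" using lead_exists False by blast
  from normalize_hs[OF this] obtain m e where e: "0 < m" "order_ge m e" "x = monom_hs d c * (1 + e)" .
  define g :: "complex fps" where "g = fps_binomial (1 / 2)"
  obtain z where z: "\<And>N. order_ge (real N * m) (z - fps_trunc_eval g e N)" using fps_eval_exists[OF e(1,2)] by blast
  have gg: "g * g = 1 + fps_X" unfolding g_def
    by (simp add: fps_binomial_add_mult[symmetric] fps_binomial_1)
  have "z * z = 1 + e"
  proof (rule fps_eval_mult[OF e(1,2) z z])
    have "fps_trunc_eval (g * g) e 2 = 1 + e" unfolding gg by (simp add: fps_trunc_eval_2 monom_1)
    then show "order_ge (real N * m) (1 + e - fps_trunc_eval (g * g) e N)" for N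
      using fps_eval_finite[OF e(1,2), of 2 "g * g" N] by (simp add: gg)
  qed
  moreover have "monom_hs (d / 2) (csqrt c) * monom_hs (d / 2) (csqrt c) = monom_hs d c"
    by (simp add: monom_mult power2_csqrt[unfolded power2_eq_square])
  ultimately have "(monom_hs (d / 2) (csqrt c) * z) * (monom_hs (d / 2) (csqrt c) * z) = x" unfolding e(3)
    by (metis (no_types, lifting) mult.assoc mult.left_commute)
  then show ?thesis using that by blast
qed

instantiation hahn_series :: field
begin
definition "inverse x = (if x = 0 then 0 else (SOME y. x * y = (1 :: hahn_series)))"
definition "x div y = x * inverse (y :: hahn_series)"
instance
proof
  fix a b :: hahn_series
  show "a div b = a * inverse b" by (rule divide_hahn_series_def)
  show "inverse (0 :: hahn_series) = 0" by (simp add: inverse_hahn_series_def)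
  assume "a \<noteq> 0"
  then obtain y where "a * y = 1" by (rule hs_inverse_exists)
  then have "a * (SOME y. a * y = 1) = 1" by (rule someI)
  then have "a * inverse a = 1" using \<open>a \<noteq> 0\<close> by (simp add: inverse_hahn_series_def)
  then show "inverse a * a = 1" by (simp add: mult.commute)
qed
end

lemma lead_inverse:
  assumes "lead d c x" "c \<noteq> 0" shows "lead (- d) (inverse c) (inverse x)"
proof -
  have x: "x \<noteq> 0" using assms lead_nonzero by blast
  then have "inverse x \<noteq> 0" by simp
  then obtain e b where b: "b \<noteq> 0" "lead e b (inverse x)" using lead_exists by blast
  have "lead (d + e) (c * b) 1" using lead_mult[OF assms(1) b(2)] x by simp
  then have "d + e = 0" "c * b = 1" using lead_unique[OF _ lead_1] assms b
    by (force, metis assms(2) b(1) lead_1 lead_def lead_unique mult_eq_0_iff zero_neq_one)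
  then show ?thesis using b by (metis assms(2) eq_neg_iff_add_eq_0 add.commute inverse_unique)
qed

lemma lead_divide:
  assumes "lead d c x" "lead e b y" "b \<noteq> 0" shows "lead (d - e) (c / b) (x / y)"
  using lead_mult[OF assms(1) lead_inverse[OF assms(2,3)]] by (simp add: field_class.field_divide_inverse)

section \<open>Minors\<close>

text \<open>The index maps may be neither increasing nor injective, so rows and columns can be
  prepended and permuted freely; a repetition gives 0 and a permutation only a sign.\<close>

definition sub_det :: "(nat \<Rightarrow> nat \<Rightarrow> 'a :: comm_ring_1) \<Rightarrow> nat \<Rightarrow> (nat \<Rightarrow> nat) \<Rightarrow> (nat \<Rightarrow> nat) \<Rightarrow> 'a" where
  "sub_det M k f g = det (mat k k (\<lambda>(i,j). M (f i) (g j)))"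

definition rank_le :: "nat \<Rightarrow> (nat \<Rightarrow> nat \<Rightarrow> 'a :: comm_ring_1) \<Rightarrow> nat \<Rightarrow> bool" where
  "rank_le n M k \<longleftrightarrow> (\<forall>f g. (\<forall>i<Suc k. f i < n \<and> g i < n) \<longrightarrow> sub_det M (Suc k) f g = 0)"

lemma sub_det_expand:
  "sub_det M k f g = (\<Sum>p\<in>{p. p permutes {0..<k}}. of_int (sign p) * (\<Prod>i = 0..<k. M (f i) (g (p i))))"
proof -
  have "(\<Prod>i = 0..<k. mat k k (\<lambda>(i,j). M (f i) (g j)) $$ (i, p i)) = (\<Prod>i = 0..<k. M (f i) (g (p i)))"
    if "p permutes {0..<k}" for p
    by (rule prod.cong) (use permutes_in_image[OF that] in auto)
  then show ?thesis unfolding sub_det_def by (subst det_def'[of _ k]) auto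
qed

lemma sub_det_cong:
  assumes "\<And>i j. i < k \<Longrightarrow> j < k \<Longrightarrow> M (f i) (g j) = M' (f' i) (g' j)"
  shows "sub_det M k f g = sub_det M' k f' g'"
  unfolding sub_det_def by (rule arg_cong[of _ _ det], rule eq_matI) (use assms in auto)

lemma sub_det_transpose: "sub_det (\<lambda>i j. M j i) k f g = sub_det M k g f"
proof -
  have "transpose_mat (mat k k (\<lambda>(i,j). M (g i) (f j))) = mat k k (\<lambda>(i,j). M (g j) (f i))"
    by (rule eq_matI) auto
  then show ?thesis unfolding sub_det_def using det_transpose[of "mat k k (\<lambda>(i,j). M (g i) (f j))" k] by simp
qed

lemma sub_det_permute:
  assumes "p permutes {0..<k}"
  shows "sub_det M k (\<lambda>i. f (p i)) g = of_int (sign p) * sub_det M k f g"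
proof -
  have "det (mat k k (\<lambda>(i,j). mat k k (\<lambda>(i,j). M (f i) (g j)) $$ (p i, j))) = of_int (sign p) * sub_det M k f g"
    unfolding sub_det_def by (rule det_permute_rows[OF _ assms]) simp
  also have "mat k k (\<lambda>(i,j). mat k k (\<lambda>(i,j). M (f i) (g j)) $$ (p i, j)) = mat k k (\<lambda>(i,j). M (f (p i)) (g j))"
    by (rule eq_matI) (use permutes_in_image[OF assms] in auto)
  finally show ?thesis by (simp add: sub_det_def)
qed

lemma sub_det_not_inj:
  assumes "\<not> inj_on f {0..<k}" shows "sub_det M k f g = 0"
proof -
  obtain i j where ij: "i < k" "j < k" "i \<noteq> j" "f i = f j" using assms by (auto simp: inj_on_def)
  show ?thesis unfolding sub_det_def
    by (rule det_identical_rows[OF _ ij(3,1,2)]) (use ij in \<open>auto intro: eq_vecI\<close>)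
qed

lemma bij_betw_permutes:
  assumes e: "bij_betw e {0..<r} I" and f: "bij_betw f {0..<r :: nat} I"
  obtains p where "p permutes {0..<r}" "\<And>k. k < r \<Longrightarrow> f k = e (p k)"
proof -
  define p where "p k = (if k \<in> {0..<r} then the_inv_into {0..<r} e (f k) else k)" for k
  have "bij_betw (\<lambda>k. the_inv_into {0..<r} e (f k)) {0..<r} {0..<r}"
    using bij_betw_trans[OF f bij_betw_the_inv_into[OF e]] by (simp add: o_def)
  then have "bij_betw p {0..<r} {0..<r}" by (rule bij_betw_cong[THEN iffD1, rotated]) (simp add: p_def)
  then have "p permutes {0..<r}" by (rule bij_imp_permutes) (simp add: p_def)
  moreover have "f k = e (p k)" if "k < r" for k
    using that f_the_inv_into_f_bij_betw[OF e, of "f k"] bij_betwE[OF f] by (simp add: p_def)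
  ultimately show ?thesis using that by blast
qed

lemma bij_betw_nth_sorted:
  assumes "finite I" shows "bij_betw (nth (sorted_list_of_set I)) {0..<card I} I"
  using bij_betw_nth[of "sorted_list_of_set I" "{0..<card I}" I] assms by (simp add: atLeast0LessThan)

text \<open>An injective index map is the increasing enumeration of its image after a permutation,
  which changes the minor by a sign. This reduces arbitrary index maps to the index sets of
  \<open>hminor\<close>.\<close>

lemma sub_det_zero_of_sorted:
  assumes "finite J" "\<And>I. I \<subseteq> J \<Longrightarrow> card I = k \<Longrightarrow> sub_det M k (nth (sorted_list_of_set I)) g = 0"
    and "\<And>i. i < k \<Longrightarrow> f i \<in> J"
  shows "sub_det M k f g = 0"
proof (cases "inj_on f {0..<k}")
  case True
  define I where "I = f ` {0..<k}"
  have I: "I \<subseteq> J" "card I = k" "finite I" using assms True by (auto simp: I_def card_image)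
  have e: "bij_betw (nth (sorted_list_of_set I)) {0..<k} I" using bij_betw_nth_sorted[OF I(3)] I(2) by simp
  have f: "bij_betw f {0..<k} I" using True by (simp add: I_def bij_betw_def)
  obtain p where p: "p permutes {0..<k}" "\<And>i. i < k \<Longrightarrow> f i = sorted_list_of_set I ! p i"
    using bij_betw_permutes[OF e f] by metis
  have "sub_det M k f g = sub_det M k (\<lambda>i. sorted_list_of_set I ! p i) g"
    by (rule sub_det_cong) (simp add: p(2))
  then show ?thesis using sub_det_permute[OF p(1), of M "nth (sorted_list_of_set I)" g] assms(2)[OF I(1,2)] by simp
qed (simp add: sub_det_not_inj)

lemma rank_le_iff_sorted:
  "rank_le n M k \<longleftrightarrow> (\<forall>I J. I \<subseteq> {..<n} \<and> J \<subseteq> {..<n} \<and> card I = Suc k \<and> card J = Suc k \<longrightarrow>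
     sub_det M (Suc k) (nth (sorted_list_of_set I)) (nth (sorted_list_of_set J)) = 0)" (is "_ \<longleftrightarrow> ?R")
proof
  assume rk: "rank_le n M k"
  show ?R
  proof (intro allI impI, elim conjE)
    fix I J assume IJ: "I \<subseteq> {..<n}" "J \<subseteq> {..<n}" "card I = Suc k" "card J = Suc k"
    have "sorted_list_of_set I ! i < n" "sorted_list_of_set J ! i < n" if "i < Suc k" for i
      using bij_betwE[OF bij_betw_nth_sorted[of I]] bij_betwE[OF bij_betw_nth_sorted[of J]] IJ that
        finite_subset[OF _ finite_lessThan] by fastforce+
    then show "sub_det M (Suc k) (nth (sorted_list_of_set I)) (nth (sorted_list_of_set J)) = 0"
      using rk unfolding rank_le_def by blast
  qed
next
  assume R: ?R
  show "rank_le n M k"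
    unfolding rank_le_def
  proof (intro allI impI)
    fix f g :: "nat \<Rightarrow> nat" assume fg: "\<forall>i<Suc k. f i < n \<and> g i < n"
    have 1: "sub_det (\<lambda>i j. M j i) (Suc k) g (nth (sorted_list_of_set I)) = 0"
      if "I \<subseteq> {..<n}" "card I = Suc k" for I
      by (rule sub_det_zero_of_sorted[of "{..<n}"]) (use R that fg in \<open>auto simp: sub_det_transpose[of M]\<close>)
    show "sub_det M (Suc k) f g = 0"
      by (rule sub_det_zero_of_sorted[of "{..<n}"]) (use 1 fg in \<open>auto simp: sub_det_transpose[of M]\<close>)
  qed
qed


section \<open>Pivot elimination and rank\<close>

definition chio :: "nat \<Rightarrow> nat \<Rightarrow> (nat \<Rightarrow> nat \<Rightarrow> 'a :: field) \<Rightarrow> nat \<Rightarrow> nat \<Rightarrow> 'a" where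
  "chio a b M i j = M i j - M i b * M a j / M a b"

text \<open>\<open>chio a b M\<close> is the Schur complement of the pivot, whose row and column are
  kept as zeros instead of being deleted. Multiplication by the unitriangular \<open>L\<close>
  clears the first column below the pivot, and expansion along that column leaves the pivot times
  the smaller minor.\<close>

lemma sub_det_chio:
  fixes M :: "nat \<Rightarrow> nat \<Rightarrow> 'a :: field"
  assumes "M a b \<noteq> 0"
  shows "sub_det M (Suc k) (case_nat a f) (case_nat b g) = M a b * sub_det (chio a b M) k f g"
proof -
  let ?f = "case_nat a f" let ?g = "case_nat b g"
  define A where "A = mat (Suc k) (Suc k) (\<lambda>(i,j). M (?f i) (?g j))"
  define L where "L = mat (Suc k) (Suc k) (\<lambda>(i,j). if i = j then 1 else if j = 0 then - (M (?f i) b / M a b) else (0::'a))"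
  define B where "B = mat (Suc k) (Suc k) (\<lambda>(i,j). if i = 0 then M a (?g j) else chio a b M (?f i) (?g j))"
  have carr: "A \<in> carrier_mat (Suc k) (Suc k)" "L \<in> carrier_mat (Suc k) (Suc k)" "B \<in> carrier_mat (Suc k) (Suc k)"
    by (simp_all add: A_def L_def B_def)
  have "det L = prod_list (diag_mat L)"
    by (rule det_lower_triangular[OF _ carr(2)]) (simp add: L_def)
  also have "diag_mat L = replicate (Suc k) 1"
    by (rule nth_equalityI) (simp_all add: diag_mat_def L_def del: upt_Suc replicate_Suc)
  finally have detL: "det L = 1" by simp
  have LA: "L * A = B"
  proof (rule eq_matI)
    fix i j assume ij: "i < dim_row B" "j < dim_col B"
    then have i: "i < Suc k" and j: "j < Suc k" by (auto simp: B_def)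
    have "(L * A) $$ (i,j) = (\<Sum>l = 0..<Suc k. L $$ (i,l) * A $$ (l,j))"
      using i j carr by (simp add: scalar_prod_def del: sum.op_ivl_Suc)
    also have "\<dots> = (\<Sum>l\<in>{0,i}. L $$ (i,l) * A $$ (l,j))"
      by (rule sum.mono_neutral_right) (use i in \<open>auto simp: L_def\<close>)
    also have "\<dots> = B $$ (i,j)"
      using i j by (cases "i = 0") (auto simp: L_def A_def B_def chio_def)
    finally show "(L * A) $$ (i,j) = B $$ (i,j)" .
  qed (use carr in auto)
  have "det A = det B" using det_mult[OF carr(2,1)] detL LA by simp
  also have "\<dots> = (\<Sum>i<Suc k. B $$ (i,0) * cofactor B i 0)"
    by (rule laplace_expansion_column[OF carr(3)]) simp
  also have "\<dots> = (\<Sum>i\<in>{0}. B $$ (i,0) * cofactor B i 0)"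
    by (rule sum.mono_neutral_right) (use assms in \<open>auto simp: B_def chio_def\<close>)
  also have "\<dots> = M a b * det (mat_delete B 0 0)" by (simp add: B_def cofactor_def)
  also have "mat_delete B 0 0 = mat k k (\<lambda>(i,j). chio a b M (f i) (g j))"
    by (rule eq_matI) (auto simp: mat_delete_def B_def)
  finally show ?thesis by (simp add: A_def sub_det_def)
qed

lemma rank_le_chio:
  fixes M :: "nat \<Rightarrow> nat \<Rightarrow> 'a :: field"
  assumes "rank_le n M (Suc k)" "M a b \<noteq> 0" "a < n" "b < n"
  shows "rank_le n (chio a b M) k"
  unfolding rank_le_def
proof (intro allI impI)
  fix f g assume fg: "\<forall>i<Suc k. f i < n \<and> g i < n"
  have "sub_det M (Suc (Suc k)) (case_nat a f) (case_nat b g) = 0"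
    using assms(1) fg assms(3,4) unfolding rank_le_def by (auto split: nat.split)
  then show "sub_det (chio a b M) (Suc k) f g = 0" using sub_det_chio[where M = M and a = a and b = b and k = "Suc k" and f = f and g = g] assms(2) by simp
qed

lemma rank_le_mono_n: "rank_le n M k \<Longrightarrow> m \<le> n \<Longrightarrow> rank_le m M k"
  unfolding rank_le_def by (meson less_le_trans)

lemma rank_le_0: "rank_le n M 0 \<Longrightarrow> i < n \<Longrightarrow> j < n \<Longrightarrow> M i j = 0"
  unfolding rank_le_def
  by (drule spec[of _ "\<lambda>_. i"], drule spec[of _ "\<lambda>_. j"])
    (simp add: sub_det_def det_single[of "mat (Suc 0) (Suc 0) _"])

lemma rank_le_1:
  fixes M :: "nat \<Rightarrow> nat \<Rightarrow> 'a :: field"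
  assumes rk: "rank_le n M 1" and lt: "i < n" "i' < n" "j < n" "j' < n"
  shows "M i j * M i' j' = M i j' * M i' j"
proof -
  have z: "chio a b M c d = 0" if "M a b \<noteq> 0" "a < n" "b < n" "c < n" "d < n" for a b c d
    using rank_le_chio[where M = M and k = 0 and a = a and b = b and n = n] rank_le_0 rk that by simp
  consider "M i j \<noteq> 0" | "M i j = 0" "M i j' \<noteq> 0" | "M i j = 0" "M i j' = 0" by blast
  then show ?thesis
  proof cases
    case 1
    then show ?thesis using z[OF 1 lt(1,3,2,4)] by (simp add: chio_def field_simps)
  next
    case 2
    then show ?thesis using z[OF 2(2) lt(1,4,2,3)] by (simp add: chio_def)
  qed simp
qed

lemma rank_le_factor:
  assumes M: "\<And>i j. i < n \<Longrightarrow> j < n \<Longrightarrow> M i j = (\<Sum>l<k. P i l * Q l j)"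
  shows "rank_le n M k"
  unfolding rank_le_def
proof (intro allI impI)
  fix f g assume fg: "\<forall>i<Suc k. f i < n \<and> g i < n"
  \<comment> \<open>Padding with a zero column makes the left factor square and singular.\<close>
  define X where "X = mat (Suc k) (Suc k) (\<lambda>(i,l). if l < k then P (f i) l else 0)"
  define Y where "Y = mat (Suc k) (Suc k) (\<lambda>(l,j). Q l (g j))"
  have carr: "X \<in> carrier_mat (Suc k) (Suc k)" "Y \<in> carrier_mat (Suc k) (Suc k)" by (simp_all add: X_def Y_def)
  have "mat (Suc k) (Suc k) (\<lambda>(i,j). M (f i) (g j)) = X * Y"
  proof (rule eq_matI)
    fix i j assume "i < dim_row (X * Y)" "j < dim_col (X * Y)"
    then have ij: "i < Suc k" "j < Suc k" by (simp_all add: X_def Y_def)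
    have "(X * Y) $$ (i,j) = (\<Sum>l = 0..<Suc k. X $$ (i,l) * Y $$ (l,j))"
      using ij carr by (simp add: scalar_prod_def del: sum.op_ivl_Suc)
    also have "\<dots> = (\<Sum>l<k. P (f i) l * Q l (g j))"
      using ij by (simp add: X_def Y_def atLeast0LessThan)
    finally show "mat (Suc k) (Suc k) (\<lambda>(i,j). M (f i) (g j)) $$ (i,j) = (X * Y) $$ (i,j)"
      using ij fg M by simp
  qed (simp_all add: X_def Y_def)
  moreover have "det X = 0"
    by (subst laplace_expansion_column[OF carr(1), of k]) (simp_all add: X_def)
  ultimately show "sub_det M (Suc k) f g = 0" unfolding sub_det_def by (simp add: det_mult[OF carr])
qed

section \<open>Symmetric lifts over the Hahn series field\<close>

definition lift_of :: "nat \<Rightarrow> (nat \<Rightarrow> nat \<Rightarrow> real) \<Rightarrow> (nat \<Rightarrow> nat \<Rightarrow> hahn_series) \<Rightarrow> bool" where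
  "lift_of n A M \<longleftrightarrow> (\<forall>i<n. \<forall>j<n. M i j = M j i \<and> (\<exists>c. c \<noteq> 0 \<and> lead (A i j) c (M i j)))"

lemma hprod_list_coef: "hprod_list (map (\<lambda>k. coef (m k)) ks) = coef (\<Prod>k\<leftarrow>ks. m k)"
  by (induction ks) (simp_all add: coef_1 coef_mult)

lemma coef_sign_mult: "coef (of_int (sign p) * x) a = of_int (sign p) * coef x a"
  by (cases "sign p = 1") (auto simp: sign_def)

lemma hminor_coef:
  assumes L: "\<And>i j. i \<in> I \<Longrightarrow> j \<in> J \<Longrightarrow> L i j = coef (M i j)"
    and fin: "finite I" "finite J" and card: "card I = k" "card J = k"
  shows "hminor L I J = coef (sub_det M k (nth (sorted_list_of_set I)) (nth (sorted_list_of_set J)))"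
proof
  fix a
  let ?e = "nth (sorted_list_of_set I)" let ?f = "nth (sorted_list_of_set J)"
  have "hprod_list (map (\<lambda>k. L (?e k) (?f (p k))) [0..<k]) = coef (\<Prod>i = 0..<k. M (?e i) (?f (p i)))"
    if p: "p permutes {0..<k}" for p
  proof -
    have "map (\<lambda>k. L (?e k) (?f (p k))) [0..<k] = map (\<lambda>k. coef (M (?e k) (?f (p k)))) [0..<k]"
      using bij_betwE[OF bij_betw_nth_sorted[OF fin(1)]] bij_betwE[OF bij_betw_nth_sorted[OF fin(2)]]
        permutes_in_image[OF p] card by (auto intro!: L)
    also have "hprod_list \<dots> = coef (\<Prod>i\<leftarrow>[0..<k]. M (?e i) (?f (p i)))" by (rule hprod_list_coef)
    also have "(\<Prod>i\<leftarrow>[0..<k]. M (?e i) (?f (p i))) = (\<Prod>i = 0..<k. M (?e i) (?f (p i)))"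
      using prod.distinct_set_conv_list[of "[0..<k]" "\<lambda>i. M (?e i) (?f (p i))"] by simp
    finally show ?thesis .
  qed
  then show "hminor L I J a = coef (sub_det M k ?e ?f) a"
    unfolding hminor_def sub_det_expand card(1) coef_sum coef_sign_mult lessThan_atLeast0
    by (intro sum.cong[OF refl]) simp
qed

text \<open>From here on lifts live in the field \<open>hahn_series\<close>, where determinants and
  elimination are available; the degree condition becomes the existence of a nonzero leading
  coefficient at the given exponent.\<close>

lemma exists_sym_lift_iff:
  "(\<exists>L. sym_lift n A L \<and> hrank_le n L k) \<longleftrightarrow> (\<exists>M. lift_of n A M \<and> rank_le n M k)"
proof
  assume "\<exists>L. sym_lift n A L \<and> hrank_le n L k"
  then obtain L where L: "sym_lift n A L" "hrank_le n L k" by blast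
  define M where "M i j = Abs_hs (L i j)" for i j
  have LM: "L i j = coef (M i j)" if "i < n" "j < n" for i j
    using L(1) that by (simp add: M_def sym_lift_def Abs_hs_inverse)
  have "lift_of n A M"
    unfolding lift_of_def
  proof (intro allI impI conjI)
    fix i j assume ij: "i < n" "j < n"
    show "M i j = M j i" using L(1) ij by (simp add: M_def sym_lift_def symmetric_mat_def)
    have "L i j \<noteq> (\<lambda>_. 0)" using L(1) ij by (simp add: sym_lift_def)
    then have "M i j \<noteq> 0" using LM[OF ij] by (auto simp: fun_eq_iff)
    then show "\<exists>c. c \<noteq> 0 \<and> lead (A i j) c (M i j)"
      using lead_iff_hdeg[of "M i j" "A i j"] L(1) ij unfolding sym_lift_def LM[OF ij, symmetric] by blast
  qed
  moreover have "rank_le n M k"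
    unfolding rank_le_iff_sorted
  proof (intro allI impI, elim conjE)
    fix I J assume IJ: "I \<subseteq> {..<n}" "J \<subseteq> {..<n}" "card I = Suc k" "card J = Suc k"
    have "hminor L I J = coef (sub_det M (Suc k) (nth (sorted_list_of_set I)) (nth (sorted_list_of_set J)))"
      by (rule hminor_coef) (use IJ LM finite_subset[OF IJ(1) finite_lessThan] finite_subset[OF IJ(2) finite_lessThan] in auto)
    moreover have "hminor L I J = (\<lambda>_. 0)" using L(2) IJ by (simp add: hrank_le_def)
    ultimately show "sub_det M (Suc k) (nth (sorted_list_of_set I)) (nth (sorted_list_of_set J)) = 0"
      by (intro hs_eqI) (metis coef_0)
  qed
  ultimately show "\<exists>M. lift_of n A M \<and> rank_le n M k" by blast
next
  assume "\<exists>M. lift_of n A M \<and> rank_le n M k"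
  then obtain M where M: "lift_of n A M" "rank_le n M k" by blast
  define L where "L i j = coef (M i j)" for i j
  have "sym_lift n A L"
    unfolding sym_lift_def symmetric_mat_def
  proof (intro conjI allI impI)
    fix i j assume ij: "i < n" "j < n"
    show "L i j = L j i" using M(1) ij by (simp add: L_def lift_of_def)
    show "is_hahn (L i j)" using coef[of "M i j"] by (simp add: L_def)
    obtain c where c: "c \<noteq> 0" "lead (A i j) c (M i j)" using M(1) ij by (auto simp: lift_of_def)
    then have "M i j \<noteq> 0" using lead_nonzero by blast
    then show "hdeg (L i j) = A i j" unfolding L_def using lead_iff_hdeg c by blast
    show "L i j \<noteq> (\<lambda>_. 0)" using c by (auto simp: L_def lead_def fun_eq_iff)
  qed
  moreover have "hrank_le n L k"
    unfolding hrank_le_def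
  proof (intro allI impI, elim conjE)
    fix I J assume IJ: "I \<subseteq> {..<n}" "J \<subseteq> {..<n}" "card I = Suc k" "card J = Suc k"
    have "hminor L I J = coef (sub_det M (Suc k) (nth (sorted_list_of_set I)) (nth (sorted_list_of_set J)))"
      by (rule hminor_coef) (use IJ finite_subset[OF IJ(1) finite_lessThan] finite_subset[OF IJ(2) finite_lessThan] in \<open>auto simp: L_def\<close>)
    then show "hminor L I J = (\<lambda>_. 0)" using M(2) IJ by (simp add: rank_le_iff_sorted fun_eq_iff)
  qed
  ultimately show "\<exists>L. sym_lift n A L \<and> hrank_le n L k" by blast
qed

section \<open>Bijections with equal symmetric monomials\<close>

text \<open>Enumerations \<open>e\<close> of the rows and \<open>f\<close> of the columns turn a
  bijection into a permutation, which has a sign. The pairs keep the original indices, because the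
  identification compares row indices with column indices.\<close>

definition perm_monomial :: "nat \<Rightarrow> (nat \<Rightarrow> nat) \<Rightarrow> (nat \<Rightarrow> nat) \<Rightarrow> (nat \<Rightarrow> nat) \<Rightarrow> nat set multiset" where
  "perm_monomial r e f p = image_mset (\<lambda>k. {e k, f (p k)}) (mset_set {0..<r})"

definition perm_value :: "(nat \<Rightarrow> nat \<Rightarrow> real) \<Rightarrow> nat \<Rightarrow> (nat \<Rightarrow> nat) \<Rightarrow> (nat \<Rightarrow> nat) \<Rightarrow> (nat \<Rightarrow> nat) \<Rightarrow> real" where
  "perm_value A r e f p = (\<Sum>k = 0..<r. A (e k) (f (p k)))"

lemma sym_monomial_eq:
  assumes "bij_betw e {0..<r} I" "\<And>k. k < r \<Longrightarrow> \<rho> (e k) = f (p k)"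
  shows "sym_monomial I \<rho> = perm_monomial r e f p"
proof -
  have "mset_set I = image_mset e (mset_set {0..<r})"
    using assms(1) by (simp add: bij_betw_def image_mset_mset_set)
  then show ?thesis unfolding sym_monomial_def perm_monomial_def
    by (auto simp: multiset.map_comp o_def assms(2) intro!: image_mset_cong)
qed

lemma trop_value_eq:
  assumes "bij_betw e {0..<r} I" "\<And>k. k < r \<Longrightarrow> \<rho> (e k) = f (p k)"
  shows "trop_value A I \<rho> = perm_value A r e f p"
  unfolding trop_value_def perm_value_def sum.reindex_bij_betw[OF assms(1), symmetric]
  by (rule sum.cong) (auto simp: assms(2))

lemma perm_to_bij:
  assumes e: "bij_betw e {0..<r} I" and f: "bij_betw f {0..<r} J" and p: "p permutes {0..<r :: nat}"
  obtains \<rho> where "bij_betw \<rho> I J" "\<And>k. k < r \<Longrightarrow> \<rho> (e k) = f (p k)"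
proof -
  define \<rho> where "\<rho> = f \<circ> p \<circ> the_inv_into {0..<r} e"
  have "bij_betw \<rho> I J" unfolding \<rho>_def
    by (rule bij_betw_trans[OF bij_betw_the_inv_into[OF e] bij_betw_trans[OF permutes_imp_bij[OF p] f]])
  moreover have "\<rho> (e k) = f (p k)" if "k < r" for k
    using the_inv_into_f_f[of e "{0..<r}" k] e that by (simp add: \<rho>_def bij_betw_def)
  ultimately show ?thesis using that by blast
qed

lemma bij_to_perm:
  assumes e: "bij_betw e {0..<r} I" and f: "bij_betw f {0..<r} J" and \<rho>: "bij_betw \<rho> I J"
  obtains p where "p permutes {0..<r :: nat}" "\<And>k. k < r \<Longrightarrow> \<rho> (e k) = f (p k)"
  using bij_betw_permutes[OF f bij_betw_trans[OF e \<rho>]] by (metis comp_apply)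

lemma sym_trop_singular_iff_perm:
  assumes e: "bij_betw e {0..<r} I" and f: "bij_betw f {0..<r} J"
  shows "sym_trop_singular A I J \<longleftrightarrow> (\<exists>p q. p permutes {0..<r} \<and> q permutes {0..<r} \<and>
      (\<forall>s. s permutes {0..<r} \<longrightarrow> perm_value A r e f p \<le> perm_value A r e f s) \<and>
      perm_value A r e f q = perm_value A r e f p \<and> perm_monomial r e f p \<noteq> perm_monomial r e f q)"
    (is "_ \<longleftrightarrow> ?R")
proof
  assume "sym_trop_singular A I J"
  then obtain \<rho>1 \<rho>2 where *: "bij_betw \<rho>1 I J" "bij_betw \<rho>2 I J"
    "\<And>\<rho>. bij_betw \<rho> I J \<Longrightarrow> trop_value A I \<rho>1 \<le> trop_value A I \<rho>"
    "trop_value A I \<rho>2 = trop_value A I \<rho>1" "sym_monomial I \<rho>1 \<noteq> sym_monomial I \<rho>2"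
    unfolding sym_trop_singular_def by blast
  obtain p where p: "p permutes {0..<r}" "\<And>k. k < r \<Longrightarrow> \<rho>1 (e k) = f (p k)" by (rule bij_to_perm[OF e f *(1)]) blast
  obtain q where q: "q permutes {0..<r}" "\<And>k. k < r \<Longrightarrow> \<rho>2 (e k) = f (q k)" by (rule bij_to_perm[OF e f *(2)]) blast
  have "perm_value A r e f p \<le> perm_value A r e f s" if s: "s permutes {0..<r}" for s
  proof -
    obtain \<rho> where \<rho>: "bij_betw \<rho> I J" "\<And>k. k < r \<Longrightarrow> \<rho> (e k) = f (s k)" by (rule perm_to_bij[OF e f s]) blast
    show ?thesis using *(3)[OF \<rho>(1)]
      by (simp add: trop_value_eq[of e r I \<rho> f s, OF e \<rho>(2)] trop_value_eq[of e r I \<rho>1 f p, OF e p(2)])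
  qed
  then show ?R using p(1) q(1) *(4,5) sym_monomial_eq[of e r I \<rho>1 f p, OF e p(2)] sym_monomial_eq[of e r I \<rho>2 f q, OF e q(2)]
    trop_value_eq[of e r I \<rho>1 f p, OF e p(2)] trop_value_eq[of e r I \<rho>2 f q, OF e q(2)] by metis
next
  assume ?R
  then obtain p q where *: "p permutes {0..<r}" "q permutes {0..<r}"
    "\<And>s. s permutes {0..<r} \<Longrightarrow> perm_value A r e f p \<le> perm_value A r e f s"
    "perm_value A r e f q = perm_value A r e f p" "perm_monomial r e f p \<noteq> perm_monomial r e f q" by blast
  obtain \<rho>1 where 1: "bij_betw \<rho>1 I J" "\<And>k. k < r \<Longrightarrow> \<rho>1 (e k) = f (p k)" by (rule perm_to_bij[OF e f *(1)]) blast
  obtain \<rho>2 where 2: "bij_betw \<rho>2 I J" "\<And>k. k < r \<Longrightarrow> \<rho>2 (e k) = f (q k)" by (rule perm_to_bij[OF e f *(2)]) blast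
  have "trop_value A I \<rho>1 \<le> trop_value A I \<rho>" if \<rho>: "bij_betw \<rho> I J" for \<rho>
  proof -
    obtain s where s: "s permutes {0..<r}" "\<And>k. k < r \<Longrightarrow> \<rho> (e k) = f (s k)" by (rule bij_to_perm[OF e f \<rho>]) blast
    show ?thesis using *(3)[OF s(1)]
      by (simp add: trop_value_eq[of e r I \<rho> f s, OF e s(2)] trop_value_eq[of e r I \<rho>1 f p, OF e 1(2)])
  qed
  then show "sym_trop_singular A I J" unfolding sym_trop_singular_def
    using 1(1) 2(1) *(4,5) sym_monomial_eq[of e r I \<rho>1 f p, OF e 1(2)] sym_monomial_eq[of e r I \<rho>2 f q, OF e 2(2)]
    trop_value_eq[of e r I \<rho>1 f p, OF e 1(2)] trop_value_eq[of e r I \<rho>2 f q, OF e 2(2)] by metis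
qed

lemma optimal_perm_exists:
  obtains p where "p permutes {0..<r}" "\<And>q. q permutes {0..<r} \<Longrightarrow> perm_value A r e f p \<le> perm_value A r e f q"
proof -
  let ?P = "{p. p permutes {0..<r}}" let ?v = "perm_value A r e f"
  have fin: "finite ?P" by (simp add: finite_permutations)
  have "?P \<noteq> {}" using permutes_id by blast
  then have "Min (?v ` ?P) \<in> ?v ` ?P" using fin by (intro Min_in) auto
  then obtain p where p: "p permutes {0..<r}" "Min (?v ` ?P) = ?v p" by auto
  have "?v p \<le> ?v q" if "q permutes {0..<r}" for q
    using p(2)[symmetric] fin that by (auto intro!: Min_le)
  then show ?thesis using that p(1) by blast
qed

lemma perm_nonsingular:
  assumes e: "bij_betw e {0..<r} I" and f: "bij_betw f {0..<r} J" and ns: "\<not> sym_trop_singular A I J"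
  obtains p where "p permutes {0..<r}"
    "\<And>q. q permutes {0..<r} \<Longrightarrow> perm_value A r e f p < perm_value A r e f q \<or>
       (perm_value A r e f q = perm_value A r e f p \<and> perm_monomial r e f q = perm_monomial r e f p)"
proof -
  let ?v = "perm_value A r e f"
  obtain p where p: "p permutes {0..<r}" and min: "\<And>q. q permutes {0..<r} \<Longrightarrow> ?v p \<le> ?v q"
    by (rule optimal_perm_exists[where A = A and e = e and f = f and r = r]) blast
  have "?v p < ?v q \<or> (?v q = ?v p \<and> perm_monomial r e f q = perm_monomial r e f p)"
    if q: "q permutes {0..<r}" for q
  proof (cases "?v p < ?v q")
    case False
    then have "?v q = ?v p" using min[OF q] by simp
    moreover have "perm_monomial r e f q = perm_monomial r e f p"
    proof (rule ccontr)
      assume "perm_monomial r e f q \<noteq> perm_monomial r e f p"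
      then have "sym_trop_singular A I J" unfolding sym_trop_singular_iff_perm[OF e f]
        using p q min \<open>?v q = ?v p\<close> by metis
      then show False using ns by simp
    qed
    ultimately show ?thesis by simp
  qed simp
  then show ?thesis using that p by blast
qed

text \<open>If \<open>p\<close> and \<open>q\<close> have the same monomial, then \<open>q\<close> is obtained from \<open>p\<close> by reversing some of the
  cycles of length at least three of \<open>i \<mapsto> p i\<close>.\<close>

lemma same_monomial_reversal:
  assumes e: "inj_on e {0..<r}" and f: "inj_on f {0..<r}"
    and p: "p permutes {0..<r}" and q: "q permutes {0..<r}"
    and eq: "perm_monomial r e f p = perm_monomial r e f q"
  obtains s where "s permutes {0..<r}" "\<And>k. p k = q k \<Longrightarrow> s k = k"
    "\<And>k. k < r \<Longrightarrow> p k \<noteq> q k \<Longrightarrow> p (s k) \<noteq> q (s k) \<and> s k < r \<and> e (s k) = f (p k) \<and> f (q (s k)) = e k"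
proof -
  \<comment> \<open>Positions where \<open>p\<close> and \<open>q\<close> agree contribute the same
    factors to both monomials and cancel.\<close>
  define R where "R = {k \<in> {0..<r}. p k \<noteq> q k}"
  have D: "mset_set {0..<r} = mset_set R + mset_set ({0..<r} - R)"
    by (subst mset_set_Union[symmetric]) (auto simp: R_def intro: arg_cong[of _ _ mset_set])
  have "image_mset (\<lambda>k. {e k, f (p k)}) (mset_set ({0..<r} - R)) = image_mset (\<lambda>k. {e k, f (q k)}) (mset_set ({0..<r} - R))"
    by (rule image_mset_cong) (auto simp: R_def)
  then have "image_mset (\<lambda>k. {e k, f (p k)}) (mset_set R) = image_mset (\<lambda>k. {e k, f (q k)}) (mset_set R)"
    using eq unfolding perm_monomial_def D image_mset_union by simp
  from arg_cong[OF this, of set_mset]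
  have img: "(\<lambda>k. {e k, f (p k)}) ` R = (\<lambda>k. {e k, f (q k)}) ` R" by (simp add: R_def)
  \<comment> \<open>The factor of \<open>p\<close> at \<open>k\<close> recurs in the monomial of
    \<open>q\<close> at some \<open>k'\<close>. It cannot recur in the same row, where
    \<open>p\<close> and \<open>q\<close> differ, so it recurs transposed.\<close>
  have "\<exists>k'\<in>R. e k' = f (p k) \<and> f (q k') = e k" if k: "k \<in> R" for k
  proof -
    obtain k' where k': "k' \<in> R" "{e k, f (p k)} = {e k', f (q k')}" using img k by blast
    have neq: "f (p k) \<noteq> f (q k)"
      using k f permutes_in_image[OF p] permutes_in_image[OF q] by (simp add: R_def inj_on_eq_iff)
    show ?thesis
    proof (cases "e k = e k'")
      case True
      then have "k = k'" using e k k'(1) by (auto simp: R_def inj_on_eq_iff)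
      then have "f (p k) = f (q k)" using k'(2) by (auto simp: doubleton_eq_iff)
      then show ?thesis using neq by simp
    next
      case False
      then have "e k = f (q k') \<and> f (p k) = e k'" using k'(2) by (auto simp: doubleton_eq_iff)
      then show ?thesis using k'(1) by auto
    qed
  qed
  then obtain t where t: "\<And>k. k \<in> R \<Longrightarrow> t k \<in> R \<and> e (t k) = f (p k) \<and> f (q (t k)) = e k" by metis
  define s where "s k = (if k \<in> R then t k else k)" for k
  have injR: "inj_on s R"
  proof (rule inj_onI)
    fix x y assume xy: "x \<in> R" "y \<in> R" "s x = s y"
    then have "f (p x) = f (p y)" using t by (metis s_def)
    then have "p x = p y" using f xy permutes_in_image[OF p] by (simp add: R_def inj_on_eq_iff)
    then show "x = y" using permutes_inj[OF p] by (simp add: inj_eq)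
  qed
  have sR: "s ` R \<subseteq> R" using t by (auto simp: s_def)
  have finR: "finite R" by (simp add: R_def)
  have "s permutes R"
  proof (rule bij_imp_permutes)
    show "bij_betw s R R" using injR sR finR by (simp add: bij_betw_def endo_inj_surj)
  qed (simp add: s_def)
  then have "s permutes {0..<r}" by (rule permutes_subset) (auto simp: R_def)
  moreover have "s k = k" if "p k = q k" for k using that by (simp add: s_def R_def)
  moreover have "p (s k) \<noteq> q (s k) \<and> s k < r \<and> e (s k) = f (p k) \<and> f (q (s k)) = e k" if "k < r" "p k \<noteq> q k" for k
  proof -
    have "k \<in> R" using that by (simp add: R_def)
    then show ?thesis using t[of k] by (simp add: s_def) (simp add: R_def)
  qed
  ultimately show ?thesis using that by blast
qed

text \<open>The map \<open>s\<close> of \<open>same_monomial_reversal\<close> satisfies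
  \<open>p = q \<circ> (s \<circ> s)\<close>, and a square is even.\<close>

lemma sign_eq_of_same_monomial:
  assumes e: "inj_on e {0..<r}" and f: "inj_on f {0..<r}"
    and p: "p permutes {0..<r}" and q: "q permutes {0..<r}"
    and eq: "perm_monomial r e f p = perm_monomial r e f q"
  shows "sign p = sign q"
proof -
  obtain s where s: "s permutes {0..<r}" "\<And>k. p k = q k \<Longrightarrow> s k = k"
    "\<And>k. k < r \<Longrightarrow> p k \<noteq> q k \<Longrightarrow> p (s k) \<noteq> q (s k) \<and> s k < r \<and> e (s k) = f (p k) \<and> f (q (s k)) = e k"
    by (rule same_monomial_reversal[OF assms]) blast
  have "p k = (q \<circ> (s \<circ> s)) k" for k
  proof (cases "k < r \<and> p k \<noteq> q k")
    case True
    then have 1: "p (s k) \<noteq> q (s k)" "s k < r" "e (s k) = f (p k)" using s(3) by blast+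
    then have "f (q (s (s k))) = f (p k)" using s(3)[of "s k"] by simp
    moreover have "s (s k) < r" using s(3)[of "s k"] 1 by simp
    ultimately show ?thesis
      using f permutes_in_image[OF q, of "s (s k)"] permutes_in_image[OF p, of k] True by (simp add: inj_on_eq_iff)
  next
    case False
    then have "p k = q k" using p q by (cases "k < r") (auto simp: permutes_not_in)
    then show ?thesis using s(2) by simp
  qed
  then have "p = q \<circ> (s \<circ> s)" by auto
  moreover have "permutation q" "permutation s" using q s(1) permutation_permutes by blast+
  ultimately have "sign p = sign q * (sign s * sign s)"
    by (simp add: sign_compose permutation_compose)
  then show ?thesis by (simp add: sign_idempotent)
qed

text \<open>A reversal moves its points in cycles of length at least three, so among four positions
  there is room for only one. In detail, the sets \<open>R\<close> and \<open>R'\<close> of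
  positions moved by \<open>s\<close> and \<open>s'\<close> have at least three elements and meet;
  on common points \<open>s\<close> and \<open>s'\<close> agree, since both are determined by
  \<open>p\<close>. The common part is closed under them and has at least three elements, so a
  leftover point would be fixed. Hence \<open>R = R'\<close>, and the reversal determines the
  permutation. This bounds the number of terms of a 4 x 4 minor with a given monomial by 2.\<close>

lemma three_same_monomials_4:
  assumes e: "inj_on e {0..<4}" and f: "inj_on f {0..<4}"
    and p: "p permutes {0..<4 :: nat}" and q: "q permutes {0..<4}" and q': "q' permutes {0..<4}"
    and eq: "perm_monomial 4 e f p = perm_monomial 4 e f q" "perm_monomial 4 e f p = perm_monomial 4 e f q'"
    and neq: "p \<noteq> q" "p \<noteq> q'"
  shows "q = q'"
proof -
  obtain s where s: "s permutes {0..<4}" "\<And>k. p k = q k \<Longrightarrow> s k = k"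
    "\<And>k. k < 4 \<Longrightarrow> p k \<noteq> q k \<Longrightarrow> p (s k) \<noteq> q (s k) \<and> s k < 4 \<and> e (s k) = f (p k) \<and> f (q (s k)) = e k"
    by (rule same_monomial_reversal[OF e f p q eq(1)]) blast
  obtain s' where s': "s' permutes {0..<4}" "\<And>k. p k = q' k \<Longrightarrow> s' k = k"
    "\<And>k. k < 4 \<Longrightarrow> p k \<noteq> q' k \<Longrightarrow> p (s' k) \<noteq> q' (s' k) \<and> s' k < 4 \<and> e (s' k) = f (p k) \<and> f (q' (s' k)) = e k"
    by (rule same_monomial_reversal[OF e f p q' eq(2)]) blast
  have closed3: "3 \<le> card X" if X: "X \<subseteq> {0..<4}" "x \<in> X" "\<And>k. k \<in> X \<Longrightarrow> t k \<in> X \<and> t k \<noteq> k \<and> t (t k) \<noteq> k" for X :: "nat set" and t x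
  proof -
    have "{x, t x, t (t x)} \<subseteq> X" using X(2,3) by blast
    moreover have "card {x, t x, t (t x)} = 3" using X(2) X(3)[of x] X(3)[of "t x"] by auto
    moreover have "finite X" using X(1) by (rule finite_subset) simp
    ultimately show ?thesis using card_mono[of X "{x, t x, t (t x)}"] by linarith
  qed
  have noinv: "t k \<noteq> k \<and> t (t k) \<noteq> k"
    if t: "\<And>k. k < 4 \<Longrightarrow> p k \<noteq> u k \<Longrightarrow> p (t k) \<noteq> u (t k) \<and> t k < 4 \<and> e (t k) = f (p k) \<and> f (u (t k)) = e k"
      and u: "u permutes {0..<4}" and k: "k < 4" "p k \<noteq> u k" for t u k
  proof -
    have 1: "p (t k) \<noteq> u (t k)" "t k < 4" "e (t k) = f (p k)" "f (u (t k)) = e k" using t[OF k] by auto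
    have inj: "a = b" if "f a = f b" "a < 4" "b < 4" for a b using f that by (auto simp: inj_on_def)
    have lt: "p a < 4" "u a < 4" if "a < 4" for a using that permutes_in_image[OF p, of a] permutes_in_image[OF u, of a] by auto
    have "t k \<noteq> k"
    proof
      assume "t k = k"
      then have "f (p k) = f (u k)" using 1 by simp
      then show False using inj lt k by blast
    qed
    moreover have "t (t k) \<noteq> k"
    proof
      assume "t (t k) = k"
      then have "f (p (t k)) = f (u (t k))" using 1 t[OF 1(2,1)] by simp
      then show False using inj lt 1(1,2) by blast
    qed
    ultimately show ?thesis by simp
  qed
  define R where "R = {k \<in> {0..<4}. p k \<noteq> q k}"
  define R' where "R' = {k \<in> {0..<4}. p k \<noteq> q' k}"
  have agree: "s k = s' k" if "k \<in> R" "k \<in> R'" for k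
  proof -
    have "e (s k) = e (s' k)" "s k < 4" "s' k < 4" using s(3)[of k] s'(3)[of k] that by (auto simp: R_def R'_def)
    then show ?thesis using e by (auto simp: inj_on_def)
  qed
  have sR: "s k \<in> R \<and> s k \<noteq> k \<and> s (s k) \<noteq> k" if "k \<in> R" for k
    using s(3)[of k] noinv[of q s k, OF s(3) q] that by (auto simp: R_def)
  have sR': "s' k \<in> R' \<and> s' k \<noteq> k \<and> s' (s' k) \<noteq> k" if "k \<in> R'" for k
    using s'(3)[of k] noinv[of q' s' k, OF s'(3) q'] that by (auto simp: R'_def)
  have sub: "R \<subseteq> {0..<4}" "R' \<subseteq> {0..<4}" by (auto simp: R_def R'_def)
  have diff: "\<exists>k\<in>{0..<4}. p k \<noteq> u k" if "u permutes {0..<4}" "p \<noteq> u" for u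
  proof (rule ccontr)
    assume "\<not> (\<exists>k\<in>{0..<4}. p k \<noteq> u k)"
    then have "p k = u k" for k using that(1) p by (cases "k \<in> {0..<4}") (auto simp: permutes_not_in)
    then show False using that(2) by auto
  qed
  obtain x where x: "x \<in> R" using diff[OF q neq(1)] by (auto simp: R_def)
  obtain x' where x': "x' \<in> R'" using diff[OF q' neq(2)] by (auto simp: R'_def)
  have c3: "3 \<le> card R" "3 \<le> card R'" using closed3[OF sub(1) x sR] closed3[OF sub(2) x' sR'] by auto
  have fin: "finite R" "finite R'" using sub finite_subset by blast+
  have "card (R \<union> R') \<le> 4" using card_mono[of "{0..<4}" "R \<union> R'"] sub by auto
  then have "R \<inter> R' \<noteq> {}" using c3 card_Un_disjoint[OF fin] by linarith
  then obtain y where y: "y \<in> R \<inter> R'" by blast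
  have cl: "s k \<in> R \<inter> R' \<and> s k \<noteq> k \<and> s (s k) \<noteq> k" if "k \<in> R \<inter> R'" for k
    using sR[of k] sR'[of k] agree[of k] that by auto
  have ci: "3 \<le> card (R \<inter> R')" by (rule closed3[OF _ y cl]) (use sub in auto)
  have fixpt: False if X: "X \<subseteq> {0..<4}" "\<And>k. k \<in> X \<Longrightarrow> t k \<in> X \<and> t k \<noteq> k" "t permutes {0..<4}"
    and Y: "Y \<subseteq> X" "3 \<le> card Y" "\<And>k. k \<in> Y \<Longrightarrow> t k \<in> Y" and z: "z \<in> X - Y" for X Y :: "nat set" and t z
  proof -
    have fX: "finite X" using X(1) finite_subset by blast
    then have fY: "finite Y" using Y(1) finite_subset by blast
    have "t ` Y = Y" using Y(3) fY permutes_inj[OF X(3)] by (intro endo_inj_surj) (auto intro: inj_on_subset)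
    then have "t z \<notin> Y" using z permutes_inj[OF X(3)] by (metis DiffD2 image_iff injD)
    then have "t z \<in> X - Y" using X(2) z by auto
    moreover have "card (X - Y) \<le> 1"
      using card_mono[OF _ X(1)] card_Diff_subset[OF fY Y(1)] Y(2) by simp
    moreover have "\<forall>a\<in>X - Y. \<forall>b\<in>X - Y. a = b"
      using calculation(2) card_le_Suc0_iff_eq[of "X - Y"] fX by simp
    ultimately have "t z = z" using z by blast
    then show False using X(2) z by auto
  qed
  have "R \<subseteq> R'"
  proof
    fix z assume z: "z \<in> R"
    show "z \<in> R'"
    proof (rule ccontr)
      assume "z \<notin> R'"
      then show False
        using fixpt[OF sub(1) _ s(1), of "R \<inter> R'" z] sR cl ci z by blast
    qed
  qed
  moreover have "R' \<subseteq> R"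
  proof
    fix z assume z: "z \<in> R'"
    show "z \<in> R"
    proof (rule ccontr)
      assume zR: "z \<notin> R"
      have "s' k \<in> R \<inter> R'" if "k \<in> R \<inter> R'" for k using cl[OF that] agree[of k] that by simp
      then show False
        using fixpt[OF sub(2) _ s'(1), of "R \<inter> R'" z] sR' ci z zR by blast
    qed
  qed
  ultimately have RR: "R = R'" by blast
  have "q k = q' k" for k
  proof (cases "k \<in> R")
    case True
    have "s ` R = R" using sR fin(1) permutes_inj[OF s(1)] by (intro endo_inj_surj) (auto intro: inj_on_subset)
    then obtain j where j: "j \<in> R" "k = s j" using True by blast
    have "j \<in> R'" using j(1) RR by simp
    then have jR: "j < 4" "p j \<noteq> q j" "p j \<noteq> q' j" "s j = s' j"
      using j(1) agree[of j] by (simp_all add: R_def R'_def)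
    have "f (q (s j)) = e j" "f (q' (s' j)) = e j" using s(3)[OF jR(1,2)] s'(3)[OF jR(1,3)] by simp_all
    then have "f (q k) = f (q' k)" using j(2) jR(4) by simp
    moreover have "k \<in> {0..<4}" using True by (simp add: R_def)
    then have "q k \<in> {0..<4}" "q' k \<in> {0..<4}"
      by (simp_all only: permutes_in_image[OF q] permutes_in_image[OF q'])
    ultimately show ?thesis using inj_onD[OF f] by blast
  next
    case False
    then have "k \<notin> R'" using RR by simp
    show ?thesis
    proof (cases "k \<in> {0..<4}")
      case True
      then have "p k = q k" "p k = q' k" using \<open>k \<notin> R\<close> \<open>k \<notin> R'\<close> by (simp_all add: R_def R'_def)
      then show ?thesis by simp
    next
      case False
      then show ?thesis by (simp add: permutes_not_in[OF q] permutes_not_in[OF q'])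
    qed
  qed
  then show ?thesis by auto
qed

text \<open>\<open>Min\<close> and \<open>Max\<close> turn an unordered pair, which is a singleton
  for a diagonal entry, back into two indices; by symmetry of \<open>c\<close> their order does not
  matter.\<close>

lemma prod_perm_monomial:
  fixes c :: "nat \<Rightarrow> nat \<Rightarrow> 'a :: comm_monoid_mult"
  assumes "\<And>k l. k < r \<Longrightarrow> l < r \<Longrightarrow> c (e k) (f l) = c (f l) (e k)" and p: "p permutes {0..<r}"
  shows "(\<Prod>k = 0..<r. c (e k) (f (p k))) = prod_mset (image_mset (\<lambda>E. c (Min E) (Max E)) (perm_monomial r e f p))"
proof -
  have "c (e k) (f (p k)) = c (Min {e k, f (p k)}) (Max {e k, f (p k)})" if "k < r" for k
    using assms(1)[of k "p k"] that permutes_in_image[OF p, of k] by (cases "e k \<le> f (p k)") (auto simp: min_def max_def)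
  then show ?thesis unfolding perm_monomial_def prod_unfold_prod_mset multiset.map_comp o_def
    by (intro arg_cong[of _ _ prod_mset] image_mset_cong) auto
qed

text \<open>Terms of a minor with the same monomial have the same sign, so nothing cancels.\<close>

lemma singular_of_rank_le:
  assumes M: "lift_of n A M" and rk: "rank_le n M k"
    and IJ: "I \<subseteq> {..<n}" "J \<subseteq> {..<n}" "card I = Suc k" "card J = Suc k"
  shows "sym_trop_singular A I J"
proof (rule ccontr)
  assume ns: "\<not> sym_trop_singular A I J"
  let ?r = "Suc k"
  let ?e = "nth (sorted_list_of_set I)" let ?f = "nth (sorted_list_of_set J)"
  have fin: "finite I" "finite J" using finite_subset[OF IJ(1)] finite_subset[OF IJ(2)] by simp_all
  have e: "bij_betw ?e {0..<?r} I" and f: "bij_betw ?f {0..<?r} J"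
    using bij_betw_nth_sorted[OF fin(1)] bij_betw_nth_sorted[OF fin(2)] IJ(3,4) by auto
  obtain p where p: "p permutes {0..<?r}" and pq:
    "\<And>q. q permutes {0..<?r} \<Longrightarrow> perm_value A ?r ?e ?f p < perm_value A ?r ?e ?f q \<or>
       (perm_value A ?r ?e ?f q = perm_value A ?r ?e ?f p \<and> perm_monomial ?r ?e ?f q = perm_monomial ?r ?e ?f p)"
    by (rule perm_nonsingular[OF e f ns]) blast
  define v where "v = perm_value A ?r ?e ?f p"
  define c where "c i j = coef (M i j) (A i j)" for i j
  have en: "?e i < n" "?f i < n" if "i < ?r" for i
  proof -
    have "?e i \<in> I" "?f i \<in> J" using bij_betwE[OF e] bij_betwE[OF f] that by simp_all
    then show "?e i < n" "?f i < n" using IJ(1,2) by auto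
  qed
  have lead: "lead (A i j) (c i j) (M i j)" "c i j \<noteq> 0" "M i j = M j i" if "i < n" "j < n" for i j
    using M that unfolding lift_of_def c_def by (auto simp: lead_def)
  have csym: "c i j = c j i" if "i < n" "j < n" for i j
  proof -
    have eq: "M j i = M i j" by (rule lead(3)[OF that(2,1)])
    have "lead (A j i) (c j i) (M i j)" using lead(1)[OF that(2,1)] by (simp only: eq)
    then have "A j i = A i j" by (rule lead_unique[OF _ lead(1)[OF that] lead(2)[OF that(2,1)] lead(2)[OF that]])
    then show ?thesis by (simp only: c_def eq)
  qed
  \<comment> \<open>The coefficient at the optimal exponent \<open>v\<close> of the term of
    \<open>q\<close>; terms of larger value contribute 0 there.\<close>
  define C where "C q = (if perm_value A ?r ?e ?f q = v then of_int (sign q) * (\<Prod>i = 0..<?r. c (?e i) (?f (q i))) else 0)" for q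
  have "lead v (C q) (of_int (sign q) * (\<Prod>i = 0..<?r. M (?e i) (?f (q i))))" if q: "q permutes {0..<?r}" for q
  proof -
    have "lead (perm_value A ?r ?e ?f q) (\<Prod>i = 0..<?r. c (?e i) (?f (q i))) (\<Prod>i = 0..<?r. M (?e i) (?f (q i)))"
      unfolding perm_value_def
      by (rule lead_prod) (use lead(1) en permutes_in_image[OF q] in auto)
    then have "lead (perm_value A ?r ?e ?f q) (of_int (sign q) * (\<Prod>i = 0..<?r. c (?e i) (?f (q i)))) (of_int (sign q) * (\<Prod>i = 0..<?r. M (?e i) (?f (q i))))"
      by (simp add: lead_def coef_sign_mult)
    then show ?thesis using pq[OF q] unfolding C_def v_def by (auto intro: lead_less)
  qed
  then have "lead v (\<Sum>q\<in>{q. q permutes {0..<?r}}. C q) (sub_det M ?r ?e ?f)"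
    unfolding sub_det_expand by (intro lead_sum) auto
  moreover have "sub_det M ?r ?e ?f = 0" using rk IJ unfolding rank_le_iff_sorted by blast
  ultimately have zero: "(\<Sum>q\<in>{q. q permutes {0..<?r}}. C q) = 0" by (auto simp: lead_def)
  define P where "P = {q. q permutes {0..<?r} \<and> perm_value A ?r ?e ?f q = v}"
  have finP: "finite {q. q permutes {0..<?r}}" by (simp add: finite_permutations)
  have "C q = C p" if "q \<in> P" for q
  proof -
    have q: "q permutes {0..<?r}" "perm_value A ?r ?e ?f q = v" using that by (auto simp: P_def)
    then have mono: "perm_monomial ?r ?e ?f q = perm_monomial ?r ?e ?f p" using pq[OF q(1)] by (auto simp: v_def)
    have "sign q = sign p"
      by (rule sign_eq_of_same_monomial[OF _ _ q(1) p mono]) (use e f in \<open>auto simp: bij_betw_def\<close>)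
    moreover have "(\<Prod>i = 0..<?r. c (?e i) (?f (q i))) = (\<Prod>i = 0..<?r. c (?e i) (?f (p i)))"
      by (subst (1 2) prod_perm_monomial) (use csym en mono p q in auto)
    ultimately show ?thesis using q(2) by (simp add: C_def v_def)
  qed
  then have "(\<Sum>q\<in>P. C q) = of_nat (card P) * C p" by simp
  moreover have "(\<Sum>q\<in>{q. q permutes {0..<?r}}. C q) = (\<Sum>q\<in>P. C q)"
    by (rule sum.mono_neutral_right) (use finP in \<open>auto simp: P_def C_def\<close>)
  moreover have "card P \<noteq> 0" using p finP finite_subset[of P "{q. q permutes {0..<?r}}"] by (auto simp: P_def v_def)
  moreover have "C p \<noteq> 0"
    using lead(2) en permutes_in_image[OF p] by (auto simp: C_def v_def)
  ultimately show False using zero by simp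
qed

lemma tropical_basis_iff:
  assumes "1 \<le> r"
  shows "sym_minors_tropical_basis n r \<longleftrightarrow>
    (\<forall>A. symmetric_mat n A \<longrightarrow>
      (\<forall>I J. I \<subseteq> {..<n} \<and> J \<subseteq> {..<n} \<and> card I = r \<and> card J = r \<longrightarrow> sym_trop_singular A I J) \<longrightarrow>
      (\<exists>M. lift_of n A M \<and> rank_le n M (r - 1)))"
  unfolding sym_minors_tropical_basis_def exists_sym_lift_iff
  using singular_of_rank_le[where k = "r - 1"] assms by (auto 0 3)

section \<open>Optimal bijections and criteria for singularity\<close>

lemma optimal_bij_exists:
  assumes "finite I" "finite J" "card I = card J"
  obtains \<rho> where "bij_betw \<rho> I J" "\<And>\<rho>'. bij_betw \<rho>' I J \<Longrightarrow> trop_value A I \<rho> \<le> trop_value A I \<rho>'"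
proof -
  define r where "r = card I"
  obtain e where e: "bij_betw e {0..<r} I" using ex_bij_betw_nat_finite[OF assms(1)] r_def by blast
  obtain f where f: "bij_betw f {0..<r} J" using ex_bij_betw_nat_finite[OF assms(2)] r_def assms(3) by metis
  obtain p where p: "p permutes {0..<r}" and min: "\<And>q. q permutes {0..<r} \<Longrightarrow> perm_value A r e f p \<le> perm_value A r e f q"
    by (rule optimal_perm_exists[where A = A and e = e and f = f and r = r]) blast
  obtain \<rho> where \<rho>: "bij_betw \<rho> I J" "\<And>k. k < r \<Longrightarrow> \<rho> (e k) = f (p k)" by (rule perm_to_bij[OF e f p]) blast
  have "trop_value A I \<rho> \<le> trop_value A I \<rho>'" if \<rho>': "bij_betw \<rho>' I J" for \<rho>'
  proof -
    obtain s where s: "s permutes {0..<r}" "\<And>k. k < r \<Longrightarrow> \<rho>' (e k) = f (s k)" by (rule bij_to_perm[OF e f \<rho>']) blast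
    show ?thesis using min[OF s(1)]
      by (simp add: trop_value_eq[of e r I \<rho>' f s, OF e s(2)] trop_value_eq[of e r I \<rho> f p, OF e \<rho>(2)])
  qed
  then show ?thesis using that \<rho>(1) by blast
qed

lemma sym_trop_singularI:
  assumes "bij_betw \<rho> I J" "\<And>\<rho>'. bij_betw \<rho>' I J \<Longrightarrow> trop_value A I \<rho> \<le> trop_value A I \<rho>'"
    and "bij_betw \<rho>2 I J" "trop_value A I \<rho>2 = trop_value A I \<rho>" "sym_monomial I \<rho>2 \<noteq> sym_monomial I \<rho>"
  shows "sym_trop_singular A I J"
  unfolding sym_trop_singular_def using assms by metis

lemma sym_trop_singular_cong:
  assumes "\<And>i j. i \<in> I \<Longrightarrow> j \<in> J \<Longrightarrow> A i j = B i j"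
  shows "sym_trop_singular A I J \<longleftrightarrow> sym_trop_singular B I J"
proof -
  have "trop_value A I \<rho> = trop_value B I \<rho>" if "bij_betw \<rho> I J" for \<rho>
    unfolding trop_value_def using assms bij_betwE[OF that] by (intro sum.cong) auto
  then show ?thesis unfolding sym_trop_singular_def by metis
qed

text \<open>After the swap, row \<open>i\<close> carries the pair of \<open>i\<close> and
  \<open>\<rho> i'\<close>, which is neither of the two pairs that were removed. So a transposition
  always changes the monomial, even after the identification, and a tie under a swap is enough for
  singularity.\<close>

lemma swap_bij:
  assumes \<rho>: "bij_betw \<rho> I J" and fin: "finite I" and i: "i \<in> I" "i' \<in> I" "i \<noteq> i'"
  defines "\<rho>' \<equiv> \<rho>(i := \<rho> i', i' := \<rho> i)"
  shows "bij_betw \<rho>' I J"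
    and "trop_value A I \<rho>' = trop_value A I \<rho> - A i (\<rho> i) - A i' (\<rho> i') + A i (\<rho> i') + A i' (\<rho> i)"
    and "sym_monomial I \<rho>' \<noteq> sym_monomial I \<rho>"
proof -
  have "bij_betw (\<rho> \<circ> transpose i i') I J"
    by (rule bij_betw_trans[OF permutes_imp_bij[OF permutes_swap_id[OF i(1,2)]] \<rho>])
  moreover have "\<rho> \<circ> transpose i i' = \<rho>'" by (auto simp: \<rho>'_def transpose_def fun_eq_iff)
  ultimately show "bij_betw \<rho>' I J" by simp
  define K where "K = I - {i, i'}"
  have I: "I = insert i (insert i' K)" "i \<notin> K" "i' \<notin> K" "finite K" using i fin by (auto simp: K_def)
  have v: "trop_value A I \<sigma> = A i (\<sigma> i) + A i' (\<sigma> i') + trop_value A K \<sigma>" for \<sigma>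
    using I i(3) by (simp add: trop_value_def)
  have "trop_value A K \<rho>' = trop_value A K \<rho>"
    unfolding trop_value_def using I by (intro sum.cong) (auto simp: \<rho>'_def)
  then show "trop_value A I \<rho>' = trop_value A I \<rho> - A i (\<rho> i) - A i' (\<rho> i') + A i (\<rho> i') + A i' (\<rho> i)"
    using v[of \<rho>] v[of \<rho>'] i(3) by (simp add: \<rho>'_def)
  have m: "sym_monomial I \<sigma> = add_mset {i, \<sigma> i} (add_mset {i', \<sigma> i'} (sym_monomial K \<sigma>))" for \<sigma>
    using I i(3) by (simp add: sym_monomial_def)
  have K: "sym_monomial K \<rho>' = sym_monomial K \<rho>"
    unfolding sym_monomial_def using I by (intro image_mset_cong) (auto simp: \<rho>'_def)
  have neq: "\<rho> i \<noteq> \<rho> i'" using \<rho> i by (auto simp: bij_betw_def inj_on_def)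
  show "sym_monomial I \<rho>' \<noteq> sym_monomial I \<rho>"
  proof
    assume "sym_monomial I \<rho>' = sym_monomial I \<rho>"
    then have "add_mset {i, \<rho> i'} {#{i', \<rho> i}#} + sym_monomial K \<rho> = add_mset {i, \<rho> i} {#{i', \<rho> i'}#} + sym_monomial K \<rho>"
      using m[of \<rho>] m[of \<rho>'] K i(3) by (simp add: \<rho>'_def)
    then have "add_mset {i, \<rho> i'} {#{i', \<rho> i}#} = add_mset {i, \<rho> i} {#{i', \<rho> i'}#}" by (rule add_right_imp_eq)
    then have "{i, \<rho> i'} \<in># add_mset {i, \<rho> i} {#{i', \<rho> i'}#}" by (metis union_single_eq_member)
    then show False using neq i(3) by (auto simp: doubleton_eq_iff)
  qed
qed

lemma singular_swapI:
  assumes \<rho>: "bij_betw \<rho> I J" "\<And>\<rho>'. bij_betw \<rho>' I J \<Longrightarrow> trop_value A I \<rho> \<le> trop_value A I \<rho>'"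
    and fin: "finite I" and i: "i \<in> I" "i' \<in> I" "i \<noteq> i'"
    and eq: "A i (\<rho> i') + A i' (\<rho> i) = A i (\<rho> i) + A i' (\<rho> i')"
  shows "sym_trop_singular A I J"
  by (rule sym_trop_singularI[OF \<rho> swap_bij(1)[OF \<rho>(1) fin i]])
    (use swap_bij(2,3)[OF \<rho>(1) fin i] eq in auto)

text \<open>Extending the two optimal bijections of the complementary submatrix by
  \<open>i \<mapsto> \<rho> i\<close> gives a value at most that of \<open>\<rho>\<close>, hence an
  optimal one, and the common new factor keeps the monomials distinct.\<close>

lemma singular_extend:
  assumes \<rho>: "bij_betw \<rho> I J" "\<And>\<rho>'. bij_betw \<rho>' I J \<Longrightarrow> trop_value A I \<rho> \<le> trop_value A I \<rho>'"
    and fin: "finite I" and i: "i \<in> I" and sing: "sym_trop_singular A (I - {i}) (J - {\<rho> i})"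
  shows "sym_trop_singular A I J"
proof -
  obtain \<rho>1 \<rho>2 where *: "bij_betw \<rho>1 (I - {i}) (J - {\<rho> i})" "bij_betw \<rho>2 (I - {i}) (J - {\<rho> i})"
    "\<And>\<sigma>. bij_betw \<sigma> (I - {i}) (J - {\<rho> i}) \<Longrightarrow> trop_value A (I - {i}) \<rho>1 \<le> trop_value A (I - {i}) \<sigma>"
    "trop_value A (I - {i}) \<rho>2 = trop_value A (I - {i}) \<rho>1" "sym_monomial (I - {i}) \<rho>1 \<noteq> sym_monomial (I - {i}) \<rho>2"
    using sing unfolding sym_trop_singular_def by blast
  have J: "\<rho> i \<in> J" using bij_betwE[OF \<rho>(1)] i by blast
  have bij: "bij_betw (\<sigma>(i := \<rho> i)) I J" if "bij_betw \<sigma> (I - {i}) (J - {\<rho> i})" for \<sigma>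
  proof -
    have "bij_betw (\<sigma>(i := \<rho> i)) (I - {i}) (J - {\<rho> i})"
      by (rule bij_betw_cong[THEN iffD1, OF _ that]) simp
    then have "bij_betw (\<sigma>(i := \<rho> i)) (insert i (I - {i})) (insert (\<rho> i) (J - {\<rho> i}))"
      using notIn_Un_bij_betw[of i "I - {i}" "\<sigma>(i := \<rho> i)" "J - {\<rho> i}"] by simp
    then show ?thesis using i J by (simp add: insert_absorb)
  qed
  have val: "trop_value A I (\<sigma>(i := \<rho> i)) = A i (\<rho> i) + trop_value A (I - {i}) \<sigma>" for \<sigma>
  proof -
    have "trop_value A I (\<sigma>(i := \<rho> i)) = A i (\<rho> i) + trop_value A (I - {i}) (\<sigma>(i := \<rho> i))"
      unfolding trop_value_def by (subst sum.remove[OF fin i]) simp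
    also have "trop_value A (I - {i}) (\<sigma>(i := \<rho> i)) = trop_value A (I - {i}) \<sigma>"
      unfolding trop_value_def by (rule sum.cong) auto
    finally show ?thesis .
  qed
  have mon: "sym_monomial I (\<sigma>(i := \<rho> i)) = add_mset {i, \<rho> i} (sym_monomial (I - {i}) \<sigma>)" for \<sigma>
  proof -
    have "mset_set I = add_mset i (mset_set (I - {i}))" using mset_set.remove[OF fin i] .
    moreover have "image_mset (\<lambda>k. {k, (\<sigma>(i := \<rho> i)) k}) (mset_set (I - {i})) = image_mset (\<lambda>k. {k, \<sigma> k}) (mset_set (I - {i}))"
      by (rule image_mset_cong) (use fin in auto)
    ultimately show ?thesis unfolding sym_monomial_def by simp
  qed
  have "bij_betw \<rho> (I - {i}) (J - {\<rho> i})" using bij_betw_DiffI[OF \<rho>(1), of "{i}" "{\<rho> i}"] i J by simp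
  then have "trop_value A (I - {i}) \<rho>1 \<le> trop_value A (I - {i}) \<rho>" by (rule *(3))
  then have le: "trop_value A I (\<rho>1(i := \<rho> i)) \<le> trop_value A I \<rho>" using val[of \<rho>1] val[of \<rho>] by simp
  show ?thesis
  proof (rule sym_trop_singularI[OF bij[OF *(1)] _ bij[OF *(2)]])
    show "trop_value A I (\<rho>1(i := \<rho> i)) \<le> trop_value A I \<rho>'" if "bij_betw \<rho>' I J" for \<rho>'
      using le \<rho>(2)[OF that] by simp
  qed (use val mon *(4,5) in auto)
qed

section \<open>Propagation of counterexamples\<close>

definition obstruction :: "nat \<Rightarrow> nat \<Rightarrow> (nat \<Rightarrow> nat \<Rightarrow> real) \<Rightarrow> bool" where
  "obstruction n r A \<longleftrightarrow> symmetric_mat n A \<and>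
    (\<forall>I J. I \<subseteq> {..<n} \<and> J \<subseteq> {..<n} \<and> card I = r \<and> card J = r \<longrightarrow> sym_trop_singular A I J) \<and>
    \<not> (\<exists>M. lift_of n A M \<and> rank_le n M (r - 1))"

lemma not_tropical_basis_of_obstruction:
  "1 \<le> r \<Longrightarrow> obstruction n r A \<Longrightarrow> \<not> sym_minors_tropical_basis n r"
  unfolding tropical_basis_iff obstruction_def by blast

text \<open>A lift of the larger matrix restricts to one of \<open>A\<close>. A submatrix that
  contains both copies of the last row or column has a tie under their swap; any other submatrix is
  a copy of a submatrix of \<open>A\<close>.\<close>

lemma obstruction_duplicate:
  assumes n: "1 \<le> n" and A: "obstruction n r A"
  shows "obstruction (Suc n) r (\<lambda>i j. A (min i (n - 1)) (min j (n - 1)))"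
    (is "obstruction _ _ ?A'")
  unfolding obstruction_def
proof (intro conjI allI impI)
  let ?g = "\<lambda>i :: nat. min i (n - 1)"
  have g: "?g i < n" for i using n by auto
  have gid: "?g i = i" if "i < n" for i using that by auto
  show "symmetric_mat (Suc n) ?A'" using A g by (auto simp: obstruction_def symmetric_mat_def)
  show "\<not> (\<exists>M. lift_of (Suc n) ?A' M \<and> rank_le (Suc n) M (r - 1))"
  proof
    assume "\<exists>M. lift_of (Suc n) ?A' M \<and> rank_le (Suc n) M (r - 1)"
    then obtain M where M: "lift_of (Suc n) ?A' M" "rank_le (Suc n) M (r - 1)" by blast
    have "lift_of n A M"
      unfolding lift_of_def
    proof (intro allI impI)
      fix i j assume ij: "i < n" "j < n"
      show "M i j = M j i \<and> (\<exists>c. c \<noteq> 0 \<and> lead (A i j) c (M i j))"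
        using M(1)[unfolded lift_of_def, rule_format, OF less_SucI[OF ij(1)] less_SucI[OF ij(2)]]
        unfolding gid[OF ij(1)] gid[OF ij(2)] .
    qed
    moreover have "rank_le n M (r - 1)" by (rule rank_le_mono_n[OF M(2)]) simp
    ultimately show False using A by (auto simp: obstruction_def)
  qed
  fix I J assume IJ: "I \<subseteq> {..<Suc n} \<and> J \<subseteq> {..<Suc n} \<and> card I = r \<and> card J = r"
  have fin: "finite I" "finite J" using IJ finite_subset[of I "{..<Suc n}"] finite_subset[of J "{..<Suc n}"] by auto
  have inj: "inj_on ?g X" if X: "X \<subseteq> {..<Suc n}" and no: "\<not> (n - 1 \<in> X \<and> n \<in> X)" for X
  proof (rule inj_onI)
    fix x y assume xy: "x \<in> X" "y \<in> X" "?g x = ?g y"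
    have "x \<le> n" "y \<le> n" using xy X by auto
    then have "x = y \<or> (x = n \<and> y = n - 1) \<or> (x = n - 1 \<and> y = n)" using xy(3) by arith
    then show "x = y" using no xy(1,2) by blast
  qed
  obtain \<rho> where \<rho>: "bij_betw \<rho> I J" "\<And>\<rho>'. bij_betw \<rho>' I J \<Longrightarrow> trop_value ?A' I \<rho> \<le> trop_value ?A' I \<rho>'"
    using optimal_bij_exists[OF fin] IJ by metis
  consider "n - 1 \<in> I \<and> n \<in> I" | "n - 1 \<in> J \<and> n \<in> J" | "\<not> (n - 1 \<in> I \<and> n \<in> I)" "\<not> (n - 1 \<in> J \<and> n \<in> J)" by blast
  then show "sym_trop_singular ?A' I J"
  proof cases
    case 1
    show ?thesis by (rule singular_swapI[OF \<rho> fin(1), of "n - 1" n]) (use 1 n in auto)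
  next
    case 2
    then obtain i i' where i: "i \<in> I" "\<rho> i = n - 1" "i' \<in> I" "\<rho> i' = n"
      using \<rho>(1) by (metis bij_betw_iff_bijections)
    have "i \<noteq> i'" using i n by auto
    show ?thesis by (rule singular_swapI[OF \<rho> fin(1) i(1,3) \<open>i \<noteq> i'\<close>]) (use i in auto)
  next
    case 3
    obtain e where e: "bij_betw e {0..<r} I" using ex_bij_betw_nat_finite[OF fin(1)] IJ by metis
    obtain f where f: "bij_betw f {0..<r} J" using ex_bij_betw_nat_finite[OF fin(2)] IJ by metis
    have injI: "inj_on ?g I" and injJ: "inj_on ?g J" using inj[of I] inj[of J] IJ 3 by auto
    have e': "bij_betw (?g \<circ> e) {0..<r} (?g ` I)"
      by (rule bij_betw_trans[OF e inj_on_imp_bij_betw[OF injI]])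
    have f': "bij_betw (?g \<circ> f) {0..<r} (?g ` J)"
      by (rule bij_betw_trans[OF f inj_on_imp_bij_betw[OF injJ]])
    have "card (?g ` I) = r" "card (?g ` J) = r" using IJ card_image[OF injI] card_image[OF injJ] by auto
    moreover have "?g ` I \<subseteq> {..<n}" "?g ` J \<subseteq> {..<n}" using g by auto
    ultimately have "sym_trop_singular A (?g ` I) (?g ` J)" using A unfolding obstruction_def by blast
    then obtain p q where pq: "p permutes {0..<r}" "q permutes {0..<r}"
      "\<And>s. s permutes {0..<r} \<Longrightarrow> perm_value A r (?g \<circ> e) (?g \<circ> f) p \<le> perm_value A r (?g \<circ> e) (?g \<circ> f) s"
      "perm_value A r (?g \<circ> e) (?g \<circ> f) q = perm_value A r (?g \<circ> e) (?g \<circ> f) p"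
      "perm_monomial r (?g \<circ> e) (?g \<circ> f) p \<noteq> perm_monomial r (?g \<circ> e) (?g \<circ> f) q"
      unfolding sym_trop_singular_iff_perm[OF e' f'] by blast
    have v: "perm_value A r (?g \<circ> e) (?g \<circ> f) s = perm_value ?A' r e f s" for s
      by (simp add: perm_value_def)
    \<comment> \<open>Identifying the two copies maps the new monomials onto the old ones, so
      monomials that differ in \<open>A\<close> differ here as well.\<close>
    have m: "perm_monomial r (?g \<circ> e) (?g \<circ> f) s = image_mset ((`) ?g) (perm_monomial r e f s)" for s
      by (simp add: perm_monomial_def multiset.map_comp o_def)
    have "perm_monomial r e f p \<noteq> perm_monomial r e f q" using pq(5) unfolding m by metis
    then show ?thesis unfolding sym_trop_singular_iff_perm[OF e f]
      using pq(1-4) unfolding v by blast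
  qed
qed

text \<open>Eliminating the corner of a lift subtracts terms of degree \<open>2 * P\<close>, too
  large to change the degrees in \<open>A\<close>, so the Schur complement is a lift of
  \<open>A\<close> whose rank bound is one smaller. For singularity, a row and its image under an
  optimal bijection are deleted so that a submatrix of \<open>A\<close> remains.\<close>

lemma obstruction_border:
  assumes r: "1 \<le> r" and A: "obstruction n r A"
  obtains A' where "obstruction (Suc n) (Suc r) A'"
proof -
  have finA: "finite ((\<lambda>(i,j). A i j) ` ({..<n} \<times> {..<n}))" by simp
  \<comment> \<open>The inserted 0 gives \<open>P \<ge> 1\<close>, hence
    \<open>A i j \<le> P - 1 < 2 * P\<close>.\<close>
  define P where "P = Max (insert 0 ((\<lambda>(i,j). A i j) ` ({..<n} \<times> {..<n}))) + 1"
  have P: "A i j < 2 * P" if "i < n" "j < n" for i j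
  proof -
    have "A i j \<le> P - 1" "0 \<le> P - 1" unfolding P_def using finA that by (auto intro!: Max_ge)
    then show ?thesis by simp
  qed
  define A' where "A' i j = (if i = n \<and> j = n then 0 else if i = n \<or> j = n then P else A i j)" for i j
  have "obstruction (Suc n) (Suc r) A'"
    unfolding obstruction_def
  proof (intro conjI allI impI)
    show "symmetric_mat (Suc n) A'"
      using A by (auto simp: obstruction_def symmetric_mat_def A'_def)
    show "\<not> (\<exists>M. lift_of (Suc n) A' M \<and> rank_le (Suc n) M (Suc r - 1))"
    proof
      assume "\<exists>M. lift_of (Suc n) A' M \<and> rank_le (Suc n) M (Suc r - 1)"
      then obtain M where M: "lift_of (Suc n) A' M" "rank_le (Suc n) M (Suc (r - 1))" using r by auto
      have ld: "\<exists>c. c \<noteq> 0 \<and> lead (A' i j) c (M i j)" "M i j = M j i" if "i < Suc n" "j < Suc n" for i j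
        using M(1)[unfolded lift_of_def, rule_format, OF that] by auto
      obtain c where c: "c \<noteq> 0" "lead 0 c (M n n)" using ld(1)[of n n] by (auto simp: A'_def)
      have nz: "M n n \<noteq> 0" using c lead_nonzero by blast
      have "lift_of n A (chio n n M)"
        unfolding lift_of_def
      proof (intro allI impI conjI)
        fix i j assume ij: "i < n" "j < n"
        have "M i j = M j i" "M i n = M n i" "M n j = M j n" using ij by (intro ld(2); simp)+
        then show "chio n n M i j = chio n n M j i" by (simp add: chio_def)
        obtain a where a: "a \<noteq> 0" "lead (A i j) a (M i j)" using ld(1)[of i j] ij by (auto simp: A'_def)
        obtain b where b: "lead P b (M i n)" using ld(1)[of i n] ij by (auto simp: A'_def)
        obtain d where d: "lead P d (M n j)" using ld(1)[of n j] ij by (auto simp: A'_def)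
        have "lead (P + P - 0) (b * d / c) (M i n * M n j / M n n)"
          by (rule lead_divide[OF lead_mult[OF b d] c(2,1)])
        then have "lead (A i j) 0 (M i n * M n j / M n n)" by (rule lead_less) (use P ij in simp)
        from lead_diff[OF a(2) this] show "\<exists>c. c \<noteq> 0 \<and> lead (A i j) c (chio n n M i j)"
          using a(1) by (auto simp: chio_def)
      qed
      moreover have "rank_le n (chio n n M) (r - 1)"
        by (rule rank_le_mono_n[of "Suc n"], rule rank_le_chio[OF M(2) nz]) auto
      ultimately show False using A by (auto simp: obstruction_def)
    qed
    fix I J assume IJ: "I \<subseteq> {..<Suc n} \<and> J \<subseteq> {..<Suc n} \<and> card I = Suc r \<and> card J = Suc r"
    have fin: "finite I" "finite J" using IJ finite_subset[of I "{..<Suc n}"] finite_subset[of J "{..<Suc n}"] by auto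
    obtain \<rho> where \<rho>: "bij_betw \<rho> I J" "\<And>\<rho>'. bij_betw \<rho>' I J \<Longrightarrow> trop_value A' I \<rho> \<le> trop_value A' I \<rho>'"
      using optimal_bij_exists[OF fin] IJ by metis
    \<comment> \<open>The conditions on \<open>i\<close> ensure that deleting row \<open>i\<close>
      and column \<open>\<rho> i\<close> removes the border index \<open>n\<close> from both
      sides.\<close>
    have sub: "sym_trop_singular A' I J" if i: "i \<in> I" "n \<in> I \<Longrightarrow> i = n" "n \<in> J \<Longrightarrow> \<rho> i = n" for i
    proof (rule singular_extend[OF \<rho> fin(1) i(1)])
      have J: "\<rho> i \<in> J" using bij_betwE[OF \<rho>(1)] i(1) by blast
      have s: "I - {i} \<subseteq> {..<n}" "J - {\<rho> i} \<subseteq> {..<n}"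
        using IJ i(2,3) by (auto simp: less_Suc_eq subset_iff)
      have "sym_trop_singular A (I - {i}) (J - {\<rho> i})"
        using A s IJ i(1) J unfolding obstruction_def by (simp add: card_Diff_singleton)
      moreover have "A' x y = A x y" if "x \<in> I - {i}" "y \<in> J - {\<rho> i}" for x y
      proof -
        have "x < n" "y < n" using that s by blast+
        then show ?thesis by (simp add: A'_def)
      qed
      ultimately show "sym_trop_singular A' (I - {i}) (J - {\<rho> i})" using sym_trop_singular_cong by metis
    qed
    show "sym_trop_singular A' I J"
    proof (cases "n \<in> J")
      case True
      then obtain i where i: "i \<in> I" "\<rho> i = n" using \<rho>(1) by (metis bij_betw_iff_bijections)
      have "i = n" if nI: "n \<in> I"
      proof (rule ccontr)
        assume ne: "i \<noteq> n"
        then have "\<rho> n \<noteq> n" using \<rho>(1) i nI by (metis bij_betw_iff_bijections)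
        moreover have "\<rho> n \<in> J" using bij_betwE[OF \<rho>(1)] nI by blast
        ultimately have lt: "\<rho> n < n" "i < n" using IJ i ne by (auto simp: less_Suc_eq subset_iff)
        \<comment> \<open>The swap sends \<open>n\<close> to itself and replaces two border entries
          \<open>P\<close> by the corner 0 and one entry of \<open>A\<close>, which is
          cheaper.\<close>
        have "trop_value A' I \<rho> \<le> trop_value A' I (\<rho>(i := \<rho> n, n := \<rho> i))"
          by (rule \<rho>(2)[OF swap_bij(1)[OF \<rho>(1) fin(1) i(1) nI ne]])
        then show False unfolding swap_bij(2)[OF \<rho>(1) fin(1) i(1) nI ne]
          using i lt P[OF lt(2,1)] by (simp add: A'_def)
      qed
      then show ?thesis using sub[of i] i by blast
    next
      case False
      show ?thesis
      proof (cases "n \<in> I")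
        case True
        then show ?thesis using sub[of n] False by blast
      next
        case nI: False
        obtain i where "i \<in> I" using IJ by fastforce
        then show ?thesis using sub[of i] nI False by blast
      qed
    qed
  qed
  then show ?thesis using that by blast
qed

lemma obstruction_add_n: "obstruction n r A \<Longrightarrow> 1 \<le> n \<Longrightarrow> \<exists>A'. obstruction (n + k) r A'"
  by (induction k) (auto dest: obstruction_duplicate[rotated])

lemma obstruction_add_both: "obstruction n r A \<Longrightarrow> 1 \<le> r \<Longrightarrow> \<exists>A'. obstruction (n + k) (r + k) A'"
proof (induction k)
  case (Suc k)
  then obtain A' where "obstruction (n + k) (r + k) A'" by blast
  then obtain A'' where "obstruction (Suc (n + k)) (Suc (r + k)) A''"
    using obstruction_border[of "r + k" "n + k" A'] Suc.prems(2) by auto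
  then show ?case by auto
qed auto

section \<open>The cases r = 2 and r = 3\<close>

lemma sym_trop_singular_2:
  assumes "sym_trop_singular A {x,y} {x',y'}" and "x \<noteq> y" "x' \<noteq> y'"
  shows "A x x' + A y y' = A x y' + A y x'"
proof -
  obtain \<rho>1 \<rho>2 where *: "bij_betw \<rho>1 {x,y} {x',y'}" "bij_betw \<rho>2 {x,y} {x',y'}"
    "trop_value A {x,y} \<rho>2 = trop_value A {x,y} \<rho>1" "sym_monomial {x,y} \<rho>1 \<noteq> sym_monomial {x,y} \<rho>2"
    using assms(1) unfolding sym_trop_singular_def by blast
  have cases: "(\<rho> x = x' \<and> \<rho> y = y') \<or> (\<rho> x = y' \<and> \<rho> y = x')" if "bij_betw \<rho> {x,y} {x',y'}" for \<rho>
  proof -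
    have "\<rho> ` {x,y} = {x',y'}" using that by (simp add: bij_betw_def)
    then show ?thesis by (auto simp: doubleton_eq_iff)
  qed
  have v: "trop_value A {x,y} \<rho> = A x (\<rho> x) + A y (\<rho> y)" for \<rho> using assms(2) by (simp add: trop_value_def)
  have m: "sym_monomial {x,y} \<rho> = {#{x, \<rho> x}, {y, \<rho> y}#}" for \<rho> using assms(2) by (simp add: sym_monomial_def)
  have "\<rho>1 x \<noteq> \<rho>2 x \<or> \<rho>1 y \<noteq> \<rho>2 y" using *(4) unfolding m by metis
  then show ?thesis using cases[OF *(1)] cases[OF *(2)] *(3) unfolding v by auto
qed

lemma lift_exists_2:
  assumes n: "2 \<le> n" and sym: "symmetric_mat n A"
    and sing: "\<And>I J. I \<subseteq> {..<n} \<and> J \<subseteq> {..<n} \<and> card I = 2 \<and> card J = 2 \<Longrightarrow> sym_trop_singular A I J"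
  shows "\<exists>M. lift_of n A M \<and> rank_le n M 1"
proof -
  \<comment> \<open>The normalization makes \<open>a 0\<close> half of \<open>A 0 0\<close>, so that
    \<open>a i + a 0 = A i 0\<close>.\<close>
  define a where "a i = A i 0 - A 0 0 / 2" for i
  have A: "A i j = a i + a j" if ij: "i < n" "j < n" for i j
  proof -
    have "A i 0 = A 0 i" "A j 0 = A 0 j" using sym ij n by (auto simp: symmetric_mat_def)
    moreover have "A 0 0 + A i j = A 0 j + A i 0" if "i \<noteq> 0" "j \<noteq> 0"
      by (rule sym_trop_singular_2[OF sing]) (use that ij n in auto)
    ultimately show ?thesis unfolding a_def by (cases "i = 0"; cases "j = 0") simp_all
  qed
  define M where "M i j = monom_hs (a i) 1 * monom_hs (a j) 1" for i j
  have "lift_of n A M"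
    unfolding lift_of_def
  proof (intro allI impI conjI)
    fix i j assume "i < n" "j < n"
    then have "lead (A i j) (1 * 1) (M i j)" unfolding A[OF \<open>i < n\<close> \<open>j < n\<close>] M_def by (intro lead_mult lead_monom)
    then show "\<exists>c. c \<noteq> 0 \<and> lead (A i j) c (M i j)" by (intro exI[of _ 1]) simp
    show "M i j = M j i" by (simp add: M_def mult.commute)
  qed
  moreover have "rank_le n M 1"
    by (rule rank_le_factor[where P = "\<lambda>i l. monom_hs (a i) 1" and Q = "\<lambda>l j. monom_hs (a j) 1"]) (simp add: M_def)
  ultimately show ?thesis by blast
qed

section \<open>Singularity of 3 x 3 submatrices\<close>

lemma bij3_cases:
  assumes "bij_betw \<rho> {x,y,z} {x',y',z'}" "x \<noteq> y" "x \<noteq> z" "y \<noteq> z"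
  shows "(\<rho> x = x' \<and> \<rho> y = y' \<and> \<rho> z = z') \<or> (\<rho> x = x' \<and> \<rho> y = z' \<and> \<rho> z = y') \<or>
    (\<rho> x = y' \<and> \<rho> y = x' \<and> \<rho> z = z') \<or> (\<rho> x = z' \<and> \<rho> y = y' \<and> \<rho> z = x') \<or>
    (\<rho> x = y' \<and> \<rho> y = z' \<and> \<rho> z = x') \<or> (\<rho> x = z' \<and> \<rho> y = x' \<and> \<rho> z = y')"
proof -
  have im: "\<rho> ` {x,y,z} = {x',y',z'}" and inj: "inj_on \<rho> {x,y,z}" using assms(1) by (auto simp: bij_betw_def)
  have "\<rho> x \<in> {x',y',z'}" "\<rho> y \<in> {x',y',z'}" "\<rho> z \<in> {x',y',z'}" using im by blast+
  moreover have "\<rho> x \<noteq> \<rho> y" "\<rho> x \<noteq> \<rho> z" "\<rho> y \<noteq> \<rho> z" using inj assms(2-4) by (auto simp: inj_on_def)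
  ultimately show ?thesis unfolding insert_iff empty_iff by (elim disjE) simp_all
qed

lemma trop_value_3: "x \<noteq> y \<Longrightarrow> x \<noteq> z \<Longrightarrow> y \<noteq> z \<Longrightarrow> trop_value A {x,y,z} \<rho> = A x (\<rho> x) + A y (\<rho> y) + A z (\<rho> z)"
  by (simp add: trop_value_def)

lemma sym_monomial_3: "x \<noteq> y \<Longrightarrow> x \<noteq> z \<Longrightarrow> y \<noteq> z \<Longrightarrow> sym_monomial {x,y,z} \<rho> = {#{x, \<rho> x}, {y, \<rho> y}, {z, \<rho> z}#}"
  by (simp add: sym_monomial_def)

lemma bij3: "x \<noteq> y \<Longrightarrow> x \<noteq> z \<Longrightarrow> y \<noteq> z \<Longrightarrow> x' \<noteq> y' \<Longrightarrow> x' \<noteq> z' \<Longrightarrow> y' \<noteq> z' \<Longrightarrow>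
  bij_betw (\<lambda>i. if i = x then x' else if i = y then y' else z') {x,y,z} {x',y',z'}"
  by (auto simp: bij_betw_def inj_on_def)

text \<open>Of two optimal bijections with different monomials at least one is not the diagonal one.
  Listing the columns in another order puts any chosen bijection on the diagonal.\<close>

lemma sym_trop_singular_3_diag:
  assumes sing: "sym_trop_singular A {x,y,z} {x',y',z'}"
    and d: "x \<noteq> y" "x \<noteq> z" "y \<noteq> z" and d': "x' \<noteq> y'" "x' \<noteq> z'" "y' \<noteq> z'"
  defines "v \<equiv> A x x' + A y y' + A z z'"
  shows "A x x' + A y z' + A z y' \<le> v \<or> A x y' + A y x' + A z z' \<le> v \<or> A x z' + A y y' + A z x' \<le> v \<or>
    A x y' + A y z' + A z x' \<le> v \<or> A x z' + A y x' + A z y' \<le> v"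
proof -
  let ?I = "{x,y,z}" let ?J = "{x',y',z'}"
  obtain \<rho>1 \<rho>2 where *: "bij_betw \<rho>1 ?I ?J" "bij_betw \<rho>2 ?I ?J"
    "\<And>\<rho>. bij_betw \<rho> ?I ?J \<Longrightarrow> trop_value A ?I \<rho>1 \<le> trop_value A ?I \<rho>"
    "trop_value A ?I \<rho>2 = trop_value A ?I \<rho>1" "sym_monomial ?I \<rho>1 \<noteq> sym_monomial ?I \<rho>2"
    using sing unfolding sym_trop_singular_def by blast
  have v: "trop_value A ?I \<rho>1 \<le> v" using *(3)[OF bij3[OF d d']] d by (simp add: trop_value_3 v_def)
  have "\<exists>\<rho>. bij_betw \<rho> ?I ?J \<and> trop_value A ?I \<rho> \<le> v \<and> \<not> (\<rho> x = x' \<and> \<rho> y = y' \<and> \<rho> z = z')"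
  proof (cases "\<rho>1 x = x' \<and> \<rho>1 y = y' \<and> \<rho>1 z = z'")
    case True
    then have "\<not> (\<rho>2 x = x' \<and> \<rho>2 y = y' \<and> \<rho>2 z = z')" using *(5) unfolding sym_monomial_3[OF d] by auto
    then show ?thesis using *(2,4) v by auto
  qed (use * v in auto)
  then obtain \<rho> where \<rho>: "bij_betw \<rho> ?I ?J" "trop_value A ?I \<rho> \<le> v" "\<not> (\<rho> x = x' \<and> \<rho> y = y' \<and> \<rho> z = z')" by blast
  show ?thesis using bij3_cases[OF \<rho>(1) d] \<rho>(2,3) unfolding trop_value_3[OF d] by (elim disjE conjE) simp_all
qed

text \<open>In a principal submatrix both cyclic bijections give the same monomial.\<close>

lemma sym_trop_singular_3_cycle:
  assumes sing: "sym_trop_singular A {x,y,z} {x,y,z}"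
    and d: "x \<noteq> y" "x \<noteq> z" "y \<noteq> z"
  defines "v \<equiv> A x y + A y z + A z x"
  shows "A x x + A y y + A z z \<le> v \<or> A x x + A y z + A z y \<le> v \<or> A x y + A y x + A z z \<le> v \<or> A x z + A y y + A z x \<le> v"
proof -
  let ?I = "{x,y,z}"
  let ?cyc = "\<lambda>\<rho>. (\<rho> x = y \<and> \<rho> y = z \<and> \<rho> z = x) \<or> (\<rho> x = z \<and> \<rho> y = x \<and> \<rho> z = y)"
  obtain \<rho>1 \<rho>2 where *: "bij_betw \<rho>1 ?I ?I" "bij_betw \<rho>2 ?I ?I"
    "\<And>\<rho>. bij_betw \<rho> ?I ?I \<Longrightarrow> trop_value A ?I \<rho>1 \<le> trop_value A ?I \<rho>"
    "trop_value A ?I \<rho>2 = trop_value A ?I \<rho>1" "sym_monomial ?I \<rho>1 \<noteq> sym_monomial ?I \<rho>2"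
    using sing unfolding sym_trop_singular_def by blast
  have "bij_betw (\<lambda>i. if i = x then y else if i = y then z else x) {x,y,z} {y,z,x}"
    by (rule bij3) (use d in auto)
  moreover have "{y,z,x} = {x,y,z}" by auto
  ultimately have v: "trop_value A ?I \<rho>1 \<le> v" using *(3)[of "\<lambda>i. if i = x then y else if i = y then z else x"] d
    by (simp add: trop_value_3 v_def)
  have cyc: "sym_monomial ?I \<rho> = {#{x,y}, {y,z}, {x,z}#}" if "?cyc \<rho>" for \<rho>
    using that unfolding sym_monomial_3[OF d] by (auto simp: insert_commute add_mset_commute)
  have "\<exists>\<rho>. bij_betw \<rho> ?I ?I \<and> trop_value A ?I \<rho> \<le> v \<and> \<not> ?cyc \<rho>"
  proof (cases "?cyc \<rho>1")
    case True
    then have "\<not> ?cyc \<rho>2" using *(5) cyc by metis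
    then show ?thesis using *(2,4) v by auto
  qed (use * v in auto)
  then obtain \<rho> where \<rho>: "bij_betw \<rho> ?I ?I" "trop_value A ?I \<rho> \<le> v" "\<not> ?cyc \<rho>" by blast
  show ?thesis using bij3_cases[OF \<rho>(1) d] \<rho>(2,3) unfolding trop_value_3[OF d] by (elim disjE conjE) simp_all
qed

text \<open>All bijections gain the same constant. This is the tropical form of scaling rows and
  columns, and serves to make the diagonal 0.\<close>

lemma sym_trop_singular_shift:
  assumes "sym_trop_singular A I J" and B: "\<And>i j. i \<in> I \<Longrightarrow> j \<in> J \<Longrightarrow> B i j = A i j + u i + w j"
  shows "sym_trop_singular B I J"
proof -
  have "trop_value B I \<rho> = trop_value A I \<rho> + (\<Sum>i\<in>I. u i) + (\<Sum>j\<in>J. w j)" if \<rho>: "bij_betw \<rho> I J" for \<rho>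
  proof -
    have "trop_value B I \<rho> = (\<Sum>i\<in>I. A i (\<rho> i) + u i + w (\<rho> i))"
      unfolding trop_value_def using B bij_betwE[OF \<rho>] by (intro sum.cong) auto
    then show ?thesis by (simp add: sum.distrib trop_value_def sum.reindex_bij_betw[OF \<rho>])
  qed
  then show ?thesis using assms(1) unfolding sym_trop_singular_def by (metis add_le_cancel_right)
qed

text \<open>Coefficients for a four-point condition on a bipartite graph: \<open>E i j > d\<close> forces opposite
  coefficients at \<open>t\<^sup>d\<close>. A component is labelled by its smallest vertex and its two sides get opposite signs.\<close>

lemma realization:
  fixes E :: "nat \<Rightarrow> nat \<Rightarrow> real"
  assumes sym: "\<And>i j. i < n \<Longrightarrow> j < n \<Longrightarrow> E i j = E j i"
    and path: "\<And>i j k l d. i < n \<Longrightarrow> j < n \<Longrightarrow> k < n \<Longrightarrow> l < n \<Longrightarrow> E i k > d \<Longrightarrow> E k l > d \<Longrightarrow> E l j > d \<Longrightarrow> E i j > d"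
    and diag: "\<And>i j d. i < n \<Longrightarrow> j < n \<Longrightarrow> E i i > d \<Longrightarrow> E j j > d \<Longrightarrow> E i j > d"
  obtains z where "\<And>i j. i < n \<Longrightarrow> j < n \<Longrightarrow> \<exists>c. c \<noteq> 0 \<and> lead (E i j) c (z i + z j)"
proof -
  \<comment> \<open>In the graph of pairs with \<open>E i j > d\<close>, the hypothesis
    \<open>path\<close> turns each walk of length 3 into an edge. A component without loops is
    therefore complete bipartite, with sides \<open>S d i\<close> and \<open>N d i\<close>.\<close>
  define N where "N d i = {j. j < n \<and> E i j > d}" for d i
  define S where "S d i = {k. k < n \<and> (k = i \<or> (\<exists>j<n. E i j > d \<and> E j k > d))}" for d i
  \<comment> \<open>A loop at \<open>i\<close> forces twice the coefficient to vanish. Elsewhere the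
    added 1 keeps the label nonzero even for vertex 0.\<close>
  define c where "c d i = (if E i i > d then 0 else if N d i = {} \<or> Min (S d i) < Min (N d i)
      then complex_of_real (real (Min (S d i)) + 1) else - complex_of_real (real (Min (N d i)) + 1))" for d i
  have fin: "finite (N d i)" "finite (S d i)" for d i by (auto simp: N_def S_def)
  have Sne: "i \<in> S d i" if "i < n" for d i using that by (simp add: S_def)
  have NS: "N d j = S d i" if ij: "i < n" "j < n" "E i j > d" for d i j
  proof
    show "N d j \<subseteq> S d i" using ij by (auto simp: N_def S_def)
    show "S d i \<subseteq> N d j"
    proof
      fix k assume k: "k \<in> S d i"
      then have kn: "k < n" by (simp add: S_def)
      have ji: "E j i > d" using ij sym by simp
      consider "k = i" | m where "m < n" "E i m > d" "E m k > d" using k by (auto simp: S_def)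
      then have "E j k > d"
      proof cases
        case 2
        show ?thesis by (rule path[OF ij(2) kn ij(1) 2(1) ji 2(2,3)])
      qed (use ji in simp)
      then show "k \<in> N d j" using kn by (simp add: N_def)
    qed
  qed
  have opp: "c d i + c d j = 0" if ij: "i < n" "j < n" "E i j > d" for d i j
  proof -
    have ji: "E j i > d" using ij sym by simp
    have loop: "E i i > d \<longleftrightarrow> E j j > d"
      using path[OF ij(1,1,2,2) ij(3) _ ji] path[OF ij(2,2,1,1) ji _ ij(3)] by blast
    show ?thesis
    proof (cases "E i i > d")
      case True
      then show ?thesis using loop by (simp add: c_def)
    next
      case False
      have disj: "S d i \<inter> N d i = {}"
      proof (rule ccontr)
        assume "S d i \<inter> N d i \<noteq> {}"
        then obtain k where k: "k < n" "k \<in> S d i" "E i k > d" by (auto simp: N_def)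
        have "k \<noteq> i" using k False by auto
        then obtain m where m: "m < n" "E i m > d" "E m k > d" using k(2) by (auto simp: S_def)
        have "E k i > d" using k sym ij by simp
        then have "E i i > d" by (rule path[OF ij(1,1) m(1) k(1) m(2,3)])
        then show False using False by simp
      qed
      have eqs: "N d j = S d i" "N d i = S d j" using NS[OF ij] NS[OF ij(2,1) ji] by auto
      have ne: "S d i \<noteq> {}" "N d i \<noteq> {}" using Sne[OF ij(1), of d] Sne[OF ij(2), of d] eqs(2) by blast+
      have "Min (S d i) \<in> S d i" "Min (N d i) \<in> N d i"
        by (rule Min_in[OF fin(2) ne(1)], rule Min_in[OF fin(1) ne(2)])
      then have "Min (S d i) \<noteq> Min (N d i)" using disj by auto
      moreover have "N d i \<noteq> {}" "N d j \<noteq> {}" using Sne[OF ij(1), of d] Sne[OF ij(2), of d] eqs by auto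
      ultimately show ?thesis using False loop unfolding c_def eqs(1) eqs(2)[symmetric] by auto
    qed
  qed
  have nz: "c d i \<noteq> 0" if "\<not> E i i > d" for d i
  proof -
    have "real k + 1 \<noteq> 0" for k by simp
    then show ?thesis using that unfolding c_def by (auto simp del: of_real_add)
  qed
  \<comment> \<open>Equal labels with opposite signs mean opposite sides of one component. Through
    the labelling vertex there is then a walk of length 1 or 3 from \<open>i\<close> to
    \<open>j\<close>, hence an edge, although \<open>E i j\<close> equals \<open>d\<close>.\<close>
  have key: False if ij: "i < n" "j < n" "E i j = d" "N d j \<noteq> {}" "Min (S d i) = Min (N d j)" for d i j
  proof -
    define m where "m = Min (N d j)"
    have "m \<in> S d i" using Min_in[OF fin(2), of d i] Sne[OF ij(1), of d] ij(5) by (auto simp: m_def)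
    moreover have "m \<in> N d j" using Min_in[OF fin(1) ij(4)] by (simp add: m_def)
    ultimately have m: "m < n" "E m j > d" "m = i \<or> (\<exists>u<n. E i u > d \<and> E u m > d)"
      using sym ij by (auto simp: N_def S_def)
    have "E i j > d"
    proof (cases "m = i")
      case False
      then obtain u where u: "u < n" "E i u > d" "E u m > d" using m by blast
      show ?thesis by (rule path[OF ij(1,2) u(1) m(1) u(2,3) m(2)])
    qed (use m in simp)
    then show False using ij by simp
  qed
  have at: "c d i + c d j \<noteq> 0" if ij: "i < n" "j < n" "E i j = d" for d i j
  proof
    assume 0: "c d i + c d j = 0"
    have ji: "E j i = d" using ij sym by simp
    \<comment> \<open>Two vanishing coefficients would mean two loops, which \<open>diag\<close>
      joins by an edge.\<close>
    have "\<not> (E i i > d \<and> E j j > d)" using diag[OF ij(1,2), of d] ij(3) by auto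
    moreover have "c d i = 0 \<longleftrightarrow> c d j = 0" using 0 by (metis add.right_neutral add_0)
    ultimately have le: "\<not> E i i > d" "\<not> E j j > d" using nz unfolding c_def by (metis, metis)
    have pos: "real k + 1 \<noteq> - (real l + 1)" for k l by linarith
    define P where "P x \<longleftrightarrow> N d x = {} \<or> Min (S d x) < Min (N d x)" for x
    define rc where "rc x = (if P x then real (Min (S d x)) + 1 else - (real (Min (N d x)) + 1))" for x
    have c: "c d x = complex_of_real (rc x)" if "\<not> E x x > d" for x using that by (simp add: c_def rc_def P_def)
    have "complex_of_real (rc i + rc j) = 0" using 0 c le by simp
    then have r0: "rc i + rc j = 0" by (simp only: of_real_eq_0_iff)
    then have "(P i \<and> \<not> P j \<and> Min (S d i) = Min (N d j)) \<or> (P j \<and> \<not> P i \<and> Min (S d j) = Min (N d i))"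
      unfolding rc_def by (auto split: if_splits)
    then show False using key[OF ij] key[OF ij(2,1) ji] unfolding P_def by blast
  qed
  define D where "D = (\<lambda>(i,j). E i j) ` ({..<n} \<times> {..<n})"
  have finD: "finite D" by (simp add: D_def)
  define z where "z i = (\<Sum>d\<in>D. monom_hs d (c d i))" for i
  have cz: "coef (z i) a = (if a \<in> D then c a i else 0)" for i a
    unfolding z_def using finD by (simp add: coef_monom)
  have "\<exists>b. b \<noteq> 0 \<and> lead (E i j) b (z i + z j)" if ij: "i < n" "j < n" for i j
  proof (intro exI conjI)
    show "c (E i j) i + c (E i j) j \<noteq> 0" using at[OF ij refl] .
    have "E i j \<in> D" using ij by (auto simp: D_def)
    then show "lead (E i j) (c (E i j) i + c (E i j) j) (z i + z j)"
      using opp[OF ij] by (auto simp: lead_def cz)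
  qed
  then show ?thesis using that by blast
qed

lemma lift_exists_3:
  assumes n: "3 \<le> n" and sym: "symmetric_mat n A"
    and sing: "\<And>I J. I \<subseteq> {..<n} \<and> J \<subseteq> {..<n} \<and> card I = 3 \<and> card J = 3 \<Longrightarrow> sym_trop_singular A I J"
  shows "\<exists>M. lift_of n A M \<and> rank_le n M 2"
proof -
  define B where "B i j = A i j - (A i i + A j j) / 2" for i j
  have Bs: "B i j = B j i" if "i < n" "j < n" for i j using sym that by (simp add: B_def symmetric_mat_def)
  have B0: "B i i = 0" for i by (simp add: B_def)
  have singB: "sym_trop_singular B {x,y,z} {x',y',z'}"
    if "x < n" "y < n" "z < n" "x' < n" "y' < n" "z' < n" "x \<noteq> y" "x \<noteq> z" "y \<noteq> z" "x' \<noteq> y'" "x' \<noteq> z'" "y' \<noteq> z'"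
    for x y z x' y' z'
    by (rule sym_trop_singular_shift[of A _ _ _ "\<lambda>i. - A i i / 2" "\<lambda>i. - A i i / 2"], rule sing)
      (use that in \<open>auto simp: B_def field_simps\<close>)
  \<comment> \<open>Only negative entries carry a distance; a nonnegative entry means distance 0 and
    leaves \<open>B i j\<close> free.\<close>
  define m where "m i j = max 0 (- 2 * B i j)" for i j
  have ms: "m i j = m j i" if "i < n" "j < n" for i j using Bs[OF that] by (simp add: m_def)
  have m0: "m i i = 0" and mpos: "0 \<le> m i j" and mB: "- m i j / 2 \<le> B i j"
    and mB': "0 < m i j \<Longrightarrow> B i j = - m i j / 2" for i j by (auto simp: m_def B0)
  have triple: "B y z \<le> 0 \<or> B x z \<le> 0 \<or> B x y \<le> 0" "m x y = m x z + m y z \<or> m x z = m x y + m y z \<or> m y z = m x y + m x z"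
    if lt: "x < n" "y < n" "z < n" and d: "x \<noteq> y" "x \<noteq> z" "y \<noteq> z" for x y z
  proof -
    define a where "a = B y z" define b where "b = B x z" define c where "c = B x y"
    have s: "B y z = a" "B z y = a" "B x z = b" "B z x = b" "B x y = c" "B y x = c"
      using Bs lt by (simp_all add: a_def b_def c_def)
    \<comment> \<open>The five monomials of a principal submatrix have values 0,
      \<open>2 * a\<close>, \<open>2 * b\<close>, \<open>2 * c\<close> and \<open>a + b + c\<close>.
      Four orders of the columns, together with the cyclic monomial, express that none of them is
      the unique minimum.\<close>
    have I: "sym_trop_singular B {x,y,z} {x,y,z}" "sym_trop_singular B {x,y,z} {x,z,y}"
      "sym_trop_singular B {x,y,z} {y,x,z}" "sym_trop_singular B {x,y,z} {z,y,x}"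
      by (rule singB; use lt d in simp)+
    note F = sym_trop_singular_3_diag[OF I(1) d d] sym_trop_singular_3_diag[OF I(2) d d(2,1) d(3)[symmetric]]
      sym_trop_singular_3_diag[OF I(3) d d(1)[symmetric] d(3,2)]
      sym_trop_singular_3_diag[OF I(4) d d(3)[symmetric] d(2)[symmetric] d(1)[symmetric]]
      sym_trop_singular_3_cycle[OF I(1) d]
    note F = F[unfolded s B0]
    show "B y z \<le> 0 \<or> B x z \<le> 0 \<or> B x y \<le> 0" using F(1) unfolding s by linarith
    show "m x y = m x z + m y z \<or> m x z = m x y + m y z \<or> m y z = m x y + m x z"
      using F unfolding m_def s by (smt (verit))
  qed
  have coll: "m x y = m x z + m y z \<or> m x z = m x y + m y z \<or> m y z = m x y + m x z"
    if "x < n" "y < n" "z < n" for x y z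
  proof (cases "x = y \<or> x = z \<or> y = z")
    case True
    then show ?thesis using ms that m0 by auto
  qed (use triple(2) that in blast)
  \<comment> \<open>All points lie between the two points \<open>a\<close> and \<open>b\<close> of
    largest distance, so the distance from \<open>a\<close> is a candidate coordinate.\<close>
  let ?V = "(\<lambda>(i,j). m i j) ` ({..<n} \<times> {..<n})"
  have "(0, 0) \<in> {..<n} \<times> {..<n}" using n by simp
  then have "?V \<noteq> {}" "finite ?V" by auto
  then have "Max ?V \<in> ?V" using Max_in by blast
  then obtain q where q: "Max ?V = (case q of (i,j) \<Rightarrow> m i j)" "q \<in> {..<n} \<times> {..<n}" by (rule imageE)
  obtain a b where "q = (a, b)" by (cases q)
  then have ab: "a < n" "b < n" "Max ?V = m a b" using q by auto
  define D where "D = m a b"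
  have Dmax: "m i j \<le> D" if "i < n" "j < n" for i j
    unfolding D_def ab(3)[symmetric] using that by (intro Max_ge) auto
  define p where "p i = m a i" for i
  have pb: "m b i = D - p i" "0 \<le> p i" "p i \<le> D" if "i < n" for i
    using coll[OF ab(1,2) that] Dmax[OF ab(1) that] Dmax[OF ab(2) that] mpos[of a i] mpos[of b i]
    unfolding D_def p_def by linarith+
  have line: "m i j = \<bar>p i - p j\<bar>" if ij: "i < n" "j < n" for i j
  proof (rule ccontr)
    assume ne: "m i j \<noteq> \<bar>p i - p j\<bar>"
    \<comment> \<open>If the coordinates give the wrong distance, both \<open>a\<close> and
      \<open>b\<close> lie between \<open>i\<close> and \<open>j\<close>. Then
      \<open>a, i, b, j\<close> is a four-cycle with equal opposite sides and both diagonals equal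
      to \<open>D\<close>.\<close>
    have 1: "m i j = p i + p j" using coll[OF ab(1) ij] ne mpos[of i j] unfolding p_def by (smt (verit))
    have 2: "m i j = (D - p i) + (D - p j)"
      using coll[OF ab(2) ij] ne pb[OF ij(1)] pb[OF ij(2)] mpos[of i j] by (smt (verit))
    have sum: "p i + p j = D" "m i j = D" using 1 2 by auto
    have strict: "0 < p i" "p i < D" "0 < p j" "p j < D"
      using sum ne pb[OF ij(1)] pb[OF ij(2)] by (smt (verit))+
    have pa: "p a = 0" "p b = D" by (simp_all add: p_def m0 D_def)
    have d: "a \<noteq> b" "a \<noteq> i" "b \<noteq> i" "b \<noteq> a" "b \<noteq> j" "a \<noteq> j"
      using pa strict pb(1)[of a] by auto
    have v: "B a b = - D / 2" "B b a = - D / 2" "B i j = - D / 2" "B b j = - p i / 2" "B i a = - p i / 2"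
      "B a j = - p j / 2" "B i b = - p j / 2"
    proof -
      show "B a b = - D / 2" using mB'[of a b] strict D_def by linarith
      then show "B b a = - D / 2" using Bs ab by simp
      show "B i j = - D / 2" using mB'[of i j] strict sum by linarith
      show "B b j = - p i / 2" using mB'[of b j] pb(1)[OF ij(2)] strict sum by linarith
      have "B a i = - p i / 2" using mB'[of a i] strict by (simp add: p_def)
      then show "B i a = - p i / 2" using Bs ab ij by simp
      show "B a j = - p j / 2" using mB'[of a j] strict by (simp add: p_def)
      have "B b i = - p j / 2" using mB'[of b i] pb(1)[OF ij(1)] strict sum by linarith
      then show "B i b = - p j / 2" using Bs ab ij by simp
    qed
    \<comment> \<open>Its diagonal uses the long distances \<open>D\<close> only and is the unique
      minimum, with value \<open>-3 * D / 2\<close>.\<close>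
    have "sym_trop_singular B {a,b,i} {b,a,j}" by (rule singB) (use ab ij d in auto)
    from sym_trop_singular_3_diag[OF this d(1-6)] show False
      unfolding v B0 using strict sum by linarith
  qed
  \<comment> \<open>Since \<open>B i j\<close> is at least minus half the distance,
    \<open>E i j\<close> is at least the smaller of the two coordinates, with equality when they
    differ: the behaviour of degrees of sums.\<close>
  define E where "E i j = B i j + (p i + p j) / 2" for i j
  have Es: "E i j = E j i" if "i < n" "j < n" for i j using Bs[OF that] by (simp add: E_def)
  have Eii: "E i i = p i" for i by (simp add: E_def B0)
  have Ege: "min (p i) (p j) \<le> E i j" if "i < n" "j < n" for i j
    using mB[of i j] unfolding line[OF that] E_def by (cases "p i \<le> p j") (simp_all add: field_simps)
  have Eeq: "E i j = min (p i) (p j)" if "i < n" "j < n" "p i \<noteq> p j" for i j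
    using mB'[of i j] that(3) unfolding line[OF that(1,2)] E_def by (cases "p i \<le> p j") (simp_all add: field_simps)
  obtain z where z: "\<And>i j. i < n \<Longrightarrow> j < n \<Longrightarrow> \<exists>c. c \<noteq> 0 \<and> lead (E i j) c (z i + z j)"
  proof (rule realization[of n E])
    show "E i j = E j i" if "i < n" "j < n" for i j using Es that .
    show "E i j > d" if "i < n" "j < n" "E i i > d" "E j j > d" for i j d
      using Ege[OF that(1,2)] that(3,4) unfolding Eii by (simp add: min_def split: if_splits)
    fix i j k l d assume lt: "i < n" "j < n" "k < n" "l < n" and gt: "E i k > d" "E k l > d" "E l j > d"
    show "E i j > d"
    proof (rule ccontr)
      assume "\<not> E i j > d"
      then have le: "E i k > E i j" "E k l > E i j" "E l j > E i j" using gt by auto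
      \<comment> \<open>For \<open>p i < p j\<close> the entry \<open>E i j\<close> is
        \<open>p i\<close>. Larger values of \<open>E\<close> along the walk force first
        \<open>p k\<close> and then \<open>p l\<close> to equal \<open>p i\<close>, and then
        \<open>E l j\<close> is also \<open>p i\<close>. The opposite inequality is handled from the
        other end.\<close>
      have pij: "p i = p j"
      proof (rule ccontr)
        assume ne: "p i \<noteq> p j"
        then have e: "E i j = min (p i) (p j)" using Eeq lt by blast
        show False
        proof (cases "p i < p j")
          case True
          have "p k = p i" using Eeq[OF lt(1,3)] le(1) e True by (cases "p i = p k") auto
          moreover have "p l = p k" using Eeq[OF lt(3,4)] le(2) e True calculation by (cases "p k = p l") auto
          ultimately show False using Eeq[OF lt(4,2)] le(3) e True by auto
        next
          case False
          have "p l = p j" using Eeq[OF lt(4,2)] le(3) e False ne by (cases "p l = p j") auto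
          moreover have "p k = p l" using Eeq[OF lt(3,4)] le(2) e False ne calculation by (cases "p k = p l") auto
          ultimately show False using Eeq[OF lt(1,3)] le(1) e False ne by auto
        qed
      qed
      have e: "p i \<le> E i j" using Ege[OF lt(1,2)] pij by simp
      have pk: "p k = p i" using Eeq[OF lt(1,3)] le(1) e by (cases "p i = p k") auto
      have pl: "p l = p i" using Eeq[OF lt(4,2)] le(3) e pij by (cases "p l = p j") auto
      have BE: "B i j = E i j - p i" "B i k = E i k - p i" "B k l = E k l - p i" "B l j = E l j - p i"
        using pij pk pl by (simp_all add: E_def field_simps)
      have B: "B i j \<ge> 0" "B i k > B i j" "B k l > B i j" "B l j > B i j" using BE le e by auto
      have il: "0 \<le> B i l" "0 \<le> B k j"
        using mB[of i l] line[OF lt(1,4)] mB[of k j] line[OF lt(3,2)] pk pl pij by auto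
      have d: "i \<noteq> k" "k \<noteq> l" "l \<noteq> j" "k \<noteq> j" "l \<noteq> i" using B B0[of i] B0[of k] B0[of l] Bs[OF lt(2,1)] Bs lt by auto
      \<comment> \<open>No triple has three positive entries, so the chords \<open>B i l\<close>
        and, below, \<open>B k j\<close> must vanish.\<close>
      have ikl: "B i l = 0" using triple(1)[OF lt(1,3,4)] d B il by (metis antisym le_less_trans not_le)
      show False
      proof (cases "i = j")
        case True
        then show False using ikl B Bs[OF lt(4,2)] B0 by auto
      next
        case False
        have kj: "B k j = 0" using triple(1)[OF lt(3,4,2)] d B il by (metis antisym le_less_trans not_le)
        have s: "B l i = 0" "B k i = B i k" "B l k = B k l" "B k j = 0" using ikl kj Bs lt by auto
        \<comment> \<open>The diagonal has value \<open>B i j + 0 + 0\<close>; each other bijection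
          uses one of the larger entries \<open>B i k\<close>, \<open>B k l\<close>,
          \<open>B l j\<close>, so the minimum would be unique.\<close>
        have "sym_trop_singular B {i,l,k} {j,i,k}" by (rule singB) (use lt d False in auto)
        from sym_trop_singular_3_diag[OF this] show False
          using d False B unfolding s B0 by auto
      qed
    qed
  qed blast
  define h where "h i = (A i i - p i) / 2" for i
  define M where "M i j = monom_hs (h i) 1 * monom_hs (h j) 1 * (z i + z j)" for i j
  have "lift_of n A M"
    unfolding lift_of_def
  proof (intro allI impI conjI)
    fix i j assume ij: "i < n" "j < n"
    show "M i j = M j i" by (simp add: M_def mult_ac add.commute)
    obtain c where c: "c \<noteq> 0" "lead (E i j) c (z i + z j)" using z[OF ij] by blast
    have "lead (h i + h j + E i j) (1 * 1 * c) (M i j)" unfolding M_def by (intro lead_mult lead_monom c(2))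
    moreover have "h i + h j + E i j = A i j" by (simp add: h_def E_def B_def field_simps)
    ultimately show "\<exists>c. c \<noteq> 0 \<and> lead (A i j) c (M i j)" using c(1) by auto
  qed
  moreover have "rank_le n M 2"
  proof (rule rank_le_factor[where P = "\<lambda>i l. if l = 0 then monom_hs (h i) 1 * z i else monom_hs (h i) 1"
        and Q = "\<lambda>l j. if l = 0 then monom_hs (h j) 1 else monom_hs (h j) 1 * z j"])
    show "M i j = (\<Sum>l<(2::nat). (if l = 0 then monom_hs (h i) 1 * z i else monom_hs (h i) 1) *
        (if l = 0 then monom_hs (h j) 1 else monom_hs (h j) 1 * z j))" for i j
      by (simp add: M_def numeral_2_eq_2 algebra_simps)
  qed
  ultimately show ?thesis by blast
qed

section \<open>The case r = n\<close>

lemma lead_of_nat: "lead 0 (of_nat n) (of_nat n)"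
  by (induction n) (auto intro: lead_0 lead_add lead_1)

text \<open>If the leading terms of a discriminant cancel, then \<open>d = 0\<close>, and the
  conclusion still says that \<open>s\<close> has no terms up to exponent \<open>v\<close>. So the
  quadratic formula can be read off at exponent \<open>v\<close> in all cases.\<close>

lemma lead_of_square:
  assumes sx: "s * s = x" and x: "lead (v + v) d x"
  obtains \<sigma> where "lead v \<sigma> s" "\<sigma> * \<sigma> = d"
proof (cases "s = 0")
  case True
  then have "d = 0" using sx x by (auto simp: lead_def)
  then show ?thesis using that[of 0] True by (simp add: lead_0)
next
  case False
  then obtain e \<sigma> where e: "\<sigma> \<noteq> 0" "lead e \<sigma> s" using lead_exists by blast
  have le: "lead (e + e) (\<sigma> * \<sigma>) x" using lead_mult[OF e(2) e(2)] sx by simp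
  consider "e < v" | "e = v" | "v < e" by linarith
  then show ?thesis
  proof cases
    case 1
    then have "coef x (e + e) = 0" using x by (simp add: lead_def)
    then show ?thesis using le e(1) by (simp add: lead_def)
  next
    case 2
    then have "\<sigma> * \<sigma> = d" using le x by (simp add: lead_def)
    then show ?thesis using that e 2 by blast
  next
    case 3
    then have "lead v 0 s" using lead_less[OF e(2)] by simp
    moreover have "lead (v + v) 0 x" using lead_less[OF le] 3 by simp
    then have "d = 0" using x by (simp add: lead_def)
    ultimately show ?thesis using that by simp
  qed
qed

text \<open>A complex polynomial \<open>a + b Y + c Y^2\<close> with at least two nonzero
  coefficients has a nonzero root; the quadratic formula lifts such a root. The sign of the square
  root is chosen so that no leading terms cancel.\<close>

lemma quadratic_root:
  assumes q: "lead v a q0" "lead v b q1" "lead v c q2"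
    and two: "(a \<noteq> 0 \<and> b \<noteq> 0) \<or> (a \<noteq> 0 \<and> c \<noteq> 0) \<or> (b \<noteq> 0 \<and> c \<noteq> 0)"
  obtains y e where "e \<noteq> 0" "lead 0 e y" "q0 + q1 * y + q2 * y\<^sup>2 = 0"
proof -
  obtain s where s: "s * s = q1 * q1 - 4 * (q0 * q2)" by (rule hs_sqrt_exists)
  have "lead (0 + (v + v)) (4 * (a * c)) (4 * (q0 * q2))"
    using lead_mult[OF lead_of_nat[of 4] lead_mult[OF q(1,3)]] by simp
  then have "lead (v + v) (b * b - 4 * (a * c)) (q1 * q1 - 4 * (q0 * q2))"
    using lead_diff[OF lead_mult[OF q(2,2)]] by simp
  from lead_of_square[OF s this] obtain \<sigma> where \<sigma>: "lead v \<sigma> s" "\<sigma> * \<sigma> = b * b - 4 * (a * c)" .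
  have neg: "lead v (- \<sigma>) (- s)" "(- s) * (- s) = q1 * q1 - 4 * (q0 * q2)"
    using \<sigma>(1) s by (simp_all add: lead_uminus)
  show ?thesis
  proof (cases "a = 0")
    case False
    have "\<exists>\<tau> u. lead v \<tau> u \<and> u * u = q1 * q1 - 4 * (q0 * q2) \<and> b + \<tau> \<noteq> 0"
    proof (cases "b + \<sigma> = 0")
      case True
      have "b + - \<sigma> \<noteq> 0"
      proof
        assume "b + - \<sigma> = 0"
        then have "b = 0" "\<sigma> = 0" using True by (simp_all add: add_eq_0_iff)
        then show False using \<sigma>(2) two False by simp
      qed
      then show ?thesis using neg by blast
    qed (use \<sigma>(1) s in blast)
    then obtain \<tau> u where u: "lead v \<tau> u" "u * u = q1 * q1 - 4 * (q0 * q2)" "b + \<tau> \<noteq> 0" by blast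
    define t where "t = q1 + u"
    have lt: "lead v (b + \<tau>) t" unfolding t_def by (rule lead_add[OF q(2) u(1)])
    have t0: "t \<noteq> 0" using lead_nonzero[OF lt u(3)] .
    \<comment> \<open>The rationalized quadratic formula, because \<open>q2\<close> may
      vanish.\<close>
    define y where "y = - (2 * q0) / t"
    have "lead (0 + v) (2 * a) (2 * q0)" using lead_mult[OF lead_of_nat[of 2] q(1)] by simp
    then have "lead (v - v) (- (2 * a) / (b + \<tau>)) y"
      unfolding y_def by (intro lead_divide lead_uminus lt u(3)) simp
    moreover have "- (2 * a) / (b + \<tau>) \<noteq> 0" using False u(3) by simp
    moreover have "q0 + q1 * y + q2 * y\<^sup>2 = 0"
    proof -
      have yt: "y * t = - (2 * q0)" using t0 by (simp add: y_def)
      have "(q0 + q1 * y + q2 * y\<^sup>2) * (t * t) = q0 * (t * t) + q1 * (y * t) * t + q2 * (y * t) * (y * t)"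
        by (simp add: algebra_simps power2_eq_square)
      also have "\<dots> = q0 * (u * u - (q1 * q1 - 4 * (q0 * q2)))"
        by (simp only: yt) (simp add: t_def algebra_simps)
      also have "\<dots> = 0" by (simp add: u(2))
      finally show ?thesis using t0 by simp
    qed
    ultimately show ?thesis using that[of "- (2 * a) / (b + \<tau>)" y] by simp
  next
    case True
    then have bc: "b \<noteq> 0" "c \<noteq> 0" using two by auto
    have "(\<sigma> - b) * (\<sigma> + b) = 0" using \<sigma>(2) True by (simp add: algebra_simps)
    then have "\<sigma> = b \<or> \<sigma> = - b" by (simp add: eq_neg_iff_add_eq_0)
    \<comment> \<open>With this sign the numerator \<open>u - q1\<close> has leading coefficient
      \<open>-2 * b\<close>, which is nonzero.\<close>
    then obtain u where u: "lead v (- b) u" "u * u = q1 * q1 - 4 * (q0 * q2)" using \<sigma>(1) s neg by auto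
    have l2: "lead v (2 * c) (2 * q2)" using lead_mult[OF lead_of_nat[of 2] q(3)] by simp
    define y where "y = (u - q1) / (2 * q2)"
    have n2: "2 * q2 \<noteq> 0" using lead_nonzero[OF l2] bc by simp
    have "lead (v - v) ((- b - b) / (2 * c)) y"
      unfolding y_def by (intro lead_divide lead_diff u(1) q(2) l2) (use bc in simp)
    moreover have "(- b - b) / (2 * c) \<noteq> 0" using bc by simp
    moreover have "q0 + q1 * y + q2 * y\<^sup>2 = 0"
    proof -
      have y2: "2 * q2 * y = u - q1" using n2 by (simp add: y_def)
      have "(2 * q2) * (2 * (q0 + q1 * y + q2 * y\<^sup>2)) = 4 * (q0 * q2) + 2 * q1 * (2 * q2 * y) + (2 * q2 * y) * (2 * q2 * y)"
        by (simp add: algebra_simps power2_eq_square)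
      also have "\<dots> = u * u - (q1 * q1 - 4 * (q0 * q2))" by (simp only: y2) (simp add: algebra_simps)
      also have "\<dots> = 0" by (simp add: u(2))
      finally have "2 * (q0 + q1 * y + q2 * y\<^sup>2) = 0" using n2 by simp
      moreover have "(2 :: hahn_series) \<noteq> 0" using n2 by auto
      ultimately show ?thesis using mult_eq_0_iff by blast
    qed
    ultimately show ?thesis using that[of "(- b - b) / (2 * c)" y] by simp
  qed
qed

section \<open>Weights that separate monomials\<close>

lemma base_expansion_unique:
  fixes a b :: "nat \<Rightarrow> nat"
  assumes "\<And>x. a x < B" "\<And>x. b x < B" "(\<Sum>x<N. a x * B ^ x) = (\<Sum>x<N. b x * B ^ x)" "x < N"
  shows "a x = b x"
  using assms
proof (induction N arbitrary: a b x)
  case (Suc N)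
  have exp: "(\<Sum>x<Suc N. c x * B ^ x) = c 0 + B * (\<Sum>x<N. c (Suc x) * B ^ x)" for c :: "nat \<Rightarrow> nat"
    by (subst sum.lessThan_Suc_shift) (simp add: sum_distrib_left mult_ac)
  have eq: "a 0 + B * (\<Sum>x<N. a (Suc x) * B ^ x) = b 0 + B * (\<Sum>x<N. b (Suc x) * B ^ x)"
    using Suc.prems(3) unfolding exp .
  have "(a 0 + B * (\<Sum>x<N. a (Suc x) * B ^ x)) mod B = a 0" "(b 0 + B * (\<Sum>x<N. b (Suc x) * B ^ x)) mod B = b 0"
    using Suc.prems(1,2) by simp_all
  then have 0: "a 0 = b 0" using eq by simp
  have "B \<noteq> 0" using Suc.prems(1)[of 0] by auto
  then have eq': "(\<Sum>x<N. a (Suc x) * B ^ x) = (\<Sum>x<N. b (Suc x) * B ^ x)" using eq 0 by simp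
  show ?case
  proof (cases x)
    case (Suc x')
    then show ?thesis using Suc.IH[of "\<lambda>x. a (Suc x)" "\<lambda>x. b (Suc x)" x', OF _ _ eq'] Suc.prems by simp
  qed (simp add: 0)
qed simp

lemma sum_mset_base_expansion:
  fixes X :: "nat multiset"
  assumes "\<And>x. x \<in># X \<Longrightarrow> x < N"
  shows "(\<Sum>x\<in>#X. B ^ x) = (\<Sum>x<N. count X x * B ^ x)"
  using assms
proof (induction X)
  case (add y X)
  have "(\<Sum>x<N. count (add_mset y X) x * B ^ x) = (\<Sum>x<N. count X x * B ^ x + (if x = y then B ^ x else 0))"
    by (rule sum.cong) auto
  also have "\<dots> = (\<Sum>x<N. count X x * B ^ x) + B ^ y" using add.prems[of y] by (simp add: sum.distrib)
  finally show ?case using add by simp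
qed simp

text \<open>Multiplicities are at most \<open>n\<close>, so they are the digits of the total weight
  in base \<open>n + 1\<close>, with the code of a pair as position.\<close>

lemma edge_weight_injective:
  fixes X Y :: "nat set multiset"
  assumes fin: "\<And>E. E \<in># X \<Longrightarrow> finite E" "\<And>E. E \<in># Y \<Longrightarrow> finite E" and size: "size X \<le> n" "size Y \<le> n"
    and eq: "(\<Sum>E\<in>#X. Suc n ^ set_encode E) = (\<Sum>E\<in>#Y. Suc n ^ set_encode E)"
  shows "X = Y"
proof -
  let ?X = "image_mset set_encode X" let ?Y = "image_mset set_encode Y"
  define N where "N = Suc (Max (insert 0 (set_mset ?X \<union> set_mset ?Y)))"
  have N: "x < N" if "x \<in># ?X \<or> x \<in># ?Y" for x
    unfolding N_def less_Suc_eq_le using that by (intro Max_ge) auto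
  have sum: "(\<Sum>E\<in>#Z. Suc n ^ set_encode E) = (\<Sum>x\<in>#image_mset set_encode Z. Suc n ^ x)" for Z :: "nat set multiset"
    by (simp add: multiset.map_comp o_def)
  have eq': "(\<Sum>x<N. count ?X x * Suc n ^ x) = (\<Sum>x<N. count ?Y x * Suc n ^ x)"
    using eq unfolding sum using sum_mset_base_expansion[of ?X N "Suc n"] sum_mset_base_expansion[of ?Y N "Suc n"] N by simp
  have bound: "count ?X x < Suc n" "count ?Y x < Suc n" for x
    using count_le_size[of ?X x] count_le_size[of ?Y x] size by simp_all
  have "count ?X x = count ?Y x" for x
  proof (cases "x < N")
    case True
    then show ?thesis using base_expansion_unique[OF bound eq'] by blast
  next
    case False
    then show ?thesis using N[of x] by (metis count_eq_zero_iff)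
  qed
  then have XY: "?X = ?Y" by (simp add: multiset_eq_iff)
  have dec: "image_mset set_decode (image_mset set_encode Z) = Z" if "\<And>E. E \<in># Z \<Longrightarrow> finite E" for Z
  proof -
    have "image_mset (\<lambda>E. set_decode (set_encode E)) Z = image_mset (\<lambda>E. E) Z"
      by (rule image_mset_cong) (simp add: that set_encode_inverse)
    then show ?thesis by (simp add: multiset.map_comp o_def)
  qed
  show ?thesis using arg_cong[OF XY, of "image_mset set_decode"] dec[OF fin(1)] dec[OF fin(2)] by simp
qed

lemma prod_mset_marked: "(\<Prod>E\<in>#X. if E = E0 then y else 1) = (y :: 'a :: comm_monoid_mult) ^ count X E0"
  by (induction X) auto

lemma lift_exists_full:
  assumes n: "1 \<le> n" and sym: "symmetric_mat n A" and sing: "sym_trop_singular A {..<n} {..<n}"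
  shows "\<exists>M. lift_of n A M \<and> rank_le n M (n - 1)"
proof -
  let ?P = "{p. p permutes {0..<n}}"
  define mono where "mono p = perm_monomial n (\<lambda>i. i) (\<lambda>i. i) p" for p
  define val where "val p = perm_value A n (\<lambda>i. i) (\<lambda>i. i) p" for p
  have finP: "finite ?P" by (simp add: finite_permutations)
  have bij: "bij_betw (\<lambda>i. i) {0..<n} {..<n}" by (simp add: bij_betw_def atLeast0LessThan)
  obtain p1 p2 where p12: "p1 permutes {0..<n}" "p2 permutes {0..<n}"
    "\<And>q. q permutes {0..<n} \<Longrightarrow> val p1 \<le> val q" "val p2 = val p1" "mono p1 \<noteq> mono p2"
    using sing unfolding sym_trop_singular_iff_perm[OF bij bij] mono_def val_def by blast
  define v where "v = val p1"
  obtain E0 where E0: "count (mono p1) E0 \<noteq> count (mono p2) E0" using p12(5) by (auto simp: multiset_eq_iff)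
  define k where "k p = count (mono p) E0" for p
  \<comment> \<open>A pair can occur only in the rows that it names, so at most twice.\<close>
  have k2: "k p \<le> 2" for p
  proof -
    have c: "k p = card {i \<in> {0..<n}. {i, p i} = E0}"
      unfolding k_def mono_def perm_monomial_def by (simp add: count_image_mset_eq_card_vimage)
    show ?thesis
    proof (cases "{i \<in> {0..<n}. {i, p i} = E0} = {}")
      case False
      obtain i where "{i, p i} = E0" using False by blast
      then have E: "finite E0" "card E0 \<le> 2" by (auto simp: card_insert_if)
      have "{i \<in> {0..<n}. {i, p i} = E0} \<subseteq> E0" by blast
      from card_mono[OF E(1) this] show ?thesis using c E(2) by simp
    next
      case True
      then show ?thesis using c by (simp only: True) simp
    qed
  qed
  define w where "w E = Suc n ^ set_encode E" for E :: "nat set"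
  define W where "W p = (\<Sum>i = 0..<n. w {i, p i})" for p
  have Winj: "mono p = mono q" if "W p = W q" for p q
  proof (rule edge_weight_injective[of _ _ n])
    have "(\<Sum>E\<in>#mono r. Suc n ^ set_encode E) = W r" for r
      unfolding mono_def perm_monomial_def W_def w_def sum_unfold_sum_mset by (simp add: multiset.map_comp o_def)
    then show "(\<Sum>E\<in>#mono p. Suc n ^ set_encode E) = (\<Sum>E\<in>#mono q. Suc n ^ set_encode E)" using that by simp
  qed (auto simp: mono_def perm_monomial_def)
  have sgn: "sign p = sign q" if "p permutes {0..<n}" "q permutes {0..<n}" "mono p = mono q" for p q
    by (rule sign_eq_of_same_monomial[OF _ _ that(1,2)]) (use that(3) in \<open>auto simp: mono_def\<close>)
  define C where "C l = {p \<in> ?P. val p = v \<and> k p = l}" for l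
  have finC: "finite (C l)" for l using finP by (simp add: C_def)
  \<comment> \<open>If the entry at the pair \<open>E\<close> has coefficient
    \<open>s ^ w E\<close>, then \<open>poly (R l) s\<close> is the coefficient at exponent
    \<open>v\<close> of the factor of \<open>y ^ l\<close> in the determinant.\<close>
  define R where "R l = (\<Sum>p\<in>C l. monom (of_int (sign p) :: complex) (W p))" for l
  \<comment> \<open>Terms of equal weight have the same monomial and hence the same sign, so nothing
    cancels.\<close>
  have R0: "R l \<noteq> 0" if p: "p \<in> C l" for l p
  proof -
    have "coeff (R l) (W p) = (\<Sum>q\<in>C l. if W q = W p then of_int (sign q) else 0)"
      by (simp add: R_def coeff_sum)
    also have "\<dots> = (\<Sum>q\<in>C l. if W q = W p then of_int (sign p) else 0)"
    proof (rule sum.cong[OF refl])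
      fix q assume "q \<in> C l"
      then show "(if W q = W p then of_int (sign q) else 0) = (if W q = W p then of_int (sign p) else (0::complex))"
        using sgn[of q p] Winj[of q p] p by (auto simp: C_def)
    qed
    also have "\<dots> = of_nat (card {q \<in> C l. W q = W p}) * of_int (sign p)"
      using finC by (simp add: sum.If_cases Int_def)
    also have "\<dots> \<noteq> 0" using p finC by (auto simp: card_gt_0_iff)
    finally show ?thesis by auto
  qed
  have pC: "p1 \<in> C (k p1)" "p2 \<in> C (k p2)" using p12 by (auto simp: C_def v_def)
  \<comment> \<open>The last factor makes the chosen \<open>s\<close> nonzero.\<close>
  have "R (k p1) * R (k p2) * [:0, 1:] \<noteq> 0" using R0[OF pC(1)] R0[OF pC(2)] by simp
  then obtain s where s: "poly (R (k p1)) s \<noteq> 0" "poly (R (k p2)) s \<noteq> 0" "s \<noteq> 0"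
    using poly_all_0_iff_0[of "R (k p1) * R (k p2) * [:0, 1:]"] by auto
  define U where "U i j = monom_hs (A i j) (s ^ w {i,j})" for i j
  define T where "T p = of_int (sign p) * (\<Prod>i = 0..<n. U i (p i))" for p
  define q where "q l = (\<Sum>p\<in>{p \<in> ?P. k p = l}. T p)" for l
  have lq: "lead v (poly (R l) s) (q l)" for l
  proof -
    define c where "c p = (if val p = v then of_int (sign p) * s ^ W p else 0)" for p
    have "lead v (c p) (T p)" if p: "p permutes {0..<n}" for p
    proof -
      have "lead (val p) (\<Prod>i = 0..<n. s ^ w {i, p i}) (\<Prod>i = 0..<n. U i (p i))"
        unfolding val_def perm_value_def U_def by (intro lead_prod lead_monom) simp
      moreover have "(\<Prod>i = 0..<n. s ^ w {i, p i}) = s ^ W p" by (simp add: W_def power_sum)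
      ultimately have "lead (val p) (of_int (sign p) * s ^ W p) (T p)" by (simp add: lead_def T_def coef_sign_mult)
      moreover have "v \<le> val p" using p12(3)[OF p] by (simp add: v_def)
      ultimately show ?thesis unfolding c_def by (auto intro: lead_less)
    qed
    then have "lead v (\<Sum>p\<in>{p \<in> ?P. k p = l}. c p) (q l)" unfolding q_def by (intro lead_sum) auto
    moreover have "(\<Sum>p\<in>{p \<in> ?P. k p = l}. c p) = poly (R l) s"
    proof -
      have "(\<Sum>p\<in>{p \<in> ?P. k p = l}. c p) = (\<Sum>p\<in>C l. c p)"
        by (rule sum.mono_neutral_right) (use finP in \<open>auto simp: C_def c_def\<close>)
      also have "\<dots> = poly (R l) s" unfolding R_def poly_sum
        by (rule sum.cong) (auto simp: c_def C_def poly_monom)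
      finally show ?thesis .
    qed
    ultimately show ?thesis by simp
  qed
  have "(poly (R 0) s \<noteq> 0 \<and> poly (R 1) s \<noteq> 0) \<or> (poly (R 0) s \<noteq> 0 \<and> poly (R 2) s \<noteq> 0) \<or> (poly (R 1) s \<noteq> 0 \<and> poly (R 2) s \<noteq> 0)"
  proof -
    have "k p1 \<noteq> k p2" using E0 by (simp add: k_def)
    moreover have "k p1 = 0 \<or> k p1 = 1 \<or> k p1 = 2" "k p2 = 0 \<or> k p2 = 1 \<or> k p2 = 2" using k2[of p1] k2[of p2] by linarith+
    ultimately show ?thesis using s(1,2) by auto
  qed
  from quadratic_root[OF lq lq lq this] obtain y e where y: "e \<noteq> 0" "lead 0 e y" "q 0 + q 1 * y + q 2 * y\<^sup>2 = 0" .
  define M where "M i j = (if {i,j} = E0 then y else 1) * U i j" for i j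
  have "lift_of n A M"
    unfolding lift_of_def
  proof (intro allI impI conjI)
    fix i j assume ij: "i < n" "j < n"
    have "A i j = A j i" using sym ij by (simp add: symmetric_mat_def)
    then show "M i j = M j i" by (simp add: M_def U_def insert_commute)
    have "lead 0 (if {i,j} = E0 then e else 1) (if {i,j} = E0 then y else 1)" using y(2) lead_1 by simp
    then have "lead (0 + A i j) ((if {i,j} = E0 then e else 1) * s ^ w {i,j}) (M i j)"
      unfolding M_def U_def by (intro lead_mult lead_monom)
    moreover have "(if {i,j} = E0 then e else 1) * s ^ w {i,j} \<noteq> 0" using y(1) s(3) by simp
    ultimately show "\<exists>c. c \<noteq> 0 \<and> lead (A i j) c (M i j)" unfolding add_0 by blast
  qed
  moreover have "rank_le n M (n - 1)"
    unfolding rank_le_iff_sorted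
  proof (intro allI impI, elim conjE)
    fix I J assume IJ: "I \<subseteq> {..<n}" "J \<subseteq> {..<n}" "card I = Suc (n - 1)" "card J = Suc (n - 1)"
    have "I = {..<n}" "J = {..<n}" using IJ n card_subset_eq[of "{..<n}"] by auto
    then have "sub_det M (Suc (n - 1)) (nth (sorted_list_of_set I)) (nth (sorted_list_of_set J)) = sub_det M n (\<lambda>i. i) (\<lambda>i. i)"
      using n by (simp, intro sub_det_cong) (simp add: lessThan_atLeast0)
    also have "\<dots> = (\<Sum>p\<in>?P. T p * y ^ k p)"
      unfolding sub_det_expand
    proof (rule sum.cong[OF refl])
      fix p
      have "(\<Prod>i = 0..<n. if {i, p i} = E0 then y else 1) = (\<Prod>E\<in>#mono p. if E = E0 then y else 1)"
        unfolding mono_def perm_monomial_def prod_unfold_prod_mset by (simp add: multiset.map_comp o_def)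
      also have "\<dots> = y ^ k p" by (simp add: prod_mset_marked k_def)
      finally show "of_int (sign p) * (\<Prod>i = 0..<n. M i (p i)) = T p * y ^ k p"
        unfolding M_def T_def prod.distrib by (simp add: mult_ac)
    qed
    also have "\<dots> = (\<Sum>l\<in>{0,1,2}. \<Sum>p\<in>{p \<in> ?P. k p = l}. T p * y ^ k p)"
    proof (rule sum.group[symmetric, OF finP])
      have "k p = 0 \<or> k p = 1 \<or> k p = 2" for p using k2[of p] by linarith
      then show "k ` ?P \<subseteq> {0,1,2}" unfolding image_subset_iff insert_iff by simp
    qed simp
    also have "\<dots> = (\<Sum>l\<in>{0,1,2}. q l * y ^ l)"
      unfolding q_def sum_distrib_right by (intro sum.cong) auto
    also have "\<dots> = 0" using y(3) by (simp add: algebra_simps)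
    finally show "sub_det M (Suc (n - 1)) (nth (sorted_list_of_set I)) (nth (sorted_list_of_set J)) = 0" .
  qed
  ultimately show ?thesis by blast
qed

section \<open>A 6 x 6 counterexample for r = 5\<close>

text \<open>Linear programming duality certifies optimality of a bijection: row and column potentials
  bound every entry from below, with equality along the bijection.\<close>

lemma singular_of_potentials:
  assumes fin: "finite I" "finite J" "card I = card J"
    and le: "\<And>i j. i \<in> I \<Longrightarrow> j \<in> J \<Longrightarrow> u i + v j \<le> A i j"
    and p: "p ` I = J" "\<And>i. i \<in> I \<Longrightarrow> A i (p i) = u i + v (p i)"
    and q: "q ` I = J" "\<And>i. i \<in> I \<Longrightarrow> A i (q i) = u i + v (q i)"
    and w: "w \<in> I" "\<And>k. k \<in> I \<Longrightarrow> {w, p w} \<noteq> {k, q k}"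
  shows "sym_trop_singular A I J"
proof (rule sym_trop_singularI)
  show bp: "bij_betw p I J" using p(1) fin by (auto simp: bij_betw_def intro: eq_card_imp_inj_on)
  show bq: "bij_betw q I J" using q(1) fin by (auto simp: bij_betw_def intro: eq_card_imp_inj_on)
  have tight: "trop_value A I \<rho> = (\<Sum>i\<in>I. u i) + (\<Sum>j\<in>J. v j)"
    if "bij_betw \<rho> I J" "\<And>i. i \<in> I \<Longrightarrow> A i (\<rho> i) = u i + v (\<rho> i)" for \<rho>
    using that(2) by (simp add: trop_value_def sum.distrib sum.reindex_bij_betw[OF that(1)])
  show "trop_value A I p \<le> trop_value A I \<rho>" if \<rho>: "bij_betw \<rho> I J" for \<rho>
  proof -
    have "(\<Sum>i\<in>I. u i) + (\<Sum>j\<in>J. v j) = (\<Sum>i\<in>I. u i + v (\<rho> i))"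
      by (simp add: sum.distrib sum.reindex_bij_betw[OF \<rho>])
    also have "\<dots> \<le> trop_value A I \<rho>" unfolding trop_value_def
      using le bij_betwE[OF \<rho>] by (intro sum_mono) auto
    finally show ?thesis using tight[OF bp p(2)] by simp
  qed
  show "trop_value A I q = trop_value A I p" using tight[OF bp p(2)] tight[OF bq q(2)] by simp
  show "sym_monomial I q \<noteq> sym_monomial I p"
  proof
    assume "sym_monomial I q = sym_monomial I p"
    then have "set_mset (sym_monomial I q) = set_mset (sym_monomial I p)" by simp
    then have "(\<lambda>i. {i, q i}) ` I = (\<lambda>i. {i, p i}) ` I" using fin(1) by (simp add: sym_monomial_def)
    then show False using w by blast
  qed
qed

definition matrix6 :: "int list list" where
  "matrix6 = [[0, 2, 0, 0, 1, 2], [2, 2, 0, 0, 2, 2], [0, 0, 1, 2, 1, 2],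
              [0, 0, 2, 2, 2, 2], [1, 2, 1, 2, 0, 0], [2, 2, 2, 2, 0, 0]]"

text \<open>In a certificate \<open>(a, b, u, v, p, q, w)\<close>, row \<open>a\<close> and column \<open>b\<close> are deleted (position \<open>a\<close> of \<open>u\<close>,
  \<open>p\<close>, \<open>q\<close> and position \<open>b\<close> of \<open>v\<close> are junk), \<open>u\<close> and \<open>v\<close> are potentials, \<open>p\<close> and \<open>q\<close> are optimal
  bijections, and the factor of \<open>p\<close> at row \<open>w\<close> does not occur in the monomial of \<open>q\<close>.\<close>

fun certificate6 :: "nat \<times> nat \<times> int list \<times> int list \<times> nat list \<times> nat list \<times> nat \<Rightarrow> bool" where
  "certificate6 (a, b, u, v, p, q, w) \<longleftrightarrow>
     (let I = filter (\<lambda>i. i \<noteq> a) [0, 1, 2, 3, 4, 5]; J = filter (\<lambda>j. j \<noteq> b) [0, 1, 2, 3, 4, 5] in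
      list_all (\<lambda>i. list_all (\<lambda>j. u ! i + v ! j \<le> matrix6 ! i ! j) J) I \<and>
      list_all (\<lambda>j. list_ex (\<lambda>i. p ! i = j) I) J \<and>
      list_all (\<lambda>i. p ! i \<noteq> b \<and> p ! i < 6 \<and> matrix6 ! i ! (p ! i) = u ! i + v ! (p ! i)) I \<and>
      list_all (\<lambda>j. list_ex (\<lambda>i. q ! i = j) I) J \<and>
      list_all (\<lambda>i. q ! i \<noteq> b \<and> q ! i < 6 \<and> matrix6 ! i ! (q ! i) = u ! i + v ! (q ! i)) I \<and>
      w \<noteq> a \<and> w < 6 \<and>
      list_all (\<lambda>k. \<not> (w = k \<and> p ! w = q ! k) \<and> \<not> (w = q ! k \<and> p ! w = k)) I)"

definition certificates6 :: "(nat \<times> nat \<times> int list \<times> int list \<times> nat list \<times> nat list \<times> nat) list" where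
  "certificates6 = [
   (0,0, [0,0,1,1,0,0], [0,-1,0,0,0,0], [0,3,2,1,5,4], [0,3,2,1,4,5],5),
   (0,1, [0,0,1,1,0,0], [-1,0,0,0,0,0], [0,3,2,0,5,4], [0,3,2,0,4,5],5),
   (0,2, [0,0,0,0,0,0], [0,0,0,0,0,0], [0,3,1,0,5,4], [0,3,1,0,4,5],5),
   (0,3, [0,0,0,0,0,0], [0,0,0,0,0,0], [0,2,1,0,5,4], [0,2,1,0,4,5],5),
   (0,4, [0,0,0,0,1,1], [0,0,0,0,0,-1], [0,3,1,0,2,5], [0,3,0,1,2,5],3),
   (0,5, [0,0,0,0,1,1], [0,0,0,0,-1,0], [0,3,1,0,2,4], [0,3,0,1,2,4],3),
   (1,0, [0,0,1,1,0,0], [0,-1,0,0,0,0], [3,0,2,1,5,4], [3,0,2,1,4,5],5),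
   (1,1, [0,0,1,1,0,0], [-1,0,0,0,0,0], [3,0,2,0,5,4], [3,0,2,0,4,5],5),
   (1,2, [0,0,0,0,0,0], [0,0,0,0,0,0], [3,0,1,0,5,4], [3,0,1,0,4,5],5),
   (1,3, [0,0,0,0,0,0], [0,0,0,0,0,0], [2,0,1,0,5,4], [2,0,1,0,4,5],5),
   (1,4, [0,0,0,0,1,1], [0,0,0,0,0,-1], [3,0,1,0,2,5], [3,0,0,1,2,5],2),
   (1,5, [0,0,0,0,1,1], [0,0,0,0,-1,0], [3,0,1,0,2,4], [3,0,0,1,2,4],2),
   (2,0, [0,0,0,0,0,0], [0,0,0,0,0,0], [3,2,0,1,5,4], [3,2,0,1,4,5],5),
   (2,1, [0,0,0,0,0,0], [0,0,0,0,0,0], [3,2,0,0,5,4], [3,2,0,0,4,5],5),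
   (2,2, [0,0,0,0,0,0], [0,0,0,0,0,0], [0,3,0,1,5,4], [0,3,0,1,4,5],5),
   (2,3, [0,0,0,0,0,0], [0,0,0,0,0,0], [0,2,0,1,5,4], [0,2,0,1,4,5],5),
   (2,4, [0,0,0,0,1,1], [0,0,0,0,0,-1], [3,2,0,1,0,5], [2,3,0,1,0,5],1),
   (2,5, [0,0,0,0,1,1], [0,0,0,0,-1,0], [3,2,0,1,0,4], [2,3,0,1,0,4],1),
   (3,0, [0,0,0,0,0,0], [0,0,0,0,0,0], [3,2,1,0,5,4], [3,2,1,0,4,5],5),
   (3,1, [0,0,0,0,0,0], [0,0,0,0,0,0], [3,2,0,0,5,4], [3,2,0,0,4,5],5),
   (3,2, [0,0,0,0,0,0], [0,0,0,0,0,0], [0,3,1,0,5,4], [0,3,1,0,4,5],5),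
   (3,3, [0,0,0,0,0,0], [0,0,0,0,0,0], [0,2,1,0,5,4], [0,2,1,0,4,5],5),
   (3,4, [0,0,0,0,1,1], [0,0,0,0,0,-1], [3,2,1,0,0,5], [2,3,1,0,0,5],0),
   (3,5, [0,0,0,0,1,1], [0,0,0,0,-1,0], [3,2,1,0,0,4], [2,3,1,0,0,4],0),
   (4,0, [0,0,1,1,0,0], [0,-1,0,0,0,0], [3,2,4,1,0,5], [2,3,4,1,0,5],1),
   (4,1, [0,0,1,1,0,0], [-1,0,0,0,0,0], [3,2,4,0,0,5], [2,3,4,0,0,5],1),
   (4,2, [1,1,1,1,0,0], [-1,-1,0,-1,0,0], [4,3,1,0,0,5], [4,3,0,1,0,5],3),
   (4,3, [1,1,1,1,0,0], [-1,-1,-1,0,0,0], [4,2,1,0,0,5], [4,2,0,1,0,5],3),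
   (4,4, [0,0,0,0,0,0], [0,0,0,0,0,0], [3,2,1,0,0,5], [2,3,0,1,0,5],3),
   (4,5, [0,0,0,0,0,0], [0,0,0,0,0,0], [3,2,1,0,0,4], [2,3,0,1,0,4],3),
   (5,0, [0,0,1,1,0,0], [0,-1,0,0,0,0], [3,2,4,1,5,0], [2,3,4,1,5,0],1),
   (5,1, [0,0,1,1,0,0], [-1,0,0,0,0,0], [3,2,4,0,5,0], [2,3,4,0,5,0],1),
   (5,2, [1,1,1,1,0,0], [-1,-1,0,-1,0,0], [4,3,1,0,5,0], [4,3,0,1,5,0],3),
   (5,3, [1,1,1,1,0,0], [-1,-1,-1,0,0,0], [4,2,1,0,5,0], [4,2,0,1,5,0],3),
   (5,4, [0,0,0,0,0,0], [0,0,0,0,0,0], [3,2,1,0,5,0], [2,3,0,1,5,0],3),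
   (5,5, [0,0,0,0,0,0], [0,0,0,0,0,0], [3,2,1,0,4,0], [2,3,0,1,4,0],3)]"

lemma certificates6_valid: "list_all certificate6 certificates6"
  by code_simp

lemma certificates6_complete: "map (\<lambda>(a, b, _). (a, b)) certificates6 = List.product [0..<6] [0..<6]"
  by code_simp

lemma matrix6_singular:
  assumes I: "I \<subseteq> {..<6}" "card I = 5" and J: "J \<subseteq> {..<6}" "card J = 5"
  shows "sym_trop_singular (\<lambda>i j. real_of_int (matrix6 ! i ! j)) I J"
proof -
  have miss: "\<exists>a<6. X = {..<6} - {a}" if X: "X \<subseteq> {..<6}" "card X = 5" for X :: "nat set"
  proof -
    have fX: "finite X" using X(1) by (rule finite_subset) simp
    have "card ({..<6} - X) = 1" using card_Diff_subset[OF fX X(1)] X(2) by simp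
    then obtain a where "{..<6} - X = {a}" by (rule card_1_singletonE)
    then show ?thesis using X(1) by blast
  qed
  obtain a b where ab: "a < 6" "b < 6" "I = {..<6} - {a}" "J = {..<6} - {b}" using miss[OF I] miss[OF J] by blast
  have "(a, b) \<in> set (map (\<lambda>(a, b, _). (a, b)) certificates6)"
    unfolding certificates6_complete using ab by simp
  then obtain u v p q w where "(a, b, u, v, p, q, w) \<in> set certificates6" by auto
  then have c: "certificate6 (a, b, u, v, p, q, w)" by (rule bspec[OF certificates6_valid[unfolded list_all_iff]])
  have six: "set [0, 1, 2, 3, 4, 5] = {..<6 :: nat}" by auto
  have sI: "set (filter (\<lambda>i. i \<noteq> a) [0, 1, 2, 3, 4, 5]) = I" and sJ: "set (filter (\<lambda>j. j \<noteq> b) [0, 1, 2, 3, 4, 5]) = J"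
    unfolding set_filter six ab(3,4) by auto
  note C = c[unfolded certificate6.simps Let_def list_all_iff list_ex_iff sI sJ]
  note C1 = C[THEN conjunct1] and D2 = C[THEN conjunct2]
  note C2 = D2[THEN conjunct1] and D3 = D2[THEN conjunct2]
  note C3 = D3[THEN conjunct1] and D4 = D3[THEN conjunct2]
  note C4 = D4[THEN conjunct1] and D5 = D4[THEN conjunct2]
  note C5 = D5[THEN conjunct1] and C6 = D5[THEN conjunct2]
  have onto: "(\<lambda>i. x ! i) ` I = J"
    if "\<forall>j\<in>J. \<exists>i\<in>I. x ! i = j" "\<forall>i\<in>I. x ! i \<noteq> b \<and> x ! i < 6 \<and> matrix6 ! i ! (x ! i) = u ! i + v ! (x ! i)" for x
  proof
    show "(\<lambda>i. x ! i) ` I \<subseteq> J" using that(2) unfolding ab(4) by auto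
    show "J \<subseteq> (\<lambda>i. x ! i) ` I" using that(1) by (metis image_eqI subsetI)
  qed
  show ?thesis
  proof (rule singular_of_potentials[where u = "\<lambda>i. real_of_int (u ! i)" and v = "\<lambda>j. real_of_int (v ! j)"
        and p = "\<lambda>i. p ! i" and q = "\<lambda>i. q ! i" and w = w])
    show "finite I" "finite J" "card I = card J" using I J finite_subset[OF I(1)] finite_subset[OF J(1)] by auto
    show "real_of_int (u ! i) + real_of_int (v ! j) \<le> real_of_int (matrix6 ! i ! j)" if "i \<in> I" "j \<in> J" for i j
    proof -
      have "u ! i + v ! j \<le> matrix6 ! i ! j" using C1 that by blast
      then show ?thesis by linarith
    qed
    show "(\<lambda>i. p ! i) ` I = J" "(\<lambda>i. q ! i) ` I = J" by (rule onto[OF C2 C3], rule onto[OF C4 C5])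
    show "real_of_int (matrix6 ! i ! (p ! i)) = real_of_int (u ! i) + real_of_int (v ! (p ! i))" if "i \<in> I" for i
      using C3[rule_format, OF that] by simp
    show "real_of_int (matrix6 ! i ! (q ! i)) = real_of_int (u ! i) + real_of_int (v ! (q ! i))" if "i \<in> I" for i
      using C5[rule_format, OF that] by simp
    show "w \<in> I" using C6 ab(3) by simp
    show "{w, p ! w} \<noteq> {k, q ! k}" if "k \<in> I" for k using C6 that unfolding doubleton_eq_iff by blast
  qed
qed

section \<open>Degrees under pivot elimination\<close>

definition has_degree :: "real \<Rightarrow> hahn_series \<Rightarrow> bool" where
  "has_degree d x \<longleftrightarrow> (\<exists>c. c \<noteq> 0 \<and> lead d c x)"

lemma has_degree_order_ge: "has_degree d x \<Longrightarrow> order_ge d x"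
  by (auto simp: has_degree_def lead_def order_ge_def)

lemma has_degree_nonzero: "has_degree d x \<Longrightarrow> x \<noteq> 0"
  by (auto simp: has_degree_def dest: lead_nonzero)

lemma has_degree_mult: "has_degree d x \<Longrightarrow> has_degree e y \<Longrightarrow> has_degree (d + e) (x * y)"
  unfolding has_degree_def by (metis lead_mult mult_eq_0_iff)

lemma has_degree_unique: "has_degree d x \<Longrightarrow> has_degree e x \<Longrightarrow> d = e"
  by (auto simp: has_degree_def dest: lead_unique)

lemma order_ge_lead: "order_ge d x \<Longrightarrow> lead d (coef x d) x"
  by (simp add: lead_def order_ge_def)

lemma chio_order_ge:
  assumes "has_degree g (M a b)" "order_ge d (M i j)" "order_ge e (M i b)" "order_ge f (M a j)" "d \<le> e + f - g"
  shows "order_ge d (chio a b M i j)"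
proof -
  obtain c where c: "c \<noteq> 0" "lead g c (M a b)" using assms(1) by (auto simp: has_degree_def)
  have "lead (e + f - g) (coef (M i b) e * coef (M a j) f / c) (M i b * M a j / M a b)"
    by (intro lead_divide lead_mult order_ge_lead assms c)
  then have "order_ge (e + f - g) (M i b * M a j / M a b)" by (simp add: lead_def order_ge_def)
  then show ?thesis unfolding chio_def using assms(2,5) by (meson order_ge_diff order_ge_mono)
qed

text \<open>The subtracted term has order at least \<open>e + f - g\<close>, too high to touch the
  leading term. If this number only equals \<open>d\<close>, cancellation is possible and
  \<open>chio_order_ge\<close> is what remains.\<close>

lemma chio_has_degree:
  assumes "has_degree g (M a b)" "has_degree d (M i j)" "order_ge e (M i b)" "order_ge f (M a j)" "d < e + f - g"
  shows "has_degree d (chio a b M i j)"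
proof -
  obtain c where c: "c \<noteq> 0" "lead g c (M a b)" using assms(1) by (auto simp: has_degree_def)
  obtain c' where c': "c' \<noteq> 0" "lead d c' (M i j)" using assms(2) by (auto simp: has_degree_def)
  have "lead (e + f - g) (coef (M i b) e * coef (M a j) f / c) (M i b * M a j / M a b)"
    by (intro lead_divide lead_mult order_ge_lead assms c)
  then have "lead d 0 (M i b * M a j / M a b)" by (rule lead_less[OF _ assms(5)])
  from lead_diff[OF c'(2) this] show ?thesis unfolding chio_def has_degree_def using c'(1) by auto
qed

text \<open>The pivots at (5,5), (1,3) and (3,1) have degree 0 and reduce a lift of rank at most 4
  to a matrix \<open>S\<close> of rank at most 1. On the indices 0, 2, 4 enough degrees survive:
  \<open>S 0 0 * S 2 4 * S 4 2\<close> has degree 2, while \<open>S 0 4 * S 2 2 * S 4 0\<close>,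
  equal to it in rank 1, has degree 3.\<close>

lemma obstruction_6_5: "obstruction 6 5 (\<lambda>i j. real_of_int (matrix6 ! i ! j))"
  unfolding obstruction_def
proof (intro conjI allI impI)
  have "list_all (\<lambda>i. list_all (\<lambda>j. matrix6 ! i ! j = matrix6 ! j ! i) [0..<6]) [0..<6]" by code_simp
  then show "symmetric_mat 6 (\<lambda>i j. real_of_int (matrix6 ! i ! j))"
    unfolding symmetric_mat_def list_all_iff by auto
  show "sym_trop_singular (\<lambda>i j. real_of_int (matrix6 ! i ! j)) I J"
    if "I \<subseteq> {..<6} \<and> J \<subseteq> {..<6} \<and> card I = 5 \<and> card J = 5" for I J
    using matrix6_singular that by blast
  show "\<not> (\<exists>M. lift_of 6 (\<lambda>i j. real_of_int (matrix6 ! i ! j)) M \<and> rank_le 6 M (5 - 1))"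
  proof
    assume "\<exists>M. lift_of 6 (\<lambda>i j. real_of_int (matrix6 ! i ! j)) M \<and> rank_le 6 M (5 - 1)"
    then obtain M where lift: "lift_of 6 (\<lambda>i j. real_of_int (matrix6 ! i ! j)) M"
      and rk: "rank_le 6 M (Suc (Suc (Suc 1)))" by (auto simp: eval_nat_numeral)
    have deg: "has_degree (real_of_int (matrix6 ! i ! j)) (M i j)" if "i < 6" "j < 6" for i j
      using lift that unfolding lift_of_def has_degree_def by blast
    have ent: "real_of_int (matrix6 ! i ! j) = d \<Longrightarrow> i < 6 \<Longrightarrow> j < 6 \<Longrightarrow> has_degree d (M i j)" for i j d
      using deg by auto
    define M1 where "M1 = chio 5 5 M"
    define M2 where "M2 = chio 1 3 M1"
    define S where "S = chio 3 1 M2"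
    have m55: "has_degree 0 (M 5 5)" by (rule ent) (simp_all add: matrix6_def)
    have col5: "has_degree 2 (M i 5)" "has_degree 2 (M 5 i)" if "i < 4" for i
    proof -
      have "i = 0 \<or> i = 1 \<or> i = 2 \<or> i = 3" using that by linarith
      then show "has_degree 2 (M i 5)" "has_degree 2 (M 5 i)" by (auto intro!: ent simp: matrix6_def)
    qed
    have m45: "has_degree 0 (M 4 5)" "has_degree 0 (M 5 4)" by (rule ent; simp add: matrix6_def)+
    \<comment> \<open>Correction terms have degree 4 among the first four indices, so degrees up to
      2 survive. Where index 4 is paired with a smaller one they have degree 2, so degree 1 survives
      and degree 2 only remains a lower bound.\<close>
    have M1: "has_degree d (M1 i j)" if "has_degree d (M i j)" "d \<le> 2" "i < 4" "j < 4" for i j d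
      unfolding M1_def using chio_has_degree[where M = M, OF m55 that(1) has_degree_order_ge[OF col5(1)[OF that(3)]] has_degree_order_ge[OF col5(2)[OF that(4)]]] that(2) by simp
    have M1r: "has_degree d (M1 i 4)" if "has_degree d (M i 4)" "d < 2" "i < 4" for i d
      unfolding M1_def using chio_has_degree[where M = M, OF m55 that(1) has_degree_order_ge[OF col5(1)[OF that(3)]] has_degree_order_ge[OF m45(2)]] that(2) by simp
    have M1c: "has_degree d (M1 4 i)" if "has_degree d (M 4 i)" "d < 2" "i < 4" for i d
      unfolding M1_def using chio_has_degree[where M = M, OF m55 that(1) has_degree_order_ge[OF m45(1)] has_degree_order_ge[OF col5(2)[OF that(3)]]] that(2) by simp
    have M1rg: "order_ge 2 (M1 i 4)" if "has_degree 2 (M i 4)" "i < 4" for i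
      unfolding M1_def using chio_order_ge[where M = M, OF m55 has_degree_order_ge[OF that(1)] has_degree_order_ge[OF col5(1)[OF that(2)]] has_degree_order_ge[OF m45(2)]] by simp
    have M1cg: "order_ge 2 (M1 4 i)" if "has_degree 2 (M 4 i)" "i < 4" for i
      unfolding M1_def using chio_order_ge[where M = M, OF m55 has_degree_order_ge[OF that(1)] has_degree_order_ge[OF m45(1)] has_degree_order_ge[OF col5(2)[OF that(2)]]] by simp
    have small: "has_degree d (M1 i j)" if "real_of_int (matrix6 ! i ! j) = d" "d \<le> 2" "i < 4" "j < 4" for i j d
      by (rule M1[OF ent[OF that(1)] that(2-4)]) (use that in auto)
    have e1: "has_degree 0 (M1 0 0)" "has_degree 2 (M1 0 1)" "has_degree 0 (M1 0 3)" "has_degree 2 (M1 1 0)" "has_degree 2 (M1 1 1)"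
      "has_degree 0 (M1 1 2)" "has_degree 0 (M1 1 3)" "has_degree 0 (M1 2 1)" "has_degree 1 (M1 2 2)" "has_degree 2 (M1 2 3)"
      "has_degree 0 (M1 3 0)" "has_degree 0 (M1 3 1)" "has_degree 2 (M1 3 2)" "has_degree 2 (M1 3 3)"
      by (rule small; simp add: matrix6_def)+
    have e2: "has_degree 1 (M1 0 4)" "has_degree 1 (M1 2 4)" by (rule M1r[OF ent]; simp add: matrix6_def)+
    have e3: "has_degree 1 (M1 4 0)" "has_degree 1 (M1 4 2)" by (rule M1c[OF ent]; simp add: matrix6_def)+
    have e4: "order_ge 2 (M1 1 4)" "order_ge 2 (M1 3 4)" by (rule M1rg[OF ent]; simp add: matrix6_def)+
    have e5: "order_ge 2 (M1 4 1)" "order_ge 2 (M1 4 3)" by (rule M1cg[OF ent]; simp add: matrix6_def)+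
    note g1 = e1[THEN has_degree_order_ge] e2[THEN has_degree_order_ge] e3[THEN has_degree_order_ge] e4 e5
    note deg2 = chio_has_degree[where M = M1, OF e1(7), folded M2_def]
    note ge2 = chio_order_ge[where M = M1, OF e1(7), folded M2_def]
    have f: "has_degree 0 (M2 0 0)" "has_degree 1 (M2 0 4)" "has_degree 1 (M2 2 2)" "has_degree 1 (M2 2 4)"
      "has_degree 1 (M2 4 0)" "has_degree 1 (M2 4 2)" "has_degree 0 (M2 3 1)"
      by (rule deg2[OF e1(1) g1(3,4)] deg2[OF e2(1) g1(3,19)] deg2[OF e1(9) g1(10,6)] deg2[OF e2(2) g1(10,19)]
          deg2[OF e3(1) g1(22,4)] deg2[OF e3(2) g1(22,6)] deg2[OF e1(12) g1(14,5)]; simp)+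
    have g: "order_ge 2 (M2 0 1)" "order_ge 0 (M2 2 1)" "order_ge 2 (M2 4 1)" "order_ge 0 (M2 3 0)" "order_ge 2 (M2 3 2)" "order_ge 2 (M2 3 4)"
      by (rule ge2[OF g1(2) g1(3,5)] ge2[OF g1(8) g1(10,5)] ge2[OF g1(21) g1(22,5)] ge2[OF g1(11) g1(14,4)]
          ge2[OF g1(13) g1(14,6)] ge2[OF g1(20) g1(14,19)]; simp)+
    note deg3 = chio_has_degree[where M = M2, OF f(7), folded S_def]
    have s: "has_degree 0 (S 0 0)" "has_degree 1 (S 0 4)" "has_degree 1 (S 2 2)" "has_degree 1 (S 2 4)"
      "has_degree 1 (S 4 0)" "has_degree 1 (S 4 2)"
      by (rule deg3[OF f(1) g(1,4)] deg3[OF f(2) g(1,6)] deg3[OF f(3) g(2,5)] deg3[OF f(4) g(2,6)]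
          deg3[OF f(5) g(3,4)] deg3[OF f(6) g(3,5)]; simp)+
    have "rank_le 6 M1 (Suc (Suc 1))" unfolding M1_def by (rule rank_le_chio[where M = M and a = 5 and b = 5, OF rk has_degree_nonzero[OF m55]]) auto
    then have "rank_le 6 M2 (Suc 1)" unfolding M2_def by (rule rank_le_chio[where M = M1 and a = 1 and b = 3, OF _ has_degree_nonzero[OF e1(7)]]) auto
    then have rS: "rank_le 6 S 1" unfolding S_def by (rule rank_le_chio[where M = M2 and a = 3 and b = 1, OF _ has_degree_nonzero[OF f(7)]]) auto
    \<comment> \<open>The entry \<open>S 2 0\<close>, whose degree is not controlled, is exchanged
      away by two 2 x 2 minors.\<close>
    have "S 0 0 * S 2 4 * S 4 2 = S 0 4 * (S 2 0 * S 4 2)"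
      using rank_le_1[OF rS, of 0 2 0 4] by simp
    also have "\<dots> = S 0 4 * (S 2 2 * S 4 0)" using rank_le_1[OF rS, of 2 4 0 2] by simp
    finally have "has_degree (1 + (1 + 1)) (S 0 0 * S 2 4 * S 4 2)"
      using has_degree_mult[OF s(2) has_degree_mult[OF s(3,5)]] by simp
    moreover have "has_degree (0 + 1 + 1) (S 0 0 * S 2 4 * S 4 2)"
      by (rule has_degree_mult[OF has_degree_mult[OF s(1,4)] s(6)])
    ultimately have "(1 :: real) + (1 + 1) = 0 + 1 + 1" by (rule has_degree_unique)
    then show False by simp
  qed
qed

section \<open>A 13 x 13 counterexample for r = 4\<close>

text \<open>Integer vectors that represent the points of the projective plane over the field with three
  elements, chosen such that no inner product is divisible by 9. The matrix of 3-adic valuations of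
  the Gram matrix is the incidence matrix of this plane, which has no realization over the complex numbers.\<close>

definition plane_vectors :: "(int \<times> int \<times> int) list" where
  "plane_vectors = [(-3, -3, -2), (3, 1, -3), (-3, 1, -2), (-3, 4, -1), (1, 0, 0), (1, 3, 1), (4, 0, 2),
     (-2, 1, 0), (4, 1, 4), (1, 4, 2), (1, -4, -3), (1, -1, 1), (1, -4, -4)]"

fun inner3 :: "int \<times> int \<times> int \<Rightarrow> int \<times> int \<times> int \<Rightarrow> int" where
  "inner3 (x, y, z) (x', y', z') = x * x' + y * y' + z * z'"

definition gram :: "nat \<Rightarrow> nat \<Rightarrow> int" where
  "gram i j = inner3 (plane_vectors ! i) (plane_vectors ! j)"

text \<open>Since 9 divides no entry, this is the 3-adic valuation of \<open>gram i j\<close>.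
  Modulo 3 it says that point \<open>i\<close> lies on the polar line of point
  \<open>j\<close>.\<close>

definition incidence :: "nat \<Rightarrow> nat \<Rightarrow> nat" where
  "incidence i j = (if 3 dvd gram i j then 1 else 0)"

lemma gram_sym: "gram i j = gram j i"
  unfolding gram_def by (cases "plane_vectors ! i"; cases "plane_vectors ! j") (simp add: mult.commute)

lemma incidence_sym: "incidence i j = incidence j i"
  by (simp add: incidence_def gram_sym[of i j])

lemma gram_not_dvd_9:
  assumes "i < 13" "j < 13" shows "\<not> 9 dvd gram i j"
proof -
  have "list_all (\<lambda>i. list_all (\<lambda>j. gram i j mod 9 \<noteq> 0) [0..<13]) [0..<13]" by code_simp
  then show ?thesis using assms by (simp add: list_all_iff dvd_eq_mod_eq_0)
qed

lemma gram_rank: "rank_le 13 gram 3"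
proof (rule rank_le_factor)
  let ?c = "\<lambda>i l :: nat. case plane_vectors ! i of (x, y, z) \<Rightarrow> if l = 0 then x else if l = 1 then y else z"
  show "gram i j = (\<Sum>l<3. ?c i l * ?c j l)" for i j
    by (cases "plane_vectors ! i"; cases "plane_vectors ! j") (simp add: gram_def numeral_3_eq_3)
qed

lemma gram_unit_part:
  assumes "i < 13" "j < 13"
  shows "gram i j = 3 ^ incidence i j * (gram i j div 3 ^ incidence i j)" "\<not> 3 dvd gram i j div 3 ^ incidence i j"
proof -
  show "gram i j = 3 ^ incidence i j * (gram i j div 3 ^ incidence i j)" by (simp add: incidence_def)
  show "\<not> 3 dvd gram i j div 3 ^ incidence i j"
  proof
    assume d: "3 dvd gram i j div 3 ^ incidence i j"
    then have "3 dvd gram i j" by (auto simp: incidence_def split: if_splits)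
    moreover from this have "3 dvd gram i j div 3" using d by (simp add: incidence_def)
    ultimately have "3 * 3 dvd gram i j" by (simp add: dvd_div_iff_mult mult.commute)
    then show False using gram_not_dvd_9[OF assms] by simp
  qed
qed

text \<open>Suppose only one monomial is optimal. Divide the vanishing minor of \<open>gram\<close>
  by the power of 3 of minimal exponent: modulo 3 only the terms of that monomial remain. They are
  all equal, not divisible by 3, and one or two in number, so their sum is not 0 modulo 3.\<close>

lemma incidence_singular:
  assumes IJ: "I \<subseteq> {..<13}" "card I = 4" "J \<subseteq> {..<13}" "card J = 4"
  shows "sym_trop_singular (\<lambda>i j. real (incidence i j)) I J"
proof (rule ccontr)
  assume ns: "\<not> sym_trop_singular (\<lambda>i j. real (incidence i j)) I J"
  let ?A = "\<lambda>i j. real (incidence i j)"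
  let ?e = "nth (sorted_list_of_set I)" let ?f = "nth (sorted_list_of_set J)"
  have fin: "finite I" "finite J" using finite_subset[OF IJ(1)] finite_subset[OF IJ(3)] by simp_all
  have e: "bij_betw ?e {0..<4} I" and f: "bij_betw ?f {0..<4} J"
    using bij_betw_nth_sorted[OF fin(1)] bij_betw_nth_sorted[OF fin(2)] IJ(2,4) by simp_all
  have inj: "inj_on ?e {0..<4}" "inj_on ?f {0..<4}" using e f by (simp_all add: bij_betw_def)
  have lt: "?e i < 13" "?f i < 13" if "i < 4" for i
  proof -
    have "?e i \<in> I" "?f i \<in> J" using bij_betwE[OF e] bij_betwE[OF f] that by simp_all
    then show "?e i < 13" "?f i < 13" using IJ(1,3) by auto
  qed
  obtain p where p: "p permutes {0..<4}" and pq: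
    "\<And>q. q permutes {0..<4} \<Longrightarrow> perm_value ?A 4 ?e ?f p < perm_value ?A 4 ?e ?f q \<or>
       (perm_value ?A 4 ?e ?f q = perm_value ?A 4 ?e ?f p \<and> perm_monomial 4 ?e ?f q = perm_monomial 4 ?e ?f p)"
    by (rule perm_nonsingular[OF e f ns]) blast
  define m where "m q = (\<Sum>k = 0..<4. incidence (?e k) (?f (q k)))" for q
  have mv: "perm_value ?A 4 ?e ?f q = real (m q)" for q by (simp add: perm_value_def m_def)
  have mq: "m p < m q \<or> (m q = m p \<and> perm_monomial 4 ?e ?f q = perm_monomial 4 ?e ?f p)"
    if "q permutes {0..<4}" for q
    using pq[OF that] by (simp add: mv)
  define h where "h i j = gram i j div 3 ^ incidence i j" for i j
  have hsym: "h i j = h j i" for i j unfolding h_def using gram_sym[of i j] incidence_sym[of i j] by simp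
  define H where "H q = of_int (sign q) * (\<Prod>k = 0..<4. h (?e k) (?f (q k)))" for q
  have summand: "of_int (sign q) * (\<Prod>k = 0..<4. gram (?e k) (?f (q k))) = 3 ^ m q * H q" if q: "q permutes {0..<4}" for q
  proof -
    have "(\<Prod>k = 0..<4. gram (?e k) (?f (q k))) = (\<Prod>k = 0..<4. 3 ^ incidence (?e k) (?f (q k)) * h (?e k) (?f (q k)))"
    proof (rule prod.cong[OF refl])
      fix k assume "k \<in> {0..<4 :: nat}"
      then have "?e k < 13" "?f (q k) < 13" using lt permutes_in_image[OF q, of k] by auto
      then show "gram (?e k) (?f (q k)) = 3 ^ incidence (?e k) (?f (q k)) * h (?e k) (?f (q k))"
        unfolding h_def by (rule gram_unit_part(1))
    qed
    also have "\<dots> = 3 ^ m q * (\<Prod>k = 0..<4. h (?e k) (?f (q k)))"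
      by (simp only: prod.distrib m_def power_sum)
    finally show ?thesis by (simp only: H_def mult_ac)
  qed
  let ?P = "{q. q permutes {0..<4 :: nat}}"
  have finP: "finite ?P" by (simp add: finite_permutations)
  have sd: "sub_det gram 4 ?e ?f = 0"
    using gram_rank[unfolded rank_le_def, rule_format, of ?e ?f] lt by (simp add: eval_nat_numeral)
  have "0 = (\<Sum>q\<in>?P. 3 ^ m q * H q)" unfolding sd[symmetric] sub_det_expand by (rule sum.cong) (use summand in auto)
  also have "\<dots> = 3 ^ m p * (\<Sum>q\<in>?P. 3 ^ (m q - m p) * H q)"
    unfolding sum_distrib_left
  proof (rule sum.cong[OF refl])
    fix q assume "q \<in> ?P"
    then have "m p \<le> m q" using mq[of q] by auto
    then have "(3 :: int) ^ m q = 3 ^ m p * 3 ^ (m q - m p)" by (simp add: power_add[symmetric])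
    then show "3 ^ m q * H q = 3 ^ m p * (3 ^ (m q - m p) * H q)" by simp
  qed
  finally have zero: "(\<Sum>q\<in>?P. 3 ^ (m q - m p) * H q) = 0" by simp
  define C where "C = {q \<in> ?P. m q = m p}"
  have CP: "C \<subseteq> ?P" "finite C" using finP by (auto simp: C_def)
  have split: "(\<Sum>q\<in>?P. 3 ^ (m q - m p) * H q) = (\<Sum>q\<in>?P - C. 3 ^ (m q - m p) * H q) + (\<Sum>q\<in>C. 3 ^ (m q - m p) * H q)"
    by (rule sum.subset_diff[OF CP(1) finP])
  have rest: "3 dvd (\<Sum>q\<in>?P - C. 3 ^ (m q - m p) * H q)"
  proof (rule dvd_sum)
    fix q assume "q \<in> ?P - C"
    then have "m p < m q" using mq[of q] by (auto simp: C_def)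
    then have "(3 :: int) dvd 3 ^ (m q - m p)" by (intro dvd_power) simp
    then show "3 dvd 3 ^ (m q - m p) * H q" by (rule dvd_mult2)
  qed
  have main: "(\<Sum>q\<in>C. 3 ^ (m q - m p) * H q) = int (card C) * H p"
  proof -
    have "3 ^ (m q - m p) * H q = H p" if "q \<in> C" for q
    proof -
      have q: "q permutes {0..<4}" "m q = m p" using that by (auto simp: C_def)
      then have mono: "perm_monomial 4 ?e ?f q = perm_monomial 4 ?e ?f p" using mq[OF q(1)] by auto
      have "sign q = sign p" by (rule sign_eq_of_same_monomial[OF inj q(1) p mono])
      moreover have "(\<Prod>k = 0..<4. h (?e k) (?f (q k))) = (\<Prod>k = 0..<4. h (?e k) (?f (p k)))"
        unfolding prod_perm_monomial[where c = h and r = 4 and e = ?e and f = ?f, OF hsym q(1)]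
          prod_perm_monomial[where c = h and r = 4 and e = ?e and f = ?f, OF hsym p] mono ..
      ultimately show ?thesis using q(2) by (simp add: H_def)
    qed
    then show ?thesis by simp
  qed
  have "int (card C) * H p = - (\<Sum>q\<in>?P - C. 3 ^ (m q - m p) * H q)"
    using split unfolding zero main by linarith
  then have dvd: "3 dvd int (card C) * H p" using rest by (simp only: dvd_minus_iff)
  have prime3: "prime (3 :: int)" by simp
  have "\<not> 3 dvd H p"
  proof
    assume "3 dvd H p"
    then have "3 dvd (\<Prod>k = 0..<4. h (?e k) (?f (p k)))" by (cases "evenperm p") (simp_all add: H_def sign_def)
    then have "\<exists>k\<in>{0..<4}. 3 dvd h (?e k) (?f (p k))" by (rule prime_dvd_prod_iff[OF finite_atLeastLessThan prime3, THEN iffD1])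
    then obtain k where k: "k \<in> {0..<4}" "3 dvd h (?e k) (?f (p k))" by blast
    then have "?e k < 13" "?f (p k) < 13" using lt permutes_in_image[OF p, of k] by auto
    then show False using gram_unit_part(2) k(2) unfolding h_def by blast
  qed
  then have "3 dvd int (card C)" using dvd prime_dvd_mult_iff[OF prime3] by blast
  moreover have "p \<in> C" using p by (simp add: C_def)
  moreover have "card C \<le> 2"
  proof (cases "C = {p}")
    case False
    then obtain q where q: "q \<in> C" "q \<noteq> p" using \<open>p \<in> C\<close> by blast
    have "C \<subseteq> {p, q}"
    proof
      fix q' assume q': "q' \<in> C"
      show "q' \<in> {p, q}"
      proof (cases "q' = p")
        case F: False
        have mono: "perm_monomial 4 ?e ?f p = perm_monomial 4 ?e ?f x" "x permutes {0..<4}" if "x \<in> C" for x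
          using mq[of x] that by (auto simp: C_def)
        have "q = q'"
          by (rule three_same_monomials_4[OF inj p mono(2)[OF q(1)] mono(2)[OF q'] mono(1)[OF q(1)] mono(1)[OF q']])
            (use q(2) F in auto)
        then show ?thesis by simp
      qed simp
    qed
    from card_mono[OF _ this] show ?thesis using q(2) by simp
  qed simp
  ultimately show False using CP(2) by (auto dest!: zdvd_imp_le simp: card_gt_0_iff)
qed

text \<open>A factorization through dimension 3 assigns coordinates \<open>a1, a2, a3\<close> to
  rows and \<open>b1, b2, b3\<close> to columns, that is, lines and points realizing the plane. The
  incidences determine all ratios up to scaling and finally force 3 = 0.\<close>

lemma projective_plane_3_rank:
  fixes N :: "nat \<Rightarrow> nat \<Rightarrow> 'a :: field_char_0"
  assumes rk: "rank_le 13 N 3" and zero: "\<And>i j. i < 13 \<Longrightarrow> j < 13 \<Longrightarrow> N i j = 0 \<longleftrightarrow> 3 dvd gram i j"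
  shows False
proof -
  have z: "N i j = 0" if "incidence i j = 1" "i < 13" "j < 13" for i j
    using that zero by (simp add: incidence_def split: if_splits)
  have nz: "N i j \<noteq> 0" if "incidence i j = 0" "i < 13" "j < 13" for i j
    using that zero by (simp add: incidence_def split: if_splits)
  note inc = incidence_def gram_def plane_vectors_def
  \<comment> \<open>Modulo 3 the vectors 4, 1, 0 are the three unit vectors. Their block in
    \<open>N\<close> is diagonal and invertible, so they can serve as the coordinate
    triangle.\<close>
  have tri: "N 0 1 = 0" "N 1 0 = 0" "N 0 4 = 0" "N 4 0 = 0" "N 1 4 = 0" "N 4 1 = 0"
    by (rule z; simp add: inc)+
  have tri': "N 0 0 \<noteq> 0" "N 1 1 \<noteq> 0" "N 4 4 \<noteq> 0" by (rule nz; simp add: inc)+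
  define N1 where "N1 = chio 4 4 N"
  define N2 where "N2 = chio 1 1 N1"
  have n1: "N1 1 1 = N 1 1" "N1 i 1 = N i 1" "N1 1 j = N 1 j" "N1 0 0 = N 0 0" "N1 i 0 = N i 0" "N1 0 j = N 0 j" for i j
    using tri by (simp_all add: N1_def chio_def)
  have n2: "N2 0 0 = N 0 0" "N2 i 0 = N i 0" "N2 0 j = N 0 j" for i j
    using tri by (simp_all add: N2_def chio_def n1)
  have "rank_le 13 N1 (Suc (Suc 0))"
    unfolding N1_def using rank_le_chio[where M = N and a = 4 and b = 4 and n = 13] rk tri' by (simp add: eval_nat_numeral)
  then have "rank_le 13 N2 (Suc 0)"
    unfolding N2_def using rank_le_chio[where M = N1 and a = 1 and b = 1 and n = 13] tri' n1 by simp
  then have "rank_le 13 (chio 0 0 N2) 0"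
    using rank_le_chio[where M = N2 and a = 0 and b = 0 and n = 13] tri' n2 by simp
  define a1 where "a1 i = N i 4 / N 4 4" for i
  define a2 where "a2 i = N i 1 / N 1 1" for i
  define a3 where "a3 i = N i 0 / N 0 0" for i
  define b1 where "b1 j = N 4 j" for j
  define b2 where "b2 j = N 1 j" for j
  define b3 where "b3 j = N 0 j" for j
  have N: "N i j = a1 i * b1 j + a2 i * b2 j + a3 i * b3 j" if "i < 13" "j < 13" for i j
  proof -
    have "chio 0 0 N2 i j = 0" using rank_le_0[OF \<open>rank_le 13 (chio 0 0 N2) 0\<close> that] .
    then have "N2 i j = N i 0 * N 0 j / N 0 0" by (simp add: chio_def n2)
    then have "N1 i j = N i 0 * N 0 j / N 0 0 + N i 1 * N 1 j / N 1 1" by (simp add: N2_def chio_def n1[unfolded One_nat_def] algebra_simps)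
    then have "N i j = N i 0 * N 0 j / N 0 0 + N i 1 * N 1 j / N 1 1 + N i 4 * N 4 j / N 4 4"
      by (simp add: N1_def chio_def algebra_simps)
    then show ?thesis by (simp add: a1_def a2_def a3_def b1_def b2_def b3_def)
  qed
  have a0: "a3 10 = 0" "a3 7 = 0" "a1 3 = 0" "a1 2 = 0" "a2 6 = 0" "a2 5 = 0"
    unfolding a1_def a2_def a3_def divide_eq_0_iff by (rule disjI1, rule z; simp add: inc)+
  have an: "a1 10 \<noteq> 0" "a1 7 \<noteq> 0" "a2 3 \<noteq> 0" "a2 2 \<noteq> 0" "a1 6 \<noteq> 0" "a1 5 \<noteq> 0" "a1 8 \<noteq> 0"
    unfolding a1_def a2_def a3_def using tri' by (simp_all add: nz inc)
  have bn: "b3 8 \<noteq> 0" "b3 9 \<noteq> 0" "b3 11 \<noteq> 0" "b3 12 \<noteq> 0" "b2 8 \<noteq> 0" "b2 10 \<noteq> 0" "b1 8 \<noteq> 0" "b3 3 \<noteq> 0"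
    "b2 9 \<noteq> 0"
    unfolding b1_def b2_def b3_def by (rule nz; simp add: inc)+
  have b0: "b3 10 = 0" "b1 3 = 0" unfolding b1_def b3_def by (rule z; simp add: inc)+
  \<comment> \<open>Rows 10, 7, 3, 2, 6, 5 have one vanishing coordinate, so they are lines through
    a vertex of the triangle. Each incidence with such a line fixes the ratio of two coordinates of
    the column, and these six constants are the ratios.\<close>
  define X where "X = - a2 10 / a1 10"
  define Y where "Y = - a2 7 / a1 7"
  define Z where "Z = - a3 3 / a2 3"
  define W where "W = - a3 2 / a2 2"
  define T where "T = - a3 6 / a1 6"
  define V where "V = - a3 5 / a1 5"
  have inc0: "a1 i * b1 j + a2 i * b2 j + a3 i * b3 j = 0" if "incidence i j = 1" "i < 13" "j < 13" for i j
    using N[OF that(2,3)] z[OF that] by simp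
  have ratio: "u = r * w" if "a * u + b * w = 0" "a \<noteq> 0" "r = - b / a" for u w a b r :: 'a
  proof -
    have "a * u = - (b * w)" by (rule eq_neg_iff_add_eq_0[THEN iffD2, OF that(1)])
    also have "\<dots> = a * (r * w)" unfolding that(3) using that(2) by simp
    finally show ?thesis using that(2) by simp
  qed
  have i10: "incidence 10 8 = 1" "incidence 10 9 = 1" and i7: "incidence 7 10 = 1" "incidence 7 11 = 1" "incidence 7 12 = 1"
    and i3: "incidence 3 8 = 1" "incidence 3 12 = 1" and i2: "incidence 2 9 = 1" "incidence 2 11 = 1" "incidence 2 3 = 1"
    and i6: "incidence 6 8 = 1" "incidence 6 11 = 1" and i5: "incidence 5 9 = 1" "incidence 5 12 = 1"
    and i8: "incidence 8 10 = 1" "incidence 8 3 = 1" "incidence 8 8 = 1"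
    by (simp_all add: inc)
  have x: "b1 8 = X * b2 8" "b1 9 = X * b2 9"
    using inc0[OF i10(1)] inc0[OF i10(2)] a0 by (auto intro!: ratio[OF _ an(1) X_def])
  have y: "b1 10 = Y * b2 10" "b1 11 = Y * b2 11" "b1 12 = Y * b2 12"
    using inc0[OF i7(1)] inc0[OF i7(2)] inc0[OF i7(3)] a0 by (auto intro!: ratio[OF _ an(2) Y_def])
  have zz: "b2 8 = Z * b3 8" "b2 12 = Z * b3 12"
    using inc0[OF i3(1)] inc0[OF i3(2)] a0 by (auto intro!: ratio[OF _ an(3) Z_def])
  have w: "b2 9 = W * b3 9" "b2 11 = W * b3 11" "b2 3 = W * b3 3"
    using inc0[OF i2(1)] inc0[OF i2(2)] inc0[OF i2(3)] a0 by (auto intro!: ratio[OF _ an(4) W_def])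
  have t: "b1 8 = T * b3 8" "b1 11 = T * b3 11"
    using inc0[OF i6(1)] inc0[OF i6(2)] a0 by (auto intro!: ratio[OF _ an(5) T_def])
  have v: "b1 9 = V * b3 9" "b1 12 = V * b3 12"
    using inc0[OF i5(1)] inc0[OF i5(2)] a0 by (auto intro!: ratio[OF _ an(6) V_def])
  have prods: "T = X * Z" "V = X * W" "T = Y * W" "V = Y * Z"
    using t v x y zz w bn by (simp_all add: mult.assoc[symmetric])
  have Zn: "Z \<noteq> 0" "W \<noteq> 0" using zz(1) w(1) bn by auto
  \<comment> \<open>The nonincidence of 10 with itself is what separates the two ratios
    \<open>X\<close> and \<open>Y\<close>.\<close>
  have "N 10 10 \<noteq> 0" by (rule nz; simp add: inc)
  then have "a1 10 * (Y * b2 10) + a2 10 * b2 10 \<noteq> 0" using N[of 10 10] a0 y(1) by simp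
  moreover have "a2 10 = - X * a1 10" using an(1) by (simp add: X_def)
  ultimately have XY: "X \<noteq> Y" by (auto simp: algebra_simps)
  have "X * Z = Y * W" "X * W = Y * Z" using prods by auto
  then have "(X * X) * (Z * W) = (Y * Y) * (Z * W)" by (metis mult.assoc mult.commute mult.left_commute)
  then have "X * X = Y * Y" using Zn by simp
  then have Y: "Y = - X" using XY by (metis square_eq_iff minus_minus)
  have Xn: "X \<noteq> 0" using x(1) bn by auto
  have "X * W = X * - Z" using \<open>X * W = Y * Z\<close> Y by simp
  then have W: "W = - Z" using Xn mult_left_cancel by blast
  have "a1 8 * (Y * b2 10) + a2 8 * b2 10 = 0" using inc0[OF i8(1)] b0 y(1) by simp
  then have "(a2 8 - X * a1 8) * b2 10 = 0" unfolding Y by (simp add: algebra_simps)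
  then have a28: "a2 8 = X * a1 8" using bn by simp
  have "a2 8 * (W * b3 3) + a3 8 * b3 3 = 0" using inc0[OF i8(2)] b0 w(3) by simp
  then have "(a3 8 - Z * a2 8) * b3 3 = 0" unfolding W by (simp add: algebra_simps)
  then have a38: "a3 8 = Z * a2 8" using bn by simp
  \<comment> \<open>Index 8 is the vector (1, 1, 1) modulo 3, which is orthogonal to itself only
    there: its three summands are equal, so their sum 0 would need characteristic 3.\<close>
  have "a1 8 * b1 8 = a2 8 * b2 8" "a2 8 * b2 8 = a3 8 * b3 8" using x(1) zz(1) a28 a38 by simp_all
  then have "3 * (a1 8 * b1 8) = 0" using inc0[OF i8(3)] by simp
  then show False using an(7) bn by simp
qed

text \<open>All entries of a lift have nonnegative order, so taking constant coefficients commutes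
  with forming minors. The constant coefficient vanishes exactly where the degree is 1, that is, at
  the incidences.\<close>

lemma obstruction_13_4: "obstruction 13 4 (\<lambda>i j. real (incidence i j))"
  unfolding obstruction_def
proof (intro conjI allI impI)
  show "symmetric_mat 13 (\<lambda>i j. real (incidence i j))"
    unfolding symmetric_mat_def using incidence_sym by metis
  show "sym_trop_singular (\<lambda>i j. real (incidence i j)) I J"
    if "I \<subseteq> {..<13} \<and> J \<subseteq> {..<13} \<and> card I = 4 \<and> card J = 4" for I J
    using incidence_singular that by blast
  show "\<not> (\<exists>M. lift_of 13 (\<lambda>i j. real (incidence i j)) M \<and> rank_le 13 M (4 - 1))"
  proof
    assume "\<exists>M. lift_of 13 (\<lambda>i j. real (incidence i j)) M \<and> rank_le 13 M (4 - 1)"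
    then obtain M where M: "lift_of 13 (\<lambda>i j. real (incidence i j)) M" "rank_le 13 M 3" by auto
    define N where "N i j = coef (M i j) 0" for i j
    have ld: "\<exists>c. c \<noteq> 0 \<and> lead (real (incidence i j)) c (M i j)" if "i < 13" "j < 13" for i j
      using M(1) that unfolding lift_of_def by blast
    have l0: "lead 0 (N i j) (M i j)" and zero: "N i j = 0 \<longleftrightarrow> 3 dvd gram i j" if ij: "i < 13" "j < 13" for i j
    proof -
      obtain c where c: "c \<noteq> 0" "lead (real (incidence i j)) c (M i j)" using ld[OF ij] by blast
      show "lead 0 (N i j) (M i j)" using c(2) by (auto simp: lead_def N_def)
      show "N i j = 0 \<longleftrightarrow> 3 dvd gram i j" using c by (auto simp: lead_def N_def incidence_def split: if_splits)
    qed
    have "rank_le 13 N 3"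
      unfolding rank_le_def
    proof (intro allI impI)
      fix f g :: "nat \<Rightarrow> nat" assume fg: "\<forall>i<Suc 3. f i < 13 \<and> g i < 13"
      have "lead 0 (of_int (sign p) * (\<Prod>i = 0..<Suc 3. N (f i) (g (p i)))) (of_int (sign p) * (\<Prod>i = 0..<Suc 3. M (f i) (g (p i))))"
        if p: "p permutes {0..<Suc 3}" for p
      proof -
        have "lead (\<Sum>i = 0..<Suc 3. 0) (\<Prod>i = 0..<Suc 3. N (f i) (g (p i))) (\<Prod>i = 0..<Suc 3. M (f i) (g (p i)))"
        proof (rule lead_prod)
          fix i assume "i \<in> {0..<Suc 3}"
          then have "i < Suc 3" "p i < Suc 3" using permutes_in_image[OF p, of i] by auto
          then show "lead 0 (N (f i) (g (p i))) (M (f i) (g (p i)))" using l0 fg by blast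
        qed simp
        then show ?thesis by (simp add: lead_def coef_sign_mult)
      qed
      then have "lead 0 (sub_det N (Suc 3) f g) (sub_det M (Suc 3) f g)"
        unfolding sub_det_expand by (intro lead_sum) auto
      moreover have "sub_det M (Suc 3) f g = 0" using M(2) fg unfolding rank_le_def by blast
      ultimately show "sub_det N (Suc 3) f g = 0" by (simp add: lead_def)
    qed
    then show False using zero by (rule projective_plane_3_rank)
  qed
qed

theorem theorem1:
  fixes n r :: nat
  assumes "1 \<le> r" and "r \<le> n"
  shows "(r = 2 \<or> r = 3 \<or> r = n \<longrightarrow> sym_minors_tropical_basis n r) \<and>
         ((4 < r \<and> r < n) \<or> (r = 4 \<and> 12 < n) \<longrightarrow> \<not> sym_minors_tropical_basis n r)"
proof (intro conjI impI)
  assume r: "r = 2 \<or> r = 3 \<or> r = n"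
  show "sym_minors_tropical_basis n r"
    unfolding tropical_basis_iff[OF assms(1)]
  proof (intro allI impI)
    fix A
    assume sym: "symmetric_mat n A" and sing: "\<forall>I J. I \<subseteq> {..<n} \<and> J \<subseteq> {..<n} \<and> card I = r \<and> card J = r \<longrightarrow> sym_trop_singular A I J"
    from r show "\<exists>M. lift_of n A M \<and> rank_le n M (r - 1)"
    proof (elim disjE)
      assume "r = 2"
      then show ?thesis using lift_exists_2[OF _ sym] sing assms(2) by simp
    next
      assume "r = 3"
      then show ?thesis using lift_exists_3[OF _ sym] sing assms(2) by simp
    next
      assume "r = n"
      then show ?thesis using lift_exists_full[OF _ sym] sing assms(1) by simp
    qed
  qed
next
  assume "(4 < r \<and> r < n) \<or> (r = 4 \<and> 12 < n)"
  then have "\<exists>A. obstruction n r A"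
  proof
    assume r: "4 < r \<and> r < n"
    \<comment> \<open>Bordering \<open>r - 5\<close> times leads from size 6 and minors of size 5 to
      size \<open>r + 1\<close> and minors of size \<open>r\<close>; duplication then reaches size
      \<open>n\<close>.\<close>
    obtain A where "obstruction (6 + (r - 5)) (5 + (r - 5)) A" using obstruction_add_both[OF obstruction_6_5] by auto
    then have "obstruction (Suc r) r A" using r by simp
    then have "\<exists>A. obstruction (Suc r + (n - Suc r)) r A" by (rule obstruction_add_n) simp
    then show ?thesis using r by simp
  next
    assume r: "r = 4 \<and> 12 < n"
    have "\<exists>A. obstruction (13 + (n - 13)) 4 A" by (rule obstruction_add_n[OF obstruction_13_4]) simp
    then show ?thesis using r by simp
  qed
  then show "\<not> sym_minors_tropical_basis n r" using not_tropical_basis_of_obstruction[OF assms(1)] by blast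
qed

end
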